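(* Let $\mathbf{K}$ be an algebraic function field of one variable with algebraically closed constant field $\mathbf{k}$ of characteristic $p\ge 0$, let $C$ be the associated smooth projective curve over $\mathbf{k}$ and $\mathfrak{g}$ its genus. Let $f\in\mathbf{K}$ be non-constant and let $S$ be a finite set of points of $C$ such that $f\in\mathcal{O}_S$. Let $m\ge1$ and let $\lambda_1,\ldots,\lambda_m$ be non-zero elements of $\mathcal{O}_S$ such that there exists a real number $\rho<1$ with $$\sum_{i=1}^m h(\lambda_i)\leq\frac{\rho\,h(f)}{\deg_{ins}(f)},$$ where $\deg_{ins}(f)=1$ if $p=0$, and $\deg_{ins}(f)=p^{\ell}$ if $p>0$ and $f\in\mathbf{K}^{p^{\ell}}\setminus\mathbf{K}^{p^{\ell+1}}$. Fix an $m$-tuple of integers $(r_1,\ldots,r_m)$ and an $m$-tuple of roots of unity $(\epsilon_1,\ldots,\epsilon_m)$ in $\mathbf{k}$, and for $n\in\mathbb{Z}$ let $$B(n):=\lambda_1(\epsilon_1 f^{r_1})^n+\cdots+\lambda_m(\epsilon_m f^{r_m})^n .$$ Let $N=\max\{r_1,\ldots,r_m\}-\min\{r_1,\ldots,r_m\}$. Fix an integer $e>\frac{2-\rho}{1-\rho}(2\mathfrak{g}+|S|)$, not divisible by $p$ if $p>0$, such that $\epsilon_i^e=1$ for all $i=1,\ldots,m$. Let $a$ be a positive integer such that $$q^{\,1+\operatorname{ord}_q a-\operatorname{ord}_q e}>N+\frac{2-\rho}{1-\rho}(2\mathfrak{g}+|S|)$$ for every prime divisor $q$ of $e$. Assume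 that there exists an integer $k$ such that $v_{\mathfrak{p}}(B(k))\ge\min\{1,v_{\mathfrak{p}}(f^a-1)\}$ for all $\mathfrak{p}\in C\setminus S$. Then: (i) If $e$ divides $k$, then $\lambda_1+\cdots+\lambda_m=0$, i.e. $B(0)=0$. (ii) If $e$ does not divide $k$, then $\sum_{i=1}^m\lambda_i\epsilon_i^kX^{r_i}\in\mathbf{K}[X,X^{-1}]$ is the zero polynomial; in particular $B(k)=0$.
   Context: For each point $\mathfrak{p}\in C$, $v_{\mathfrak{p}}=\operatorname{ord}_{\mathfrak{p}}:\mathbf{K}\to\mathbb{Z}\cup\{\infty\}$ is the normalized order function (valuation) at $\mathfrak{p}$, with $v_{\mathfrak{p}}(0)=\infty$. For a finite set $S$ of points of $C$, $\mathcal{O}_S=\{g\in\mathbf{K}: v_{\mathfrak{p}}(g)\ge 0\text{ for all }\mathfrak{p}\in C\setminus S\}$. The height of $g\in\mathbf{K}$ is $h(g)=\sum_{\mathfrak{p}\in C}-\min\{0,v_{\mathfrak{p}}(g)\}$. For $p>0$, $\mathbf{K}^{p^\ell}=\{g^{p^\ell}:g\in\mathbf{K}\}$. For a prime number $q$, $\operatorname{ord}_q$ is the $q$-adic valuation on integers. *)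

theory Defs
  imports
    Complex_Main
    "HOL-Computational_Algebra.Computational_Algebra"
    "HOL-Library.Extended"
    "HOL-Library.Poly_Mapping"
begin

text \<open>
  The field of constants is a type \<open>'k\<close>, the function field is a type \<open>'a\<close>, and
  \<open>emb :: 'k \<Rightarrow> 'a\<close> is the inclusion of the constants.
\<close>

definition ratfun_field :: "('k::field \<Rightarrow> 'a::field) \<Rightarrow> 'a \<Rightarrow> 'a set" where
  "ratfun_field emb x =
     {poly (map_poly emb p) x / poly (map_poly emb q) x | p q. poly (map_poly emb q) x \<noteq> 0}"

text \<open>
  A function field of one variable is a finite extension of \<open>k(x)\<close> for some \<open>x\<close> transcendental
  over the constants \<open>k\<close>.  When \<open>k\<close> is algebraically closed it is automatically the full field
  of constants.
\<close>

locale function_field =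
  fixes emb :: "'k::alg_closed_field \<Rightarrow> 'a::field"
  assumes emb_add: "emb (c + d) = emb c + emb d"
    and emb_mult: "emb (c * d) = emb c * emb d"
    and emb_one: "emb 1 = 1"
    and finite_over_ratfun_field:
      "\<exists>x. (\<forall>p. p \<noteq> 0 \<longrightarrow> poly (map_poly emb p) x \<noteq> 0) \<and>
           (\<exists>Bs. finite Bs \<and>
             (\<forall>y. \<exists>c. (\<forall>b\<in>Bs. c b \<in> ratfun_field emb x) \<and> y = (\<Sum>b\<in>Bs. c b * b)))"

text \<open>
  The closed points of the smooth projective curve with function field \<open>'a\<close> are identified with
  their normalized order functions, that is, with the discrete valuations of the function field
  that are trivial on the constants and have value group \<open>\<int>\<close>.  The value \<open>\<infinity>\<close>
  is \<open>Pinf\<close>; the range condition excludes \<open>Minf\<close>.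
\<close>

definition points :: "('k::field \<Rightarrow> 'a::field) \<Rightarrow> ('a \<Rightarrow> int extended) set" where
  "points emb = {v.
     (\<forall>x. v x = Pinf \<longleftrightarrow> x = 0) \<and>
     (\<forall>x y. v (x * y) = v x + v y) \<and>
     (\<forall>x y. min (v x) (v y) \<le> v (x + y)) \<and>
     (\<forall>c. c \<noteq> 0 \<longrightarrow> v (emb c) = 0) \<and>
     range v = insert Pinf (range Fin)}"

text \<open>
  A divisor is a finitely supported integer-valued function on the points.  All points have
  degree one, because the constant field is algebraically closed.
\<close>

definition divisors ::
    "('k::field \<Rightarrow> 'a::field) \<Rightarrow> (('a \<Rightarrow> int extended) \<Rightarrow> int) set" where
  "divisors emb = {D. finite {v. D v \<noteq> 0} \<and> {v. D v \<noteq> 0} \<subseteq> points emb}"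

definition div_degree :: "(('a \<Rightarrow> int extended) \<Rightarrow> int) \<Rightarrow> int" where
  "div_degree D = (\<Sum>v | D v \<noteq> 0. D v)"

definition riemann_roch_space ::
    "('k::field \<Rightarrow> 'a::field) \<Rightarrow> (('a \<Rightarrow> int extended) \<Rightarrow> int) \<Rightarrow> 'a set" where
  "riemann_roch_space emb D = {g. \<forall>v\<in>points emb. Fin (- D v) \<le> v g}"

definition div_dim ::
    "('k::field \<Rightarrow> 'a::field) \<Rightarrow> (('a \<Rightarrow> int extended) \<Rightarrow> int) \<Rightarrow> nat" where
  "div_dim emb D = vector_space.dim (\<lambda>c x. emb c * x) (riemann_roch_space emb D)"

text \<open>
  The genus as it is defined for function fields: the maximum of
  \<open>deg D + 1 - l(D)\<close> over all divisors \<open>D\<close>.  It exists by Riemann's theorem.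
\<close>

definition genus :: "('k::field \<Rightarrow> 'a::field) \<Rightarrow> int" where
  "genus emb = (SUP D\<in>divisors emb. div_degree D + 1 - int (div_dim emb D))"

definition S_integers ::
    "('k::field \<Rightarrow> 'a::field) \<Rightarrow> ('a \<Rightarrow> int extended) set \<Rightarrow> 'a set" where
  "S_integers emb S = {g. \<forall>v\<in>points emb - S. 0 \<le> v g}"

text \<open>
  \<open>pole_order n\<close> is \<open>- min {0, n}\<close> for \<open>n\<close> in \<open>\<int> \<union> {\<infinity>}\<close>; \<open>Minf\<close> is never a value of a point.
  An element of a function field has only finitely many poles, so the sum in
  the height is over a finite set.
\<close>

definition pole_order :: "int extended \<Rightarrow> int" where
  "pole_order n = (case n of Fin i \<Rightarrow> - min 0 i | _ \<Rightarrow> 0)"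

definition height :: "('k::field \<Rightarrow> 'a::field) \<Rightarrow> 'a \<Rightarrow> int" where
  "height emb g = (\<Sum>v | v \<in> points emb \<and> v g < 0. pole_order (v g))"

text \<open>
  In positive characteristic the exponent below exists and is unique when \<open>f\<close> is a
  non-constant element of a function field.
\<close>

definition deg_ins :: "'a::field \<Rightarrow> nat" where
  "deg_ins f = (if CHAR('a) = 0 then 1 else
     CHAR('a) ^ (THE l. f \<in> range (\<lambda>g. g ^ (CHAR('a) ^ l)) \<and>
                       f \<notin> range (\<lambda>g. g ^ (CHAR('a) ^ (l + 1)))))"

text \<open>The following facts confirm that \<open>div_dim\<close> is a dimension over the
  constants and that \<open>deg_ins\<close> refers to the characteristic of the constants.\<close>

context function_field
begin

lemma emb_zero: "emb 0 = 0"
  using emb_add[of 0 0] by (metis add_0 add_cancel_right_right)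

lemma emb_inj: "emb c = emb d \<longleftrightarrow> c = d"
proof
  assume eq: "emb c = emb d"
  have "emb (c - d) = 0"
    using emb_add[of "c - d" d] eq by simp
  then show "c = d"
    using emb_mult[of "c - d" "inverse (c - d)"] emb_one by (cases "c = d") auto
qed simp

lemma vector_space_emb: "vector_space (\<lambda>c x. emb c * x)"
  by unfold_locales (simp_all add: algebra_simps emb_add emb_mult emb_one)

lemma CHAR_eq: "CHAR('a) = CHAR('k)"
proof (rule CHAR_eqI)
  have of_nat: "emb (of_nat n) = of_nat n" for n
    by (induction n) (simp_all add: emb_add emb_one emb_zero)
  show "of_nat CHAR('k) = (0::'a)"
    using of_nat[of "CHAR('k)"] by (simp add: emb_zero)
  show "CHAR('k) dvd n" if "of_nat n = (0::'a)" for n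
    using that of_nat[of n] emb_inj[of "of_nat n" 0] by (simp add: emb_zero of_nat_eq_0_iff_char_dvd)
qed

end

end

theory Submission
  imports Defs
begin

text \<open>
  Write \<open>f = f0^D\<close> with \<open>D = deg_ins f\<close>, so that \<open>f0\<close> is not a \<open>p\<close>-th power, and let \<open>d\<close> be
  the height of \<open>f0\<close>.  If \<open>v\<close> lies outside \<open>S\<close> and \<open>f0\<close> takes at \<open>v\<close> the value \<open>z\<close> with
  \<open>z^a = 1\<close>, then the hypothesis on \<open>B k\<close> says that \<open>L(y) = \<Sum>i. lam i * \<epsilon> i^k * y^(r i)\<close>,
  evaluated at the constant \<open>y = z^(D k)\<close>, vanishes at \<open>v\<close>.  As the height of \<open>L(y)\<close> is at most
  \<open>\<rho> d\<close>, a non-zero \<open>L(y)\<close> has at most \<open>\<rho> d\<close> zeros.  On the other hand, \<open>f0\<close> takes values in a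
  finite set \<open>Z\<close> of constants at no fewer than \<open>(|Z| - 2 g - |S|) d\<close> points outside \<open>S\<close>.
  In case (i) take for \<open>Z\<close> the \<open>e\<close>-th roots of unity; in case (ii) take a prime \<open>q\<close> with
  \<open>ord_q k < ord_q e\<close> and roots of unity of order dividing \<open>q^(ord_q a)\<close>: their powers
  \<open>z^(D k)\<close> are too many to be roots of a non-zero Laurent polynomial of width \<open>N\<close>.

  The lower bound for the number of points replaces the Riemann-Hurwitz formula by a weaker
  estimate that needs no differentials.  Let \<open>R\<close> be the divisor with coefficients \<open>e_v - 1\<close> at the
  points over \<open>Z\<close>.  The trace of \<open>K\<close> over \<open>k(f0)\<close> maps an element with poles bounded by \<open>R\<close> and with
  zeros at all poles of \<open>f0\<close> to an element without poles that vanishes at infinity, hence to \<open>0\<close>.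
  Since \<open>L((g + 1) (f0)_\<infinity>)\<close> spans \<open>K\<close> over \<open>k(f0)\<close>, the space
  \<open>L(R - (g + 1) (f0)_\<infinity> - \<Sum> v)\<close>, with \<open>v\<close> running over the poles of \<open>f0\<close>, is orthogonal to \<open>K\<close> under
  the trace form, so it is zero, and the definition of the genus bounds the degree of \<open>R\<close>.
\<close>

section \<open>Valuations and rational functions of an element\<close>

text \<open>The trace argument says nothing if the trace form is zero, as it is when K is
  inseparable over \<open>k(f0)\<close>; hence the passage from \<open>f\<close> to
  \<open>f0\<close>. In characteristic 0 the trace of 1 is the degree. In characteristic p one
  unramified point over one value of \<open>f0\<close> suffices, because there the trace is seen to
  be non-zero. Such a point exists since the p-th powers of a basis over \<open>k(f0)\<close> are a
  basis again, while the p-th power of a regular element differs from a constant by order at least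
  p: over a general value they leave no room for an element of order 1 at a ramified point. The
  equality of [K : k(x)] with the pole degree of x and the behaviour of the trace come from one
  device: families adapted to a fibre, with coordinates compared through leading terms. The constant
  in the hypotheses is shaped by case (ii). If L is non-zero for n of the values, the two counts
  give n d <= n \<rho> d + (2 g + |S|) d, so n is at most (2 g + |S|) / (1 - \<rho>), which is below
  the assumed bound; the summand N pays for the values at which L vanishes. In case (i) all values
  give the same function, and \<rho> d is paid only once.\<close>

locale vector_space_families = vector_space scale
  for scale :: "'s::field \<Rightarrow> 'b::ab_group_add \<Rightarrow> 'b" (infixr "*s" 75)
begin

text \<open>Indexed families allow products such as \<open>x ^ j * u i\<close> to be treated before
  their members are known to be distinct; independence then implies distinctness. The locale is used
  twice on the same field, with scalars in k and with scalars in k(x).\<close>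

definition fam_indep :: "'i set \<Rightarrow> ('i \<Rightarrow> 'b) \<Rightarrow> bool" where
  "fam_indep I u \<longleftrightarrow> (\<forall>a. (\<Sum>i\<in>I. a i *s u i) = 0 \<longrightarrow> (\<forall>i\<in>I. a i = 0))"

lemma fam_indepI:
  "(\<And>a i. (\<Sum>i\<in>I. a i *s u i) = 0 \<Longrightarrow> i \<in> I \<Longrightarrow> a i = 0) \<Longrightarrow> fam_indep I u"
  by (auto simp: fam_indep_def)

lemma fam_indepD:
  "fam_indep I u \<Longrightarrow> (\<Sum>i\<in>I. a i *s u i) = 0 \<Longrightarrow> i \<in> I \<Longrightarrow> a i = 0"
  by (auto simp: fam_indep_def)

lemma fam_indep_inj:
  assumes "finite I" "fam_indep I u"
  shows "inj_on u I"
proof (rule inj_onI, rule ccontr)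
  fix i j assume ij: "i \<in> I" "j \<in> I" "u i = u j" "i \<noteq> j"
  define a where "a = (\<lambda>k. if k = i then 1 else if k = j then -1 else 0 :: 's)"
  have "(\<Sum>k\<in>I. a k *s u k) = (\<Sum>k\<in>{i,j}. a k *s u k)"
    by (rule sum.mono_neutral_right) (use assms ij in \<open>auto simp: a_def\<close>)
  also have "\<dots> = 0"
    using ij by (auto simp: a_def)
  finally have "a i = 0"
    using fam_indepD[OF assms(2)] ij by blast
  then show False by (simp add: a_def)
qed

lemma fam_indep_independent:
  assumes "finite I" "fam_indep I u"
  shows "independent (u ` I)"
proof (rule independent_if_scalars_zero)
  fix f y assume *: "(\<Sum>z\<in>u ` I. f z *s z) = 0" "y \<in> u ` I"
  then obtain i where i: "i \<in> I" "y = u i" by auto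
  have "(\<Sum>i\<in>I. f (u i) *s u i) = 0"
    using *(1) by (simp add: sum.reindex[OF fam_indep_inj[OF assms]])
  from fam_indepD[OF assms(2) this i(1)] show "f y = 0" by (simp add: i)
qed (use assms in auto)

lemma independent_fam_indep:
  assumes "independent B" "finite B"
  shows "fam_indep B (\<lambda>b. b)"
  using assms independentD[OF assms(1) assms(2) subset_refl] by (auto simp: fam_indep_def)

lemma fam_indep_card_span:
  assumes "finite I" "fam_indep I u" "u ` I \<subseteq> span T" "finite T"
  shows "card I \<le> card T"
  using independent_span_bound[OF assms(4) fam_indep_independent[OF assms(1,2)] assms(3)]
  by (simp add: card_image[OF fam_indep_inj[OF assms(1,2)]])

text \<open>\<open>dim\<close> is a cardinality and is 0 when all bases are infinite, so an
  independent family bounds it from below only if finite dimension is known.\<close>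

definition fin_dim :: "'b set \<Rightarrow> bool" where
  "fin_dim W \<longleftrightarrow> (\<exists>T. finite T \<and> W \<subseteq> span T)"

lemma fin_dim_basis:
  assumes "fin_dim W"
  obtains B where "B \<subseteq> W" "independent B" "finite B" "W \<subseteq> span B" "card B = dim W"
proof -
  obtain B where B: "B \<subseteq> W" "independent B" "W \<subseteq> span B" "card B = dim W"
    by (rule basis_exists)
  moreover have "finite B"
    using assms B independent_span_bound[of _ B] by (auto simp: fin_dim_def)
  ultimately show ?thesis by (intro that)
qed

lemma fam_indep_dim:
  assumes "finite I" "fam_indep I u" "u ` I \<subseteq> W" "fin_dim W"
  shows "card I \<le> dim W"
proof -
  obtain B where "independent B" "finite B" "W \<subseteq> span B" "card B = dim W"
    using fin_dim_basis[OF assms(4)] by metis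
  then show ?thesis
    using fam_indep_card_span[OF assms(1,2), of B] assms(3) by auto
qed

lemma dim_insert_le:
  assumes "W \<subseteq> span (insert u W')" "fin_dim W'"
  shows "fin_dim W" "dim W \<le> dim W' + 1"
proof -
  obtain B where B: "finite B" "W' \<subseteq> span B" "card B = dim W'"
    using fin_dim_basis[OF assms(2)] by metis
  have "insert u W' \<subseteq> span (insert u B)"
    using B(2) span_mono[of B "insert u B"] by (auto intro: span_base)
  then have W: "W \<subseteq> span (insert u B)"
    using assms(1) span_minimal[OF _ subspace_span] by blast
  then show "fin_dim W" using B(1) by (auto simp: fin_dim_def)
  have "dim W \<le> card (insert u B)"
    by (rule dim_le_card[OF W]) (use B in auto)
  also have "\<dots> \<le> card B + 1" using B(1) by (simp add: card_insert_if)
  finally show "dim W \<le> dim W' + 1" using B by simp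
qed

lemma fin_dim_subset: "fin_dim W \<Longrightarrow> W' \<subseteq> W \<Longrightarrow> fin_dim W'"
  by (auto simp: fin_dim_def)

end

section \<open>Integer orders at a point\<close>

definition vord :: "('a::field \<Rightarrow> int extended) \<Rightarrow> 'a \<Rightarrow> int" where
  "vord v y = (case v y of Fin i \<Rightarrow> i | _ \<Rightarrow> 0)"

text \<open>The element 0 satisfies every bound, its order being infinite. In this form inequalities
  pass to sums and products without a case distinction, although \<open>vord\<close> has the dummy
  value 0 at 0.\<close>

definition vge :: "('a::field \<Rightarrow> int extended) \<Rightarrow> int \<Rightarrow> 'a \<Rightarrow> bool" where
  "vge v n y \<longleftrightarrow> y = 0 \<or> n \<le> vord v y"

context function_field
begin

abbreviation "P \<equiv> points emb"

sublocale V: vector_space_families "\<lambda>c x. emb c * x"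
  by (simp add: vector_space_families_def vector_space_emb)

lemma emb_0_iff [simp]: "emb c = 0 \<longleftrightarrow> c = 0"
  using emb_inj[of c 0] by (simp add: emb_zero)

lemma emb_minus: "emb (- c) = - emb c"
  by (metis add.right_inverse add_eq_0_iff emb_add emb_zero)

lemma emb_diff: "emb (c - d) = emb c - emb d"
  using emb_add[of c "-d"] by (simp add: emb_minus)

lemma emb_power: "emb (c ^ n) = emb c ^ n"
  by (induction n) (auto simp: emb_one emb_mult)

lemma emb_inverse: "emb (inverse c) = inverse (emb c)"
  by (cases "c = 0") (auto simp: emb_zero emb_one emb_mult[symmetric] intro!: inverse_unique[symmetric])

lemma emb_divide: "emb (c / d) = emb c / emb d"
  by (simp add: field_class.field_divide_inverse emb_mult emb_inverse)

lemma emb_sum: "emb (sum g A) = (\<Sum>i\<in>A. emb (g i))"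
  by (induction A rule: infinite_finite_induct) (auto simp: emb_zero emb_add)

lemma emb_powi: "emb (c powi n) = emb c powi n"
  by (cases "n \<ge> 0") (auto simp: power_int_def emb_power emb_inverse)

lemma pt_0 [simp]: "v \<in> P \<Longrightarrow> v 0 = Pinf"
  by (auto simp: points_def)

lemma pt_Fin: 
  assumes "v \<in> P" "y \<noteq> 0" shows "v y = Fin (vord v y)"
proof -
  have "v y \<in> insert Pinf (range Fin)" "v y \<noteq> Pinf"
    using assms by (auto simp: points_def)
  then show ?thesis by (auto simp: vord_def)
qed

lemma vge_iff: "v \<in> P \<Longrightarrow> Fin n \<le> v y \<longleftrightarrow> vge v n y"
  by (cases "y = 0") (auto simp: vge_def pt_Fin)

lemma vord_mult:
  assumes "v \<in> P" "y \<noteq> 0" "z \<noteq> 0"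
  shows "vord v (y * z) = vord v y + vord v z"
proof -
  have "v (y * z) = v y + v z" using assms by (auto simp: points_def)
  then show ?thesis using assms by (simp add: pt_Fin)
qed

lemma vord_emb [simp]: 
  assumes "v \<in> P" shows "vord v (emb c) = 0"
  using assms emb_0_iff[of c] by (cases "c = 0") (auto simp: points_def vord_def zero_extended_def emb_zero)

lemma vord_zero [simp]: "v \<in> P \<Longrightarrow> vord v 0 = 0"
  by (auto simp: vord_def)

lemma vord_one [simp]: "v \<in> P \<Longrightarrow> vord v 1 = 0"
  using vord_emb[of v 1] by (simp add: emb_one)

lemma vord_inverse: 
  assumes "v \<in> P" shows "vord v (inverse y) = - vord v y"
proof (cases "y = 0")
  case False
  then have "vord v (y * inverse y) = vord v y + vord v (inverse y)"
    using assms by (intro vord_mult) auto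
  then show ?thesis using False assms by simp
qed (use assms in auto)

lemma vord_divide: "v \<in> P \<Longrightarrow> y \<noteq> 0 \<Longrightarrow> z \<noteq> 0 \<Longrightarrow> vord v (y / z) = vord v y - vord v z"
  by (simp add: field_class.field_divide_inverse vord_mult vord_inverse)

lemma vord_power: "v \<in> P \<Longrightarrow> y \<noteq> 0 \<Longrightarrow> vord v (y ^ n) = int n * vord v y"
  by (induction n) (auto simp: vord_mult algebra_simps)

lemma vord_powi: "v \<in> P \<Longrightarrow> y \<noteq> 0 \<Longrightarrow> vord v (y powi n) = n * vord v y"
  by (cases "n \<ge> 0") (auto simp: power_int_def vord_power vord_inverse)

lemma vord_minus [simp]: "v \<in> P \<Longrightarrow> vord v (- y) = vord v y"
  using vord_mult[of v "emb (-1)" y] vord_emb[of v "-1"]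
  by (cases "y = 0") (auto simp: emb_minus emb_one simp del: vord_emb)

lemma vge_0 [simp]: "vge v n 0" by (simp add: vge_def)

lemma vge_self [simp]: "vge v (vord v y) y" by (simp add: vge_def)

lemma vge_add:
  assumes "v \<in> P" "vge v n y" "vge v n z" shows "vge v n (y + z)"
proof -
  have "min (v y) (v z) \<le> v (y + z)" using assms(1) by (auto simp: points_def)
  moreover have "Fin n \<le> min (v y) (v z)" using assms by (simp add: vge_iff)
  ultimately have "Fin n \<le> v (y + z)" by (rule order_trans[rotated])
  then show ?thesis using assms by (simp add: vge_iff)
qed

lemma vge_minus: "v \<in> P \<Longrightarrow> vge v n y \<Longrightarrow> vge v n (- y)"
  by (auto simp: vge_def)

lemma vge_diff: "v \<in> P \<Longrightarrow> vge v n y \<Longrightarrow> vge v n z \<Longrightarrow> vge v n (y - z)"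
  using vge_add[of v n y "-z"] vge_minus[of v n z] by simp

lemma vge_sum: "v \<in> P \<Longrightarrow> (\<And>i. i \<in> I \<Longrightarrow> vge v n (g i)) \<Longrightarrow> vge v n (sum g I)"
  by (induction I rule: infinite_finite_induct) (auto intro: vge_add)

lemma vge_mult: "v \<in> P \<Longrightarrow> vge v n y \<Longrightarrow> vge v m z \<Longrightarrow> vge v (n + m) (y * z)"
  by (cases "y = 0"; cases "z = 0") (auto simp: vge_def vord_mult)

lemma vge_mono: "vge v n y \<Longrightarrow> m \<le> n \<Longrightarrow> vge v m y"
  by (auto simp: vge_def)

lemma vge_emb [simp]: "v \<in> P \<Longrightarrow> vge v 0 (emb c)" by (auto simp: vge_def)

lemma vge_one [simp]: "v \<in> P \<Longrightarrow> vge v 0 1" by (auto simp: vge_def)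

lemma vge_emb_mult: "v \<in> P \<Longrightarrow> vge v n y \<Longrightarrow> vge v n (emb c * y)"
  using vge_mult[of v 0 "emb c" n y] by simp

lemma vge_cancel: "v \<in> P \<Longrightarrow> z \<noteq> 0 \<Longrightarrow> vge v (n + vord v z) (y * z) \<longleftrightarrow> vge v n y"
  by (cases "y = 0") (auto simp: vge_def vord_mult)

lemma vge_power: "v \<in> P \<Longrightarrow> vge v 0 y \<Longrightarrow> vge v 0 (y ^ n)"
  by (cases "y = 0"; cases "n = 0") (auto simp: vge_def vord_power)

lemma vge_not_emb: "v \<in> P \<Longrightarrow> vge v 1 (emb c) \<Longrightarrow> c = 0"
  by (auto simp: vge_def)

lemma vord_add_eq:
  assumes "v \<in> P" "y \<noteq> 0" "vge v (vord v y + 1) z"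
  shows "y + z \<noteq> 0 \<and> vord v (y + z) = vord v y"
proof (cases "z = 0")
  case False
  have "y + z \<noteq> 0"
    using assms False by (auto simp: vge_def add_eq_0_iff)
  moreover have "vge v (vord v y) (y + z)"
    using assms by (intro vge_add) (auto intro: vge_mono)
  moreover have "\<not> vge v (vord v y + 1) (y + z)"
  proof
    assume "vge v (vord v y + 1) (y + z)"
    then have "vge v (vord v y + 1) (y + z - z)" using assms by (intro vge_diff) auto
    then show False using assms by (auto simp: vge_def)
  qed
  ultimately show ?thesis by (auto simp: vge_def)
qed (use assms in auto)

lemma vord_unif:
  assumes "v \<in> P" obtains y where "y \<noteq> 0" "vord v y = n"
proof -
  have "Fin n \<in> range v" using assms by (auto simp: points_def)
  then obtain y where "v y = Fin n" by (metis rangeE)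
  then show ?thesis using that[of y] assms by (cases "y = 0") (auto simp: vord_def)
qed

lemma pt_eqI:
  assumes "v \<in> P" "w \<in> P" "\<And>y. y \<noteq> 0 \<Longrightarrow> vord v y = vord w y"
  shows "v = w"
proof
  fix y show "v y = w y" using assms by (cases "y = 0") (auto simp: pt_Fin)
qed

section \<open>Evaluation at an element and the embedding of the rational function field\<close>

definition ev :: "'a \<Rightarrow> 'k poly \<Rightarrow> 'a" where
  "ev x p = poly (map_poly emb p) x"

lemma ev_pCons [simp]: "ev x (pCons a p) = emb a + x * ev x p"
  by (simp add: ev_def map_poly_pCons emb_zero)

lemma ev_0 [simp]: "ev x 0 = 0" by (simp add: ev_def)

lemma ev_1 [simp]: "ev x 1 = 1" by (simp add: ev_def emb_one)

lemma ev_add: "ev x (p + q) = ev x p + ev x q"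
proof -
  have "map_poly emb (p + q) = map_poly emb p + map_poly emb q"
    by (rule poly_eqI) (simp add: coeff_map_poly emb_zero emb_add)
  then show ?thesis by (simp add: ev_def)
qed

lemma ev_smult: "ev x (smult c p) = emb c * ev x p"
  by (simp add: ev_def map_poly_smult emb_zero emb_mult)

lemma ev_mult: "ev x (p * q) = ev x p * ev x q"
  by (induction p) (simp_all add: ev_add ev_smult algebra_simps emb_zero)

lemma ev_minus: "ev x (- p) = - ev x p"
  using ev_smult[of x "-1" p] by (simp add: emb_minus emb_one)

lemma ev_diff: "ev x (p - q) = ev x p - ev x q"
  using ev_add[of x p "-q"] by (simp add: ev_minus)

lemma ev_power: "ev x (p ^ n) = ev x p ^ n"
  by (induction n) (auto simp: ev_mult)

lemma ev_sum: "ev x (sum g A) = (\<Sum>i\<in>A. ev x (g i))"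
  by (induction A rule: infinite_finite_induct) (auto simp: ev_add)

lemma ev_prod: "ev x (prod g A) = (\<Prod>i\<in>A. ev x (g i))"
  by (induction A rule: infinite_finite_induct) (auto simp: ev_mult)

lemma ev_monom: "ev x (monom c n) = emb c * x ^ n"
  by (simp add: ev_def map_poly_monom emb_zero poly_monom)

lemma ev_altdef: 
  assumes "degree p \<le> n"
  shows "ev x p = (\<Sum>i\<le>n. emb (coeff p i) * x ^ i)"
proof -
  have "ev x p = ev x (\<Sum>i\<le>n. monom (coeff p i) i)"
    using poly_as_sum_of_monoms'[OF assms] by simp
  then show ?thesis by (simp add: ev_sum ev_monom)
qed

text \<open>Non-constant elements are transcendental because k is algebraically closed: a polynomial
  splits off linear factors, and no factor \<open>x - emb a\<close> is zero.\<close>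

lemma ev_eq_0_iff:
  assumes "x \<notin> range emb"
  shows "ev x p = 0 \<longleftrightarrow> p = 0"
proof
  show "ev x p = 0 \<Longrightarrow> p = 0"
  proof (induction "degree p" arbitrary: p)
    case 0
    then obtain c where "p = [:c:]" using degree_eq_zeroE by metis
    then show ?case using 0 by simp
  next
    case (Suc n)
    obtain a where "poly p a = 0"
      using alg_closed_imp_poly_has_root[of p] Suc(2) by auto
    then obtain q where q: "p = [:-a, 1:] * q" by (auto simp: poly_eq_0_iff_dvd dvd_def)
    have "q \<noteq> 0" using Suc(2) q by auto
    then have "degree p = Suc (degree q)" unfolding q by (subst degree_mult_eq) auto
    moreover have "ev x p = (x - emb a) * ev x q"
      unfolding q ev_mult by (simp add: emb_minus emb_one emb_zero)
    moreover have "x - emb a \<noteq> 0" using assms by auto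
    ultimately show ?case using Suc.hyps Suc.prems \<open>q \<noteq> 0\<close> by auto
  qed
qed simp

text \<open>The embedding of the rational function field onto k(x). A fraction has many
  representations, so its value is described as the one common to all of them; it exists for
  non-constant \<open>x\<close>. As a type, the rational function field can serve as a field of
  scalars.\<close>

definition phi :: "'a \<Rightarrow> 'k poly fract \<Rightarrow> 'a" where
  "phi x s = (THE y. \<forall>p q. q \<noteq> 0 \<longrightarrow> s = Fract p q \<longrightarrow> y = ev x p / ev x q)"

end

locale function_field_element = function_field emb
  for emb :: "'k::alg_closed_field \<Rightarrow> 'a::field" +
  fixes x :: 'a
  assumes nonconst: "x \<notin> range emb"
begin

lemma ev_0_iff [simp]: "ev x p = 0 \<longleftrightarrow> p = 0"
  by (rule ev_eq_0_iff[OF nonconst])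

lemma phi_Fract:
  assumes "q \<noteq> 0" shows "phi x (Fract p q) = ev x p / ev x q"
  unfolding phi_def
proof (rule the_equality)
  show "\<forall>p' q'. q' \<noteq> 0 \<longrightarrow> Fract p q = Fract p' q' \<longrightarrow> ev x p / ev x q = ev x p' / ev x q'"
  proof (intro allI impI)
    fix p' q' :: "'k poly" assume q': "q' \<noteq> 0" "Fract p q = Fract p' q'"
    then have "p * q' = p' * q" using assms by (simp add: eq_fract)
    then have "ev x p * ev x q' = ev x p' * ev x q" by (metis ev_mult)
    then show "ev x p / ev x q = ev x p' / ev x q'"
      using assms q' by (simp add: frac_eq_eq)
  qed
qed (use assms in auto)

lemma phi_add: "phi x (s + t) = phi x s + phi x t"
  by (cases s; cases t) (simp add: phi_Fract ev_mult ev_add add_frac_eq)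

lemma phi_mult: "phi x (s * t) = phi x s * phi x t"
  by (cases s; cases t) (simp add: phi_Fract ev_mult)

lemma phi_poly: "phi x (Fract p 1) = ev x p"
  by (simp add: phi_Fract)

lemma phi_1 [simp]: "phi x 1 = 1"
  by (simp add: One_fract_def phi_Fract)

lemma phi_0_iff [simp]: "phi x s = 0 \<longleftrightarrow> s = 0"
proof (cases s)
  case (Fract p q)
  then show ?thesis
    using eq_fract(1)[of q 1 p 0] by (simp add: phi_Fract Zero_fract_def)
qed

lemma phi_0 [simp]: "phi x 0 = 0" by simp

lemma phi_sum: "phi x (sum g A) = (\<Sum>i\<in>A. phi x (g i))"
  by (induction A rule: infinite_finite_induct) (auto simp: phi_add)

sublocale X: vector_space_families "\<lambda>s y. phi x s * y"
  by unfold_locales (simp_all add: algebra_simps phi_add phi_mult)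

lemma X_indep_poly:
  assumes "X.fam_indep I u" "(\<Sum>i\<in>I. ev x (p i) * u i) = 0" "i \<in> I"
  shows "p i = 0"
proof -
  have "(\<Sum>i\<in>I. phi x (Fract (p i) 1) * u i) = 0" using assms(2) by (simp add: phi_poly)
  from X.fam_indepD[OF assms(1) this assms(3)] have "phi x (Fract (p i) 1) = 0" by simp
  then show ?thesis unfolding phi_poly by simp
qed

text \<open>A relation over k(x) becomes one over k[x] after multiplication by the product of the
  denominators.\<close>

lemma X_indepI_poly:
  assumes "finite I"
    and "\<And>p i. (\<Sum>i\<in>I. ev x (p i) * u i) = 0 \<Longrightarrow> i \<in> I \<Longrightarrow> p i = 0"
  shows "X.fam_indep I u"
proof (rule X.fam_indepI)
  fix s i assume *: "(\<Sum>i\<in>I. phi x (s i) * u i) = 0" and i: "i \<in> I"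
  have "\<exists>p q. q \<noteq> 0 \<and> s j = Fract p q" for j by (cases "s j") auto
  then obtain p q where pq: "\<And>j. q j \<noteq> 0" "\<And>j. s j = Fract (p j) (q j)" by metis
  define Q where "Q = prod q I"
  have Q: "ev x Q * phi x (s j) = ev x (p j * prod q (I - {j}))" if "j \<in> I" for j
  proof -
    have "Q = q j * prod q (I - {j})" using that assms(1) by (simp add: Q_def prod.remove)
    then show ?thesis using pq(1)[of j] by (simp add: pq(2) phi_Fract ev_mult)
  qed
  have "(\<Sum>j\<in>I. ev x (p j * prod q (I - {j})) * u j) = ev x Q * (\<Sum>i\<in>I. phi x (s i) * u i)"
    unfolding sum_distrib_left by (intro sum.cong) (simp_all add: Q[symmetric] mult.assoc)
  also have "\<dots> = 0" using * by simp
  finally have "p i * prod q (I - {i}) = 0"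
    using assms(2)[of "\<lambda>j. p j * prod q (I - {j})", OF _ i] by blast
  then have "p i = 0" using pq(1) assms(1) by auto
  then show "s i = 0" using pq(1)[of i] by (simp add: pq(2) fract_collapse)
qed

end

section \<open>Finiteness over the field generated by a non-constant element\<close>

context function_field_element
begin

lemma indep_powers_V:
  assumes "X.fam_indep I u" "finite I"
  shows "V.fam_indep ({..n} \<times> I) (\<lambda>(j, i). x ^ j * u i)"
proof (rule V.fam_indepI)
  fix a ji assume *: "(\<Sum>ji\<in>{..n} \<times> I. emb (a ji) * (case ji of (j, i) \<Rightarrow> x ^ j * u i)) = 0"
    and ji: "ji \<in> {..n} \<times> I"
  define p where "p = (\<lambda>i. \<Sum>j\<le>n. monom (a (j, i)) j)"
  have "(\<Sum>i\<in>I. ev x (p i) * u i) = (\<Sum>i\<in>I. \<Sum>j\<le>n. emb (a (j, i)) * (x ^ j * u i))"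
    by (simp add: p_def ev_sum ev_monom sum_distrib_right mult.assoc)
  also have "\<dots> = 0"
    using * by (subst sum.swap) (simp add: sum.cartesian_product case_prod_unfold)
  finally have "p (snd ji) = 0" using X_indep_poly[OF assms(1)] ji by auto
  then have "coeff (p (snd ji)) (fst ji) = 0" by simp
  then show "a ji = 0" using ji by (auto simp: p_def coeff_sum)
qed

end

context function_field
begin

lemma V_fam_indep_scale:
  assumes "V.fam_indep I u" "z \<noteq> 0"
  shows "V.fam_indep I (\<lambda>i. z * u i)"
proof (rule V.fam_indepI)
  fix a i assume *: "(\<Sum>i\<in>I. emb (a i) * (z * u i)) = 0" and i: "i \<in> I"
  have "z * (\<Sum>i\<in>I. emb (a i) * u i) = 0"
    using * by (simp add: sum_distrib_left mult_ac)
  then show "a i = 0" using V.fam_indepD[OF assms(1) _ i] assms(2) by simp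
qed

end

context function_field_element
begin

text \<open>
  The field is finite over some \<open>k(t)\<close>.  Up to a common denominator, multiplication by \<open>x\<close> raises
  degrees in \<open>t\<close> by at most \<open>C\<close>, so the \<open>(n + 1) |B|\<close> independent elements \<open>x^j b\<close> with \<open>j \<le> n\<close>
  lie in a space of dimension \<open>n C |Bs| + O(1)\<close>.
\<close>
lemma indep_card_bounded: "\<exists>N. \<forall>B. finite B \<longrightarrow> X.independent B \<longrightarrow> card B \<le> N"
proof -
  obtain t Bs where Bs: "finite Bs"
    and span: "\<And>y. \<exists>c. (\<forall>b\<in>Bs. c b \<in> ratfun_field emb t) \<and> y = (\<Sum>b\<in>Bs. c b * b)"
    using finite_over_ratfun_field by blast
  define G where "G = (\<lambda>n. {\<Sum>b\<in>Bs. ev t (p b) * b | p. \<forall>b\<in>Bs. degree (p b) \<le> n})"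
  have G_I: "(\<Sum>b\<in>Bs. ev t (p b) * b) \<in> G n" if "\<And>b. b \<in> Bs \<Longrightarrow> degree (p b) \<le> n" for p n
    using that by (auto simp: G_def)
  have G_add: "y + z \<in> G n" if "y \<in> G n" "z \<in> G n" for y z n
  proof -
    obtain p p' where "y = (\<Sum>b\<in>Bs. ev t (p b) * b)" "\<forall>b\<in>Bs. degree (p b) \<le> n"
        "z = (\<Sum>b\<in>Bs. ev t (p' b) * b)" "\<forall>b\<in>Bs. degree (p' b) \<le> n"
      using \<open>y \<in> G n\<close> \<open>z \<in> G n\<close> by (auto simp: G_def)
    then show ?thesis using G_I[of "\<lambda>b. p b + p' b" n]
      by (simp add: ev_add algebra_simps sum.distrib degree_add_le)
  qed
  have G_0: "0 \<in> G n" for n using G_I[of "\<lambda>b. 0" n] by simp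
  have G_sum: "sum g A \<in> G n" if "\<And>i. i \<in> A \<Longrightarrow> g i \<in> G n" for g n and A :: "'a set"
    using that by (induction A rule: infinite_finite_induct) (auto intro: G_add G_0)
  have G_mono: "y \<in> G m" if "y \<in> G n" "n \<le> m" for y n m
    using that by (fastforce simp: G_def)
  have G_mult: "ev t q * y \<in> G (n + m)" if yn: "y \<in> G n" and "degree q \<le> m" for q y n m
  proof -
    obtain p where p: "y = (\<Sum>b\<in>Bs. ev t (p b) * b)" "\<forall>b\<in>Bs. degree (p b) \<le> n"
      using yn by (auto simp: G_def)
    have "degree (q * p b) \<le> n + m" if "b \<in> Bs" for b
      using degree_mult_le[of q "p b"] p(2) that \<open>degree q \<le> m\<close> by fastforce
    then show ?thesis using G_I[of "\<lambda>b. q * p b" "n + m"] p(1)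
      by (simp add: ev_mult sum_distrib_left mult.assoc)
  qed
  have denom1: "\<exists>q C. ev t q \<noteq> 0 \<and> ev t q * y \<in> G C" for y
  proof -
    obtain c where c: "\<forall>b\<in>Bs. c b \<in> ratfun_field emb t" "y = (\<Sum>b\<in>Bs. c b * b)" using span by blast
    have "\<forall>b. \<exists>p q. b \<in> Bs \<longrightarrow> ev t q \<noteq> 0 \<and> c b = ev t p / ev t q"
      using c(1) by (fastforce simp: ratfun_field_def ev_def)
    then obtain p q where pq: "\<And>b. b \<in> Bs \<Longrightarrow> ev t (q b) \<noteq> 0 \<and> c b = ev t (p b) / ev t (q b)"
      by metis
    define Q where "Q = prod q Bs"
    have Q0: "ev t Q \<noteq> 0" using pq Bs by (simp add: Q_def ev_prod)
    have "ev t Q * c b = ev t (p b * prod q (Bs - {b}))" if "b \<in> Bs" for b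
    proof -
      have "Q = q b * prod q (Bs - {b})" using that Bs by (simp add: Q_def prod.remove)
      then show ?thesis using pq[OF that] by (simp add: ev_mult)
    qed
    then have "ev t Q * y = (\<Sum>b\<in>Bs. ev t (p b * prod q (Bs - {b})) * b)"
      by (simp add: c(2) sum_distrib_left mult.assoc[symmetric])
    also have "\<dots> \<in> G (\<Sum>b\<in>Bs. degree (p b * prod q (Bs - {b})))"
      by (rule G_I) (rule member_le_sum, use Bs in auto)
    finally show ?thesis using Q0 by blast
  qed
  have denom: "\<exists>q C. ev t q \<noteq> 0 \<and> (\<forall>y\<in>Y. ev t q * y \<in> G C)" if "finite Y" for Y
    using that
  proof (induction Y)
    case empty
    show ?case by (intro exI[of _ 1]) auto
  next
    case (insert y Y)
    obtain q C where q: "ev t q \<noteq> 0" "\<forall>y\<in>Y. ev t q * y \<in> G C" using insert by blast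
    obtain q' C' where q': "ev t q' \<noteq> 0" "ev t q' * y \<in> G C'" using denom1 by blast
    have "ev t (q * q') * z \<in> G (C + C' + degree q + degree q')" if "z \<in> insert y Y" for z
    proof (cases "z = y")
      case True
      then show ?thesis using G_mono[OF G_mult[OF q'(2), of q "degree q"]]
        by (simp add: ev_mult mult_ac)
    next
      case False
      then have "ev t q * z \<in> G C" using that q by auto
      then show ?thesis using G_mono[OF G_mult[of "ev t q * z" C q' "degree q'"]]
        by (simp add: ev_mult mult_ac)
    qed
    then show ?case using q q' by (intro exI[of _ "q * q'"]) (auto simp: ev_mult)
  qed
  obtain q C0 where q: "ev t q \<noteq> 0" "\<And>b. b \<in> Bs \<Longrightarrow> ev t q * (x * b) \<in> G C0"
    using denom[of "(\<lambda>b. x * b) ` Bs"] Bs by auto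
  define C where "C = C0 + degree q"
  have step_q: "ev t q * y \<in> G (n + C)" if "y \<in> G n" for y n
    by (rule G_mult[OF that]) (simp add: C_def)
  have step_x: "ev t q * x * y \<in> G (n + C)" if yn: "y \<in> G n" for y n
  proof -
    obtain p where p: "y = (\<Sum>b\<in>Bs. ev t (p b) * b)" "\<forall>b\<in>Bs. degree (p b) \<le> n"
      using yn by (auto simp: G_def)
    have "ev t q * x * y = (\<Sum>b\<in>Bs. ev t (p b) * (ev t q * (x * b)))"
      by (simp add: p sum_distrib_left mult_ac)
    also have "\<dots> \<in> G (n + C)"
    proof (rule G_sum)
      fix b assume b: "b \<in> Bs"
      show "ev t (p b) * (ev t q * (x * b)) \<in> G (n + C)"
        by (rule G_mono[OF G_mult[OF q(2)[OF b], of "p b" n]]) (use p b in \<open>auto simp: C_def\<close>)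
    qed
    finally show ?thesis .
  qed
  have steps_q: "ev t q ^ i * y \<in> G (n + i * C)" if "y \<in> G n" for y n i
  proof (induction i)
    case (Suc i)
    show ?case using step_q[OF Suc] by (simp add: algebra_simps)
  qed (use that in auto)
  have steps_x: "(ev t q * x) ^ i * y \<in> G (n + i * C)" if "y \<in> G n" for y n i
  proof (induction i)
    case (Suc i)
    show ?case using step_x[OF Suc] by (simp add: algebra_simps)
  qed (use that in auto)
  have G_span: "\<exists>T. finite T \<and> card T \<le> (n + 1) * card Bs \<and> G n \<subseteq> V.span T" for n
  proof (intro exI conjI)
    let ?T = "(\<lambda>(j, b). t ^ j * b) ` ({..n} \<times> Bs)"
    show "finite ?T" using Bs by simp
    have "card ?T \<le> card ({..n} \<times> Bs)" by (rule card_image_le) (use Bs in auto)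
    then show "card ?T \<le> (n + 1) * card Bs" by (simp add: card_cartesian_product)
    show "G n \<subseteq> V.span ?T"
    proof
      fix y assume "y \<in> G n"
      then obtain p where p: "y = (\<Sum>b\<in>Bs. ev t (p b) * b)" "\<forall>b\<in>Bs. degree (p b) \<le> n"
        by (auto simp: G_def)
      have "y = (\<Sum>b\<in>Bs. \<Sum>j\<le>n. emb (coeff (p b) j) * (t ^ j * b))"
        unfolding p(1) by (intro sum.cong refl)
          (use p(2) in \<open>simp add: ev_altdef[of _ n] sum_distrib_right mult.assoc\<close>)
      also have "\<dots> \<in> V.span ?T"
        by (intro V.span_sum V.span_scale V.span_base) auto
      finally show "y \<in> V.span ?T" .
    qed
  qed
  have "card B \<le> C * card Bs" if B: "finite B" "X.independent B" for B
  proof (rule ccontr)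
    assume "\<not> ?thesis"
    then have cB: "C * card Bs + 1 \<le> card B" by simp
    obtain Q C' where Q: "ev t Q \<noteq> 0" "\<And>b. b \<in> B \<Longrightarrow> ev t Q * b \<in> G C'"
      using denom[OF B(1)] by blast
    have main: "(n + 1) * card B \<le> (C' + n * C + 1) * card Bs" for n
    proof -
      obtain T where T: "finite T" "card T \<le> (C' + n * C + 1) * card Bs" "G (C' + n * C) \<subseteq> V.span T"
        using G_span by blast
      \<comment> \<open>One factor \<open>ev t q\<close> pays for one multiplication by
        \<open>x\<close>, and \<open>ev t Q\<close> clears the denominators of \<open>B\<close>. For
        \<open>j < n\<close> the surplus factors \<open>ev t q\<close> raise the degree by at most
        \<open>C\<close> each, so that all products lie in the same space.\<close>
      let ?u = "\<lambda>(j, b). x ^ j * b" and ?z = "ev t q ^ n * ev t Q"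
      have ind: "V.fam_indep ({..n} \<times> B) (\<lambda>ji. ?z * ?u ji)"
        by (rule V_fam_indep_scale[OF indep_powers_V[OF X.independent_fam_indep[OF B(2,1)] B(1)]])
          (use q Q in auto)
      have sub: "(\<lambda>ji. ?z * ?u ji) ` ({..n} \<times> B) \<subseteq> V.span T"
      proof (rule image_subsetI)
        fix ji assume "ji \<in> {..n} \<times> B"
        then obtain j b where ji: "ji = (j, b)" and jb: "j \<in> {..n}" "b \<in> B" by blast
        have "ev t q ^ (n - j) * ((ev t q * x) ^ j * (ev t Q * b)) \<in> G (C' + j * C + (n - j) * C)"
          by (intro steps_q steps_x Q jb)
        also have "C' + j * C + (n - j) * C = C' + n * C"
          using jb by (simp add: add.assoc flip: distrib_right)
        also have "ev t q ^ (n - j) * ((ev t q * x) ^ j * (ev t Q * b)) = ?z * (x ^ j * b)"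
        proof -
          have "ev t q ^ n = ev t q ^ (n - j) * ev t q ^ j" using jb by (simp flip: power_add)
          then show ?thesis by (simp add: power_mult_distrib mult_ac)
        qed
        finally show "?z * ?u ji \<in> V.span T" using T unfolding ji by auto
      qed
      have le: "card ({..n} \<times> B) \<le> card T"
        by (rule V.fam_indep_card_span[OF _ ind sub T(1)]) (use B in auto)
      have "(n + 1) * card B = card ({..n} \<times> B)" by (simp only: card_cartesian_product card_atMost Suc_eq_plus1)
      also note le
      also note T(2)
      finally show ?thesis .
    qed
    \<comment> \<open>The terms \<open>n * C * card Bs\<close> cancel in the two bounds. What
      remains, \<open>n + C * card Bs + 1 <= C' * card Bs + card Bs\<close>, fails for this
      \<open>n\<close>.\<close>
    define n where "n = C' * card Bs + card Bs"
    have "(n + 1) * (C * card Bs + 1) \<le> (n + 1) * card B" using cB by (rule mult_le_mono2)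
    also have "\<dots> \<le> (C' + n * C + 1) * card Bs" by (rule main)
    finally show False by (simp add: algebra_simps n_def)
  qed
  then show ?thesis by blast
qed

text \<open>Some bound for the number of elements independent over k(x). It serves until the exact
  degree is available as the pole degree of \<open>x\<close>.\<close>

definition xbound :: nat where
  "xbound = (SOME N. \<forall>B. finite B \<longrightarrow> X.independent B \<longrightarrow> card B \<le> N)"

lemma fam_card_le_xbound:
  assumes "finite I" "X.fam_indep I u"
  shows "card I \<le> xbound"
proof -
  have "\<forall>B. finite B \<longrightarrow> X.independent B \<longrightarrow> card B \<le> xbound"
    unfolding xbound_def by (rule someI_ex) (rule indep_card_bounded)
  then show ?thesis
    using X.fam_indep_independent[OF assms] X.fam_indep_inj[OF assms] assms(1)
    by (metis card_image finite_imageI)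
qed

text \<open>If the constant coefficients vanish in every relation, each relation can be divided by
  \<open>x\<close>, and induction removes all coefficients. So dependence always shows in a relation
  that stays non-trivial modulo \<open>x\<close>.\<close>

lemma X_indepI_const:
  assumes "finite I"
    and const: "\<And>p i. (\<Sum>i\<in>I. ev x (p i) * u i) = 0 \<Longrightarrow> i \<in> I \<Longrightarrow> coeff (p i) 0 = 0"
  shows "X.fam_indep I u"
proof (rule X_indepI_poly[OF assms(1)])
  fix p i assume "(\<Sum>i\<in>I. ev x (p i) * u i) = 0" "i \<in> I"
  have "coeff (p i) N = 0" if "(\<Sum>i\<in>I. ev x (p i) * u i) = 0" "i \<in> I" for N p i
    using that
  proof (induction N arbitrary: p)
    case (Suc N)
    define q where "q = (\<lambda>i. poly_shift 1 (p i))"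
    have pq: "p j = pCons 0 (q j)" if "j \<in> I" for j
    proof (rule poly_eqI)
      fix n show "coeff (p j) n = coeff (pCons 0 (q j)) n"
        using const[OF Suc.prems(1) that] by (cases n) (auto simp: q_def coeff_poly_shift)
    qed
    have "x * (\<Sum>i\<in>I. ev x (q i) * u i) = (\<Sum>i\<in>I. ev x (p i) * u i)"
      by (simp add: sum_distrib_left mult.assoc pq emb_zero)
    moreover have "x \<noteq> 0" using nonconst emb_zero by (metis rangeI)
    ultimately have "(\<Sum>i\<in>I. ev x (q i) * u i) = 0" using Suc.prems by simp
    from Suc.IH[OF this Suc.prems(2)] show ?case using Suc.prems(2) by (simp add: pq)
  qed (use const in blast)
  then show "p i = 0" using \<open>(\<Sum>i\<in>I. ev x (p i) * u i) = 0\<close> \<open>i \<in> I\<close> by (intro poly_eqI) auto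
qed

end

section \<open>Residues at a point\<close>

context function_field
begin

lemma function_field_elementI: "x \<notin> range emb \<Longrightarrow> function_field_element emb x"
  by unfold_locales

lemma vge_ev:
  assumes "v \<in> P" "vge v 0 y" shows "vge v 0 (ev y p)"
proof (induction p)
  case (pCons a p)
  have "vge v (0 + 0) (y * ev y p)" by (rule vge_mult) (use assms pCons in auto)
  then show ?case using vge_add[OF assms(1) vge_emb[OF assms(1), of a]] by simp
qed simp

lemma vge_ev_const:
  assumes "v \<in> P" "vge v n y" "n \<ge> 0" shows "vge v n (ev y p - emb (coeff p 0))"
proof (cases p)
  case (pCons a q)
  have "vge v (n + 0) (y * ev y q)"
    using assms by (intro vge_mult vge_ev) (auto intro: vge_mono)
  then show ?thesis by (simp add: pCons)
qed

text \<open>The residue field is k. For a uniformizer \<open>x\<close>, the powers of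
  \<open>y\<close> are too many to be independent over k(x). A relation with a non-zero constant
  coefficient reduces modulo \<open>x\<close> to a non-zero polynomial over k whose value at
  \<open>y\<close> has positive order, and one of its linear factors must have positive order
  too.\<close>

lemma residue:
  assumes v: "v \<in> P" and y: "vge v 0 y"
  shows "\<exists>c. vge v 1 (y - emb c)"
proof -
  obtain x where x: "x \<noteq> 0" "vord v x = 1" using vord_unif[OF v] by blast
  then have nc: "x \<notin> range emb" using v by auto
  interpret x: function_field_element emb x by (rule function_field_elementI[OF nc])
  have "\<not> x.X.fam_indep {..x.xbound} (\<lambda>i. y ^ i)"
    using x.fam_card_le_xbound[of "{..x.xbound}" "\<lambda>i. y ^ i"] by auto
  then obtain p i where p: "(\<Sum>i\<le>x.xbound. ev x (p i) * y ^ i) = 0" "coeff (p i) 0 \<noteq> 0" "i \<le> x.xbound"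
    using x.X_indepI_const[of "{..x.xbound}" "\<lambda>i. y ^ i"] by blast
  define q where "q = (\<Sum>i\<le>x.xbound. monom (coeff (p i) 0) i)"
  have "coeff q i \<noteq> 0" using p by (simp add: q_def coeff_sum)
  then have q0: "q \<noteq> 0" by auto
  have "vge v 1 (\<Sum>i\<le>x.xbound. (ev x (p i) - emb (coeff (p i) 0)) * y ^ i)"
  proof (rule vge_sum[OF v])
    fix i
    have "vge v (1 + 0) ((ev x (p i) - emb (coeff (p i) 0)) * y ^ i)"
      by (intro vge_mult vge_ev_const vge_power v y) (use x in \<open>auto simp: vge_def\<close>)
    then show "vge v 1 ((ev x (p i) - emb (coeff (p i) 0)) * y ^ i)" by simp
  qed
  then have "vge v 1 (- ev y q)"
    using p(1) by (simp add: q_def ev_sum ev_monom algebra_simps sum_subtractf)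
  from vge_minus[OF v this] have "vge v 1 (ev y q)" by simp
  with q0 show ?thesis
  proof (induction "degree q" arbitrary: q)
    case 0
    then obtain c where "q = [:c:]" using degree_eq_zeroE by metis
    then show ?case using 0 vge_not_emb[OF v] by auto
  next
    case (Suc n)
    obtain a where "poly q a = 0"
      using alg_closed_imp_poly_has_root[of q] Suc(2) by auto
    then obtain r where r: "q = [:-a, 1:] * r" by (auto simp: poly_eq_0_iff_dvd dvd_def)
    have "r \<noteq> 0" using Suc(2) r by auto
    then have deg: "degree q = Suc (degree r)" unfolding r by (subst degree_mult_eq) auto
    have evq: "ev y q = (y - emb a) * ev y r"
      unfolding r ev_mult by (simp add: emb_minus emb_one emb_zero)
    show ?case
    proof (cases "vge v 1 (y - emb a)")
      case False
      then have "y - emb a \<noteq> 0" "vord v (y - emb a) \<le> 0" by (auto simp: vge_def)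
      then have "vge v 1 (ev y r)"
        using Suc.prems(2) v unfolding evq vge_def by (cases "ev y r = 0") (auto simp: vord_mult)
      then show ?thesis using Suc.hyps deg \<open>r \<noteq> 0\<close> by auto
    qed blast
  qed
qed

end

section \<open>Existence of points and weak approximation\<close>

context function_field
begin

definition k_subring :: "'a set \<Rightarrow> bool" where
  "k_subring A \<longleftrightarrow> range emb \<subseteq> A \<and> (\<forall>y\<in>A. \<forall>z\<in>A. y + z \<in> A \<and> y * z \<in> A)"

definition valuation_subring :: "'a set \<Rightarrow> bool" where
  "valuation_subring A \<longleftrightarrow> k_subring A \<and> (\<forall>y. y \<noteq> 0 \<longrightarrow> y \<in> A \<or> inverse y \<in> A)"

definition nonunits :: "'a set \<Rightarrow> 'a set" where
  "nonunits A = {y \<in> A. y = 0 \<or> inverse y \<notin> A}"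

lemma k_subringD:
  assumes "k_subring A"
  shows "emb c \<in> A" "y \<in> A \<Longrightarrow> z \<in> A \<Longrightarrow> y + z \<in> A" "y \<in> A \<Longrightarrow> z \<in> A \<Longrightarrow> y * z \<in> A"
    "0 \<in> A" "1 \<in> A" "y \<in> A \<Longrightarrow> - y \<in> A" "y \<in> A \<Longrightarrow> z \<in> A \<Longrightarrow> y - z \<in> A"
    "y \<in> A \<Longrightarrow> y ^ n \<in> A"
proof -
  note * = assms[unfolded k_subring_def]
  show e: "emb c \<in> A" for c using * by auto
  show "y \<in> A \<Longrightarrow> z \<in> A \<Longrightarrow> y + z \<in> A" "y \<in> A \<Longrightarrow> z \<in> A \<Longrightarrow> y * z \<in> A" for y z
    using * by auto
  show "0 \<in> A" "1 \<in> A" using e[of 0] e[of 1] by (simp_all add: emb_zero emb_one)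
  show m: "- y \<in> A" if "y \<in> A" for y
    using * e[of "-1"] that by (metis emb_minus emb_one mult_minus1)
  show "y \<in> A \<Longrightarrow> z \<in> A \<Longrightarrow> y - z \<in> A"
    using * m[of z] by (metis add_uminus_conv_diff)
  show "y \<in> A \<Longrightarrow> y ^ n \<in> A"
    by (induction n) (use * \<open>1 \<in> A\<close> in auto)
qed

lemma k_subring_sum: "k_subring A \<Longrightarrow> (\<And>i. i \<in> I \<Longrightarrow> g i \<in> A) \<Longrightarrow> sum g I \<in> A"
  by (induction I rule: infinite_finite_induct) (auto intro: k_subringD)

lemma ev_in_subring: "k_subring A \<Longrightarrow> y \<in> A \<Longrightarrow> ev y p \<in> A"
  by (induction p) (auto intro: k_subringD)

context
  fixes A assumes A: "valuation_subring A"
begin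

lemma valuation_subring_subring: "k_subring A" using A by (simp add: valuation_subring_def)

lemmas A_rules = k_subringD[OF valuation_subring_subring]

lemma valuation_subring_cases: "y \<noteq> 0 \<Longrightarrow> y \<in> A \<or> inverse y \<in> A" using A by (simp add: valuation_subring_def)

lemma nonunits_mult: "y \<in> A \<Longrightarrow> z \<in> nonunits A \<Longrightarrow> y * z \<in> nonunits A"
proof -
  assume *: "y \<in> A" "z \<in> nonunits A"
  have inv: "inverse z = y * inverse (y * z)" if "y * z \<noteq> 0" using that by (simp add: field_simps)
  have "inverse (y * z) \<notin> A" if "y * z \<noteq> 0"
  proof
    assume "inverse (y * z) \<in> A"
    then have "inverse z \<in> A" using A_rules(3)[of y "inverse (y * z)"] * unfolding inv[OF that] by blast
    then show False using * that by (auto simp: nonunits_def)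
  qed
  then show ?thesis using * A_rules(3)[of y z] by (simp add: nonunits_def) blast
qed

lemma nonunits_mult2: "z \<in> nonunits A \<Longrightarrow> y \<in> A \<Longrightarrow> z * y \<in> nonunits A"
  using nonunits_mult[of y z] by (simp add: mult.commute)

lemma nonunits_A: "y \<in> nonunits A \<Longrightarrow> y \<in> A" by (simp add: nonunits_def)

lemma nonunits_add:
  assumes "y \<in> nonunits A" "z \<in> nonunits A" shows "y + z \<in> nonunits A"
proof -
  have *: "y + z \<in> nonunits A" if "y \<in> nonunits A" "z \<in> nonunits A" "z \<noteq> 0" "y / z \<in> A" for y z
  proof -
    have "y + z = (y / z + 1) * z" using that by (simp add: field_simps)
    then show ?thesis using nonunits_mult[of "y / z + 1" z] that A_rules by auto
  qed
  show ?thesis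
  proof (cases "y = 0 \<or> z = 0")
    case False
    then show ?thesis
      using *[of y z] *[of z y] assms valuation_subring_cases[of "y / z"] by (auto simp: add.commute)
  qed (use assms in auto)
qed

lemma nonunits_0: "0 \<in> nonunits A" using A_rules by (simp add: nonunits_def)

lemma nonunits_sum: "(\<And>i. i \<in> I \<Longrightarrow> g i \<in> nonunits A) \<Longrightarrow> sum g I \<in> nonunits A"
  by (induction I rule: infinite_finite_induct) (auto intro: nonunits_add nonunits_0)

lemma nonunits_emb: "emb c \<in> nonunits A \<Longrightarrow> c = 0"
  using A_rules(1)[of "inverse c"] by (auto simp: nonunits_def emb_inverse)

lemma nonunits_iff: "y \<noteq> 0 \<Longrightarrow> y \<in> nonunits A \<longleftrightarrow> inverse y \<notin> A"
  using valuation_subring_cases[of y] by (auto simp: nonunits_def)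

text \<open>A bounded length of divisor chains makes the valuation discrete.\<close>
lemma chain_le_xbound:
  assumes c0: "\<And>i. i \<le> n \<Longrightarrow> c i \<noteq> 0" "\<And>i. i \<le> n \<Longrightarrow> c i \<in> nonunits A"
    and step: "\<And>i. i < n \<Longrightarrow> c i / c (Suc i) \<in> nonunits A"
  shows "n + 1 \<le> function_field_element.xbound emb (c 0)"
proof -
  have nc: "c 0 \<notin> range emb" using c0[of 0] nonunits_emb by (auto simp: emb_zero)
  interpret x: function_field_element emb "c 0" by (rule function_field_elementI[OF nc])
  have quot: "c i / c j \<in> nonunits A" if "i < j" "j \<le> n" for i j
    using that
  proof (induction j)
    case (Suc j)
    show ?case
    proof (cases "i = j")
      case False
      then have "(c i / c j) * (c j / c (Suc j)) \<in> nonunits A"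
        using Suc step[of j] by (intro nonunits_mult) (auto intro: nonunits_A)
      moreover have "c j \<noteq> 0" using c0 Suc.prems by auto
      ultimately show ?thesis by simp
    qed (use step Suc in auto)
  qed auto
  have evx: "ev (c 0) p - emb (coeff p 0) \<in> nonunits A" for p
  proof (cases p)
    case (pCons a q)
    have "c 0 * ev (c 0) q \<in> nonunits A"
      using c0[of 0] by (intro nonunits_mult2 ev_in_subring valuation_subring_subring) (auto intro: nonunits_A)
    then show ?thesis by (simp add: pCons)
  qed
  have "x.X.fam_indep {..n} c"
  proof (rule x.X_indepI_const)
    fix p i assume rel: "(\<Sum>i\<le>n. ev (c 0) (p i) * c i) = 0" and i: "i \<in> {..n}"
    show "coeff (p i) 0 = 0"
    proof (rule ccontr)
      assume ne: "coeff (p i) 0 \<noteq> 0"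
      \<comment> \<open>Along the chain the members become less divisible, so the last index with a
        non-zero constant coefficient dominates. Earlier terms are smaller because
        \<open>c l / c j\<close> is a non-unit, later ones because their coefficients contain a
        factor \<open>c 0\<close>.\<close>
      define j where "j = Max {i. i \<le> n \<and> coeff (p i) 0 \<noteq> 0}"
      have "j \<in> {i. i \<le> n \<and> coeff (p i) 0 \<noteq> 0}"
        unfolding j_def by (rule Max_in) (use ne i in auto)
      then have j: "j \<le> n" "coeff (p j) 0 \<noteq> 0" by auto
      have gt: "coeff (p l) 0 = 0" if "l \<le> n" "l > j" for l
        using that Max_ge[of "{i. i \<le> n \<and> coeff (p i) 0 \<noteq> 0}" l] unfolding j_def[symmetric] by auto
      have "ev (c 0) (p l) * c l / c j \<in> nonunits A" if l: "l \<in> {..n} - {j}" for l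
      proof (cases "l < j")
        case True
        have "ev (c 0) (p l) * (c l / c j) \<in> nonunits A"
          using True j c0[of 0] by (intro nonunits_mult ev_in_subring valuation_subring_subring quot) (auto intro: nonunits_A)
        then show ?thesis by simp
      next
        case False
        then have "coeff (p l) 0 = 0" using gt l by auto
        then obtain q where q: "p l = pCons 0 q" by (cases "p l") auto
        have "c 0 / c j \<in> A"
          using quot[of 0 j] j c0[of 0] A_rules(5) by (cases "j = 0") (auto intro: nonunits_A)
        moreover have "ev (c 0) q * c l \<in> nonunits A"
          using l c0[of 0] c0[of l] by (intro nonunits_mult ev_in_subring valuation_subring_subring) (auto intro: nonunits_A)
        ultimately have "c 0 / c j * (ev (c 0) q * c l) \<in> nonunits A" by (rule nonunits_mult)
        then show ?thesis by (simp add: q emb_zero mult_ac)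
      qed
      then have "(\<Sum>l\<in>{..n} - {j}. ev (c 0) (p l) * c l / c j) \<in> nonunits A" by (rule nonunits_sum)
      also have "(\<Sum>l\<in>{..n} - {j}. ev (c 0) (p l) * c l / c j) = - ev (c 0) (p j)"
      proof -
        have "ev (c 0) (p j) * c j + (\<Sum>l\<in>{..n} - {j}. ev (c 0) (p l) * c l) = 0"
          using rel j(1) by (subst (asm) sum.remove[of _ j]) auto
        then have "(\<Sum>l\<in>{..n} - {j}. ev (c 0) (p l) * c l) = - ev (c 0) (p j) * c j"
          by (simp add: add_eq_0_iff)
        moreover have "c j \<noteq> 0" using c0 j by auto
        ultimately show ?thesis by (simp add: sum_divide_distrib[symmetric])
      qed
      finally have "- ev (c 0) (p j) + (ev (c 0) (p j) - emb (coeff (p j) 0)) \<in> nonunits A"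
        using evx nonunits_add by blast
      then have "emb (- coeff (p j) 0) \<in> nonunits A" by (simp add: emb_minus)
      then show False using nonunits_emb j(2) by fastforce
    qed
  qed auto
  from x.fam_card_le_xbound[OF _ this] show ?thesis by simp
qed

text \<open>A divisor chain of maximal length starting at \<open>g\<close> ends in an element
  \<open>t\<close> that divides all non-units. Hence every non-zero element is a unit times a power
  of \<open>t\<close>, and the exponent is the order function.\<close>

lemma valuation_subring_place:
  assumes g: "g \<in> nonunits A" "g \<noteq> 0"
  shows "\<exists>v\<in>P. vord v g > 0"
proof -
  define Ch where "Ch = (\<lambda>n. \<exists>c. c (0::nat) = g \<and> (\<forall>i\<le>n. c i \<noteq> 0 \<and> c i \<in> nonunits A) \<and>
    (\<forall>i<n. c i / c (Suc i) \<in> nonunits A))"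
  have "Ch 0" using g by (auto simp: Ch_def)
  have "\<forall>n. Ch n \<longrightarrow> n \<le> function_field_element.xbound emb g"
  proof (intro allI impI)
    fix n assume "Ch n"
    then obtain c where c: "c 0 = g" "\<forall>i\<le>n. c i \<noteq> 0 \<and> c i \<in> nonunits A"
      "\<forall>i<n. c i / c (Suc i) \<in> nonunits A" unfolding Ch_def by blast
    have "n + 1 \<le> function_field_element.xbound emb (c 0)"
      by (rule chain_le_xbound) (use c in auto)
    then show "n \<le> function_field_element.xbound emb g" using c by simp
  qed
  then obtain n where n: "Ch n" "\<And>m. Ch m \<Longrightarrow> m \<le> n"
    using \<open>Ch 0\<close> ex_has_greatest_nat[of Ch 0 "\<lambda>n. n"] by (metis less_Suc_eq_le)
  then obtain c where c: "c 0 = g" "\<And>i. i \<le> n \<Longrightarrow> c i \<noteq> 0 \<and> c i \<in> nonunits A"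
    "\<And>i. i < n \<Longrightarrow> c i / c (Suc i) \<in> nonunits A" by (auto simp: Ch_def)
  define t where "t = c n"
  have t: "t \<noteq> 0" "t \<in> nonunits A" using c by (auto simp: t_def)
  have tdiv: "y / t \<in> A" if y: "y \<in> nonunits A" for y
  proof (rule ccontr)
    assume *: "y / t \<notin> A"
    then have y0: "y \<noteq> 0" using A_rules by auto
    then have "t / y \<in> nonunits A" using * nonunits_iff[of "t / y"] t by simp
    then have "Ch (Suc n)" unfolding Ch_def
      using c y y0 by (intro exI[of _ "c(Suc n := y)"]) (auto simp: t_def less_Suc_eq)
    then show False using n(2) by fastforce
  qed
  have tA: "t ^ n \<in> A" for n by (intro A_rules(8) nonunits_A t)
  have tn: "t ^ n \<in> nonunits A" if "n > 0" for n
    using that nonunits_mult[OF tA[of "n - 1"] t(2)] by (cases n) (auto simp: mult.commute)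
  define unit where "unit = (\<lambda>u. u \<noteq> 0 \<and> u \<in> A \<and> inverse u \<in> A)"
  have dec1: "\<exists>n u. unit u \<and> y = u * t ^ n" if y: "y \<in> nonunits A" "y \<noteq> 0" for y
  proof -
    have bnd: "m \<le> function_field_element.xbound emb y" if "y / t ^ m \<in> A" for m
    proof (cases "m = 0")
      case False
      \<comment> \<open>This is the chain y, t^(m-1), ..., t. Its first quotient is
        \<open>t * (y / t ^ m)\<close> and all others are \<open>t\<close>, so the length bound for
        chains starting at \<open>y\<close> limits \<open>m\<close>.\<close>
      define d where "d = (\<lambda>i. if i = 0 then y else t ^ (m - i))"
      have "m - 1 + 1 \<le> function_field_element.xbound emb (d 0)"
      proof (rule chain_le_xbound)
        show "d i \<noteq> 0" "d i \<in> nonunits A" if "i \<le> m - 1" for i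
          using that y t False tn[of "m - i"] by (auto simp: d_def)
        show "d i / d (Suc i) \<in> nonunits A" if "i < m - 1" for i
        proof (cases "i = 0")
          case True
          have "t ^ m = t * t ^ (m - 1)" using False by (simp flip: power_Suc)
          then have "y / t ^ (m - 1) = t * (y / t ^ m)" using t by simp
          also have "\<dots> \<in> nonunits A" using that t \<open>y / t ^ m \<in> A\<close> by (intro nonunits_mult2) auto
          finally show ?thesis using True by (simp add: d_def)
        next
          case False
          have "m - i = Suc (m - Suc i)" using that by simp
          then have "t ^ (m - i) = t * t ^ (m - Suc i)" by simp
          then show ?thesis using False t by (simp add: d_def)
        qed
      qed
      then show ?thesis using False by (simp add: d_def)
    qed auto
    have "y / t ^ 0 \<in> A" using y by (auto intro: nonunits_A)
    then obtain m where m: "y / t ^ m \<in> A" "\<And>m'. y / t ^ m' \<in> A \<Longrightarrow> m' \<le> m"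
      using bnd ex_has_greatest_nat[of "\<lambda>m. y / t ^ m \<in> A" 0 "\<lambda>n. n"] by (metis less_Suc_eq_le)
    have "y / t ^ m \<notin> nonunits A"
    proof
      assume "y / t ^ m \<in> nonunits A"
      then have "y / t ^ m / t \<in> A" by (rule tdiv)
      then have "y / t ^ Suc m \<in> A" by (simp add: field_simps)
      then show False using m(2) by fastforce
    qed
    then have "unit (y / t ^ m)" using m(1) by (auto simp: unit_def nonunits_def)
    moreover have "y = (y / t ^ m) * t ^ m" using t by simp
    ultimately show ?thesis by blast
  qed
  have unit_mult: "unit (u * w)" if "unit u" "unit w" for u w
    using that A_rules(3) by (auto simp: unit_def)
  have unit_inv: "unit (inverse u)" if "unit u" for u using that by (auto simp: unit_def)
  have "\<exists>n u. y \<noteq> 0 \<longrightarrow> unit u \<and> y = u * t powi n" for y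
  proof (cases "y = 0")
    case y0: False
    consider "y \<in> nonunits A" | "unit y" | "inverse y \<in> nonunits A"
      using valuation_subring_cases[OF y0] y0 by (auto simp: unit_def nonunits_def)
    then show ?thesis
    proof cases
      case 1
      then obtain n u where "unit u" "y = u * t ^ n" using dec1 y0 by blast
      then show ?thesis by (intro exI[of _ "int n"] exI[of _ u]) simp
    next
      case 2
      then show ?thesis by (intro exI[of _ 0] exI[of _ y]) simp
    next
      case 3
      then obtain n u where nu: "unit u" "inverse y = u * t ^ n" using dec1 y0 by fastforce
      then have "y = inverse (u * t ^ n)" by (metis inverse_inverse_eq)
      then have "y = inverse u * t powi (- int n)"
        by (simp add: power_int_minus)
      then show ?thesis using unit_inv[OF nu(1)] by blast
    qed
  qed auto
  then obtain ord uu where ou: "\<And>y. y \<noteq> 0 \<Longrightarrow> unit (uu y) \<and> y = uu y * t powi (ord y)" by metis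
  have pos: "n \<ge> 0" if "unit u" "u * t powi n \<in> A" for u n
  proof (rule ccontr)
    assume "\<not> n \<ge> 0"
    have "inverse u * (u * t powi n) \<in> A" using that A_rules(3) unit_def by blast
    then have "t powi n \<in> A" using that by (simp add: unit_def field_simps)
    then have "inverse (t ^ nat (- n)) \<in> A" using \<open>\<not> n \<ge> 0\<close> by (simp add: power_int_def power_inverse)
    then show False using tn[of "nat (-n)"] \<open>\<not> n \<ge> 0\<close> t by (auto simp: nonunits_def)
  qed
  have uniq: "ord y = n" if "unit u" "y = u * t powi n" for y u n
  proof -
    have y0: "y \<noteq> 0" using that t by (auto simp: unit_def)
    have 1: "uu y * t powi (ord y) = u * t powi n" using ou[OF y0] that by simp
    have "u * inverse (uu y) = 1 * t powi (ord y - n)"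
    proof -
      have "t powi (ord y - n) = t powi (ord y) / t powi n" using t by (simp add: power_int_diff)
      also have "\<dots> = u / uu y" using 1 ou[OF y0] t by (simp add: unit_def frac_eq_eq mult_ac)
      finally show ?thesis by (simp add: field_simps)
    qed
    moreover have "u * inverse (uu y) \<in> A" "uu y * inverse u \<in> A"
      using that ou[OF y0] A_rules(3) by (auto simp: unit_def)
    ultimately have A1: "1 * t powi (ord y - n) \<in> A" by simp
    have "uu y * inverse u = inverse (u * inverse (uu y))" by simp
    also have "\<dots> = 1 * t powi (n - ord y)"
      using \<open>u * inverse (uu y) = 1 * t powi (ord y - n)\<close> by (simp flip: power_int_minus)
    finally have A2: "1 * t powi (n - ord y) \<in> A" using \<open>uu y * inverse u \<in> A\<close> by simp
    have "unit 1" using A_rules by (auto simp: unit_def)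
    from pos[OF this A1] pos[OF this A2] show ?thesis by simp
  qed
  have ordA: "0 \<le> ord y \<longleftrightarrow> y \<in> A" if "y \<noteq> 0" for y
  proof
    assume "0 \<le> ord y"
    then have e: "t powi (ord y) = t ^ nat (ord y)" by (simp add: power_int_def)
    have "uu y \<in> A" using ou[OF that] by (simp only: unit_def)
    then have "uu y * t powi (ord y) \<in> A" unfolding e by (intro A_rules(3) tA)
    then show "y \<in> A" using ou[OF that] by metis
  next
    assume "y \<in> A"
    then have "uu y * t powi (ord y) \<in> A" using ou[OF that] by simp
    then show "0 \<le> ord y" using pos ou[OF that] by blast
  qed
  have ord_mult: "ord (y * z) = ord y + ord z" if "y \<noteq> 0" "z \<noteq> 0" for y z
  proof (rule uniq)
    show "unit (uu y * uu z)" using ou that unit_mult by auto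
    have "y * z = (uu y * t powi (ord y)) * (uu z * t powi (ord z))" using ou that by metis
    then show "y * z = uu y * uu z * t powi (ord y + ord z)" using t by (simp add: power_int_add mult_ac)
  qed
  have ord_inv: "ord (inverse y) = - ord y" if "y \<noteq> 0" for y
  proof -
    have "ord (y * inverse y) = 0" by (rule uniq[of 1]) (use that A_rules in \<open>auto simp: unit_def\<close>)
    then show ?thesis using ord_mult[of y "inverse y"] that by auto
  qed
  have ord_add: "min (ord y) (ord z) \<le> ord (y + z)" if "y \<noteq> 0" "z \<noteq> 0" "y + z \<noteq> 0" for y z
  proof -
    have *: "ord y \<le> ord (y + z)" if "y \<noteq> 0" "z \<noteq> 0" "y + z \<noteq> 0" "ord y \<le> ord z" for y z
    proof -
      have "ord (z * inverse y) \<ge> 0" using that by (simp add: ord_mult ord_inv)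
      then have "1 + z * inverse y \<in> A" using ordA[of "z * inverse y"] that A_rules by auto
      moreover have "y * (1 + z * inverse y) = y + z" using that by (simp add: field_simps)
      ultimately show ?thesis using ord_mult[of y "1 + z * inverse y"] ordA[of "1 + z * inverse y"] that
        by fastforce
    qed
    show ?thesis
      using *[of y z] *[of z y] that by (auto simp: add.commute min_def)
  qed
  define v where "v = (\<lambda>y. if y = 0 then Pinf else Fin (ord y))"
  have "v \<in> P"
  proof -
    have "v (y * z) = v y + v z" for y z by (auto simp: v_def ord_mult)
    moreover have "min (v y) (v z) \<le> v (y + z)" for y z using ord_add[of y z]
      by (cases "y = 0"; cases "z = 0"; cases "y + z = 0") (auto simp: v_def)
    moreover have "v (emb c) = 0" if "c \<noteq> 0" for c
    proof -
      have "ord (emb c) = 0" by (rule uniq[of "emb c"])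
        (use that A_rules(1)[of c] A_rules(1)[of "inverse c"] in \<open>auto simp: unit_def emb_inverse\<close>)
      then show ?thesis using that by (simp add: v_def zero_extended_def)
    qed
    moreover have "range v = insert Pinf (range Fin)"
    proof -
      have "Fin n \<in> range v" for n
      proof -
        have "ord (t powi n) = n" by (rule uniq[of 1]) (use A_rules in \<open>auto simp: unit_def\<close>)
        then have "v (t powi n) = Fin n" using t by (simp add: v_def)
        then show ?thesis by (metis rangeI)
      qed
      moreover have "Pinf \<in> range v" by (auto simp: v_def intro!: image_eqI[of _ _ 0])
      ultimately show ?thesis by (auto simp: v_def)
    qed
    ultimately show ?thesis by (auto simp: points_def v_def)
  qed
  moreover have "ord g > 0"
    using ordA[of g] ordA[of "inverse g"] ord_inv[of g] g by (auto simp: nonunits_def)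
  ultimately show ?thesis using g by (intro bexI[of _ v]) (auto simp: vord_def v_def)
qed

end


text \<open>With \<open>b\<close> the constant coefficient of \<open>q\<close>, the second relation
  times \<open>z ^ n\<close> expresses \<open>(1 - g * b) * z ^ n\<close> as \<open>g\<close> times
  a polynomial of degree below \<open>n\<close>. Multiplying the first relation by
  \<open>1 - g * b\<close> and substituting this for its top term lowers the degree.\<close>

lemma chevalley_descent:
  assumes A: "k_subring A" and gA: "g \<in> A" and z: "z \<noteq> 0" and nm: "m \<le> n" "n > 0"
    and p: "\<forall>i. coeff p i \<in> A" "degree p \<le> n" "1 = g * poly p z"
    and q: "\<forall>i. coeff q i \<in> A" "degree q \<le> m" "1 = g * poly q (inverse z)"
  shows "\<exists>r. (\<forall>i. coeff r i \<in> A) \<and> degree r \<le> n - 1 \<and> 1 = g * poly r z"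
proof -
  note A_rules = k_subringD[OF A]
  define s where "s = (\<Sum>j=1..m. monom (coeff q j) (n - j))"
  define p' where "p' = p - monom (coeff p n) n"
  define b where "b = coeff q 0"
  have pz: "poly p z = poly p' z + coeff p n * z ^ n" by (simp add: p'_def poly_monom)
  have qz: "poly q (inverse z) = b + (\<Sum>j=1..m. coeff q j * inverse z ^ j)"
  proof -
    have "poly q (inverse z) = (\<Sum>j\<le>m. coeff q j * inverse z ^ j)"
      by (subst poly_altdef, rule sum.mono_neutral_left) (use q(2) in \<open>auto simp: coeff_eq_0\<close>)
    also have "{..m} = insert 0 {1..m}" by auto
    finally show ?thesis by (simp add: b_def)
  qed
  have sz: "z ^ n * (\<Sum>j=1..m. coeff q j * inverse z ^ j) = poly s z"
    unfolding s_def poly_sum poly_monom sum_distrib_left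
  proof (intro sum.cong refl)
    fix j assume "j \<in> {1..m}"
    then have "z ^ n = z ^ (n - j) * z ^ j" using nm by (simp flip: power_add)
    then show "z ^ n * (coeff q j * inverse z ^ j) = coeff q j * z ^ (n - j)"
      using z by (simp add: field_simps)
  qed
  have e1: "(1 - g * b) * z ^ n = g * poly s z"
  proof -
    have "1 - g * b = g * (\<Sum>j=1..m. coeff q j * inverse z ^ j)" using q(3) qz by (simp add: algebra_simps)
    then show ?thesis by (simp add: mult_ac flip: sz)
  qed
  define r where "r = [:b:] + smult (1 - g * b) p' + smult (g * coeff p n) s"
  have sA: "coeff s i \<in> A" for i unfolding s_def coeff_sum
    by (intro k_subring_sum A) (use q(1) A_rules(4) in auto)
  have p'A: "coeff p' i \<in> A" for i using p(1) A_rules(4) by (auto simp: p'_def)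
  have "1 - g * b = (1 - g * b) * (g * poly p' z) + g * coeff p n * ((1 - g * b) * z ^ n)"
    using p(3) pz by (simp add: algebra_simps) (metis distrib_left mult.assoc mult.commute mult_1)
  then have "1 = g * poly r z" unfolding e1 by (simp add: r_def algebra_simps)
  moreover have "coeff r i \<in> A" for i
  proof -
    have bA: "b \<in> A" using q by (simp add: b_def)
    have cb: "coeff [:b:] i \<in> A" using bA A_rules(4) by (simp add: coeff_pCons split: nat.split)
    have c1: "1 - g * b \<in> A" by (intro A_rules(7) A_rules(3) A_rules(5) bA gA)
    have c2: "g * coeff p n \<in> A" using gA p(1) by (intro A_rules(3)) auto
    show ?thesis unfolding r_def coeff_add coeff_smult
      by (intro A_rules(2) cb A_rules(3)[OF c1 p'A] A_rules(3)[OF c2 sA])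
  qed
  moreover have "degree r \<le> n - 1"
  proof -
    have "degree p' \<le> n - 1"
    proof (rule degree_le, intro allI impI)
      fix i assume "i > n - 1"
      then show "coeff p' i = 0" using p(2) by (cases "i = n") (auto simp: p'_def coeff_eq_0)
    qed
    moreover have "degree s \<le> n - 1" unfolding s_def
    proof (rule degree_sum_le)
      fix j assume "j \<in> {1..m}"
      then show "degree (monom (coeff q j) (n - j)) \<le> n - 1"
        using degree_monom_le[of "coeff q j" "n - j"] by simp linarith
    qed auto
    ultimately show ?thesis unfolding r_def
      by (intro degree_add_le) (auto intro: order_trans[OF degree_smult_le])
  qed
  ultimately show ?thesis by blast
qed

text \<open>
  Chevalley's argument: if neither \<open>y\<close> nor \<open>1/y\<close> lies in \<open>A\<close>, then \<open>1/g\<close> is a polynomial over \<open>A\<close> both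
  in \<open>y\<close> and in \<open>1/y\<close>, and the one of larger degree can be shortened by means of the other.
\<close>
lemma maximal_valuation_subring:
  assumes A: "k_subring A" "g \<in> A" "inverse g \<notin> A" and g0: "g \<noteq> 0"
    and max: "\<And>A'. k_subring A' \<Longrightarrow> A \<subseteq> A' \<Longrightarrow> inverse g \<notin> A' \<Longrightarrow> A' = A"
  shows "valuation_subring A"
  unfolding valuation_subring_def
proof (intro conjI A allI impI)
  note A_rules = k_subringD[OF A(1)]
  define R where "R = (\<lambda>z n. \<exists>p. (\<forall>i. coeff p i \<in> A) \<and> degree p \<le> n \<and> 1 = g * poly p z)"
  have ex: "\<exists>n. R z n" if "z \<notin> A" for z
  proof -
    define A' where "A' = {poly p z | p. \<forall>i. coeff p i \<in> A}"
    have "k_subring A'" unfolding k_subring_def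
    proof (intro conjI ballI)
      show "range emb \<subseteq> A'"
      proof clarify
        fix c
        have "emb c = poly [:emb c:] z \<and> (\<forall>i. coeff [:emb c:] i \<in> A)"
          using A_rules(1,4) by (auto simp: coeff_pCons split: nat.split)
        then show "emb c \<in> A'" unfolding A'_def by blast
      qed
      fix y w assume "y \<in> A'" "w \<in> A'"
      then obtain p q where pq: "y = poly p z" "w = poly q z" "\<And>i. coeff p i \<in> A" "\<And>i. coeff q i \<in> A"
        by (auto simp: A'_def)
      have "y + w = poly (p + q) z \<and> (\<forall>i. coeff (p + q) i \<in> A)" using pq A_rules(2) by auto
      then show "y + w \<in> A'" unfolding A'_def by blast
      have "y * w = poly (p * q) z \<and> (\<forall>i. coeff (p * q) i \<in> A)"
        using pq A_rules(3) by (auto simp: coeff_mult intro!: k_subring_sum[OF A(1)])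
      then show "y * w \<in> A'" unfolding A'_def by blast
    qed
    moreover have "A \<subseteq> A'"
    proof
      fix a assume "a \<in> A"
      then have "a = poly [:a:] z \<and> (\<forall>i. coeff [:a:] i \<in> A)"
        using A_rules(4) by (auto simp: coeff_pCons split: nat.split)
      then show "a \<in> A'" unfolding A'_def by blast
    qed
    moreover have "z \<in> A'"
    proof -
      have "z = poly [:0, 1:] z \<and> (\<forall>i. coeff [:0, 1:] i \<in> A)"
        using A_rules(4,5) by (auto simp: coeff_pCons split: nat.split)
      then show ?thesis unfolding A'_def by blast
    qed
    ultimately have "inverse g \<in> A'" using max that by blast
    then obtain p where "inverse g = poly p z" "\<forall>i. coeff p i \<in> A" by (auto simp: A'_def)
    then show ?thesis using g0 unfolding R_def
      by (intro exI[of _ "degree p"] exI[of _ p]) (auto simp flip: \<open>inverse g = poly p z\<close>)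
  qed
  have R0: "\<not> R z 0" for z
  proof
    assume "R z 0"
    then obtain p where p: "\<forall>i. coeff p i \<in> A" "degree p \<le> 0" "1 = g * poly p z" by (auto simp: R_def)
    then obtain c where "p = [:c:]" using degree_eq_zeroE[of p] by auto
    then have "1 = g * c" "c \<in> A" using p by (auto dest: spec[of _ 0])
    then show False using A(3) by (metis inverse_unique)
  qed
  have desc: "R z (n - 1)" if "z \<noteq> 0" "m \<le> n" "n > 0" "R z n" "R (inverse z) m" for z n m
    using that chevalley_descent[OF A(1,2) that(1,2,3)] unfolding R_def by blast
  fix y :: 'a assume y0: "y \<noteq> 0"
  show "y \<in> A \<or> inverse y \<in> A"
  proof (rule ccontr)
    assume "\<not> ?thesis"
    then have e: "\<exists>n. R y n" "\<exists>n. R (inverse y) n" using ex by auto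
    define n where "n = (LEAST n. R y n)"
    define m where "m = (LEAST n. R (inverse y) n)"
    have n: "R y n" "\<And>k. k < n \<Longrightarrow> \<not> R y k" unfolding n_def
      using LeastI_ex[OF e(1)] not_less_Least by blast+
    have m: "R (inverse y) m" "\<And>k. k < m \<Longrightarrow> \<not> R (inverse y) k" unfolding m_def
      using LeastI_ex[OF e(2)] not_less_Least by blast+
    have nm: "n > 0" "m > 0" using n(1) m(1) R0 by (metis gr0I)+
    show False
    proof (cases "m \<le> n")
      case True
      then show False using desc[OF y0 True nm(1) n(1) m(1)] n(2)[of "n - 1"] nm by simp
    next
      case False
      then show False using desc[of "inverse y" n m] y0 n(1) m nm by simp
    qed
  qed
qed

text \<open>Zorn's lemma gives a subring maximal among those containing \<open>g\<close> but not
  \<open>1/g\<close>. It is a valuation ring in which \<open>g\<close> is a non-unit. There is such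
  a subring to begin with: k[g] does not contain \<open>1/g\<close>, since \<open>g\<close> is
  transcendental.\<close>

theorem exists_zero:
  assumes nc: "g \<notin> range emb"
  shows "\<exists>v\<in>P. vord v g > 0"
proof -
  have g0: "g \<noteq> 0" using nc emb_zero by (metis rangeI)
  define \<A> where "\<A> = {A. k_subring A \<and> g \<in> A \<and> inverse g \<notin> A}"
  have "range (ev g) \<in> \<A>"
  proof -
    have "k_subring (range (ev g))" unfolding k_subring_def
    proof (intro conjI ballI)
      show "range emb \<subseteq> range (ev g)"
      proof clarify
        fix c have "emb c = ev g [:c:]" by simp
        then show "emb c \<in> range (ev g)" by blast
      qed
      fix y z assume "y \<in> range (ev g)" "z \<in> range (ev g)"
      then show "y + z \<in> range (ev g)" "y * z \<in> range (ev g)"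
        by (auto simp flip: ev_add ev_mult)
    qed
    moreover have "g = ev g [:0, 1:]" by (simp add: emb_zero emb_one)
    moreover have "inverse g \<notin> range (ev g)"
    proof
      assume "inverse g \<in> range (ev g)"
      then obtain p where "inverse g = ev g p" by auto
      then have "ev g (pCons (-1) p) = 0" using g0 
        by (simp add: emb_minus emb_one flip: \<open>inverse g = ev g p\<close>)
      then have "pCons (-1) p = 0" using ev_eq_0_iff[OF nc] by blast
      then show False by simp
    qed
    ultimately show ?thesis unfolding \<A>_def by (metis (mono_tags, lifting) mem_Collect_eq rangeI)
  qed
  moreover have "\<Union>\<C> \<in> \<A>" if C: "\<C> \<noteq> {}" "subset.chain \<A> \<C>" for \<C>
  proof -
    have sub: "\<C> \<subseteq> \<A>" and tot: "\<And>A B. A \<in> \<C> \<Longrightarrow> B \<in> \<C> \<Longrightarrow> A \<subseteq> B \<or> B \<subseteq> A"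
      using C by (auto simp: subset.chain_def)
    have "k_subring (\<Union>\<C>)" unfolding k_subring_def
    proof (intro conjI ballI)
      show "range emb \<subseteq> \<Union>\<C>" using C(1) sub by (fastforce simp: \<A>_def k_subring_def)
      fix y z assume "y \<in> \<Union>\<C>" "z \<in> \<Union>\<C>"
      then obtain A B where AB: "A \<in> \<C>" "B \<in> \<C>" "y \<in> A" "z \<in> B" by blast
      then obtain D where D: "D \<in> \<C>" "y \<in> D" "z \<in> D" using tot[OF AB(1,2)] by blast
      then have "k_subring D" using sub by (auto simp: \<A>_def)
      then show "y + z \<in> \<Union>\<C>" "y * z \<in> \<Union>\<C>" using D k_subringD by blast+
    qed
    then show ?thesis using C(1) sub by (auto simp: \<A>_def)
  qed
  ultimately obtain A where A: "A \<in> \<A>" "\<And>B. B \<in> \<A> \<Longrightarrow> A \<subseteq> B \<Longrightarrow> B = A"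
    using subset_Zorn_nonempty[of \<A>] by blast
  have "valuation_subring A"
  proof (rule maximal_valuation_subring[of A g])
    fix A' assume "k_subring A'" "A \<subseteq> A'" "inverse g \<notin> A'"
    then show "A' = A" using A by (intro A(2)) (auto simp: \<A>_def)
  qed (use A g0 in \<open>auto simp: \<A>_def\<close>)
  moreover have "g \<in> nonunits A" using A(1) by (auto simp: \<A>_def nonunits_def)
  ultimately show ?thesis using valuation_subring_place g0 by blast
qed

text \<open>Otherwise the valuation ring of \<open>v\<close> lies in that of \<open>w\<close>. Then
  order 0 at \<open>v\<close> implies order 0 at \<open>w\<close>, so the order at \<open>w\<close>
  is a fixed multiple of the order at \<open>v\<close>, and normalization makes the factor
  1.\<close>

lemma places_separate:
  assumes v: "v \<in> P" and w: "w \<in> P" and ne: "v \<noteq> w"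
  shows "\<exists>z. z \<noteq> 0 \<and> vord v z \<ge> 0 \<and> vord w z < 0"
proof (rule ccontr)
  assume "\<not> ?thesis"
  then have *: "\<And>z. z \<noteq> 0 \<Longrightarrow> vord v z \<ge> 0 \<Longrightarrow> vord w z \<ge> 0" by force
  have zero: "vord w z = 0" if "z \<noteq> 0" "vord v z = 0" for z
    using *[of z] *[of "inverse z"] that v w by (simp add: vord_inverse)
  obtain t where t: "t \<noteq> 0" "vord v t = 1" using vord_unif[OF v] by blast
  have eq: "vord w y = vord v y * vord w t" if "y \<noteq> 0" for y
  proof -
    have "vord v (y / t powi (vord v y)) = 0" using that t v by (simp add: vord_divide vord_powi)
    then have "vord w (y / t powi (vord v y)) = 0" using zero that t by auto
    then show ?thesis using that t w by (simp add: vord_divide vord_powi)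
  qed
  have "vord w t \<ge> 0" using * t by simp
  moreover obtain y where "y \<noteq> 0" "vord w y = 1" using vord_unif[OF w] by blast
  then have "vord v y * vord w t = 1" using eq[of y] by simp
  ultimately have "vord w t = 1" using zmult_eq_1_iff by fastforce
  then have "v = w" using eq by (intro pt_eqI v w) auto
  then show False using ne by simp
qed

lemma places_sign:
  assumes v: "v \<in> P" and T: "finite T" "T \<subseteq> P" "v \<notin> T"
  shows "\<exists>y. y \<noteq> 0 \<and> vord v y > 0 \<and> (\<forall>w\<in>T. vord w y < 0)"
  using T
proof (induction T)
  case empty
  obtain y where "y \<noteq> 0" "vord v y = 1" using vord_unif[OF v] by blast
  then show ?case by (intro exI[of _ y]) auto
next
  case (insert w T)
  have w: "w \<in> P" "v \<noteq> w" using insert by auto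
  obtain y where y: "y \<noteq> 0" "vord v y > 0" "\<And>u. u \<in> T \<Longrightarrow> vord u y < 0" using insert by auto
  obtain z1 where z1: "z1 \<noteq> 0" "vord v z1 \<ge> 0" "vord w z1 < 0"
    using places_separate[OF v w] by blast
  obtain z2 where z2: "z2 \<noteq> 0" "vord w z2 \<ge> 0" "vord v z2 < 0"
    using places_separate[OF w(1) v] w by blast
  \<comment> \<open>Each of \<open>z1\<close> and \<open>z2\<close> separates \<open>v\<close> and
    \<open>w\<close> in one direction; the quotient has a zero at \<open>v\<close> and a pole at
    \<open>w\<close>.\<close>
  define z where "z = z1 / z2"
  have z: "z \<noteq> 0" "vord v z > 0" "vord w z < 0"
    using z1 z2 v w by (auto simp: z_def vord_divide)
  show ?case
  proof (cases "vord w y < 0")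
    case True
    then show ?thesis using y by auto
  next
    case False
    \<comment> \<open>At points of \<open>T\<close> where \<open>z\<close> has a pole, this power of
      \<open>z\<close> dominates \<open>y\<close>; where \<open>z\<close> is regular, the pole of
      \<open>y\<close> dominates. The summand 1 keeps \<open>r\<close> positive for empty
      \<open>T\<close>.\<close>
    define r where "r = nat (1 + (\<Sum>u\<in>T. \<bar>vord u y\<bar>))"
    have r: "r > 0" "\<bar>vord u y\<bar> < int r" if "u \<in> T" for u
      using member_le_sum[of u T "\<lambda>u. \<bar>vord u y\<bar>"] that insert(1) by (auto simp: r_def)
    have "(\<Sum>u\<in>T. \<bar>vord u y\<bar>) \<ge> 0" by (rule sum_nonneg) auto
    then have r0: "r > 0" unfolding r_def by linarith
    have zr: "vord u (z ^ r) = int r * vord u z" if "u \<in> P" for u using z that by (simp add: vord_power)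
    have vw: "y + z ^ r \<noteq> 0 \<and> vord w (y + z ^ r) < 0"
    proof -
      have lt: "vord w (z ^ r) < 0" using z r0 w by (simp add: zr mult_pos_neg)
      have "z ^ r + y \<noteq> 0 \<and> vord w (z ^ r + y) = vord w (z ^ r)"
        by (rule vord_add_eq) (use w z lt False in \<open>auto simp: vge_def\<close>)
      then show ?thesis using lt by (simp add: add.commute)
    qed
    moreover have "vord v (y + z ^ r) > 0"
    proof -
      have "vord v (z ^ r) > 0" using z r0 v by (simp add: zr)
      then have "vge v 1 (y + z ^ r)" using y by (intro vge_add v) (auto simp: vge_def)
      then show ?thesis using vw by (auto simp: vge_def)
    qed
    moreover have "vord u (y + z ^ r) < 0" if u: "u \<in> T" for u
    proof -
      have uP: "u \<in> P" using u insert by auto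
      show ?thesis
      proof (cases "vord u z \<ge> 0")
        case True
        then have "vord u (z ^ r) \<ge> 0" using uP by (simp add: zr)
        then have "vord u (y + z ^ r) = vord u y"
          using vord_add_eq[OF uP y(1), of "z ^ r"] y(3)[OF u] by (auto simp: vge_def)
        then show ?thesis using y(3)[OF u] by simp
      next
        case False
        have "int r * vord u z \<le> int r * (-1)" using False by (intro mult_left_mono) auto
        then have "vord u (z ^ r) < vord u y" using r(2)[OF u] uP by (simp add: zr)
        then have "vord u (z ^ r + y) = vord u (z ^ r)"
          using vord_add_eq[OF uP, of "z ^ r" y] z by (auto simp: vge_def)
        then show ?thesis using \<open>vord u (z ^ r) < vord u y\<close> y(3)[OF u] by (simp add: add.commute)
      qed
    qed
    ultimately show ?thesis by auto
  qed
qed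

text \<open>If \<open>y\<close> vanishes at \<open>v\<close> and has poles on \<open>T\<close>, then
  \<open>1 / (1 + y ^ m)\<close> has order 0 at \<open>v\<close> and order at least \<open>m\<close>
  on \<open>T\<close>.\<close>

lemma weak_approximation:
  assumes v: "v \<in> P" and T: "finite T" "T \<subseteq> P" "v \<notin> T"
  shows "\<exists>u. u \<noteq> 0 \<and> vord v u = 0 \<and> (\<forall>w\<in>T. vord w u \<ge> n)"
proof -
  obtain y where y: "y \<noteq> 0" "vord v y > 0" "\<And>w. w \<in> T \<Longrightarrow> vord w y < 0"
    using places_sign[OF assms] by blast
  define m where "m = Suc (nat n)"
  have vm: "1 + y ^ m \<noteq> 0 \<and> vord v (1 + y ^ m) = vord v 1"
  proof (rule vord_add_eq[OF v])
    have "int m * vord v y \<ge> 1 * 1" by (rule mult_mono) (use y in \<open>auto simp: m_def\<close>)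
    then show "vge v (vord v 1 + 1) (y ^ m)" using v y by (auto simp: vge_def vord_power)
  qed auto
  have "vord w (inverse (1 + y ^ m)) \<ge> n" if w: "w \<in> T" for w
  proof -
    have wP: "w \<in> P" using w T by auto
    have "int m * vord w y \<le> int m * (-1)" using y(3)[OF w] by (intro mult_left_mono) auto
    moreover have "vord w (y ^ m) = int m * vord w y" using y wP by (simp add: vord_power)
    moreover have "int m \<ge> n" "int m \<ge> 1" by (auto simp: m_def)
    ultimately have le: "vord w (y ^ m) \<le> - n" "vord w (y ^ m) < 0" by linarith+
    have "vord w (y ^ m + 1) = vord w (y ^ m)"
      using vord_add_eq[OF wP, of "y ^ m" 1] y le wP by (auto simp: vge_def)
    then show ?thesis using le wP by (simp add: vord_inverse add.commute)
  qed
  then show ?thesis using vm v by (intro exI[of _ "inverse (1 + y ^ m)"]) (auto simp: vord_inverse)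
qed

end

section \<open>Local families, zeros and poles\<close>

context function_field_element
begin

text \<open>
  For \<open>t = x - c\<close> and \<open>t = 1/x\<close>, a non-zero element of \<open>k(x)\<close> is \<open>\<alpha> t^n\<close> up to higher order at all
  zeros of \<open>t\<close> at once.
\<close>
definition leading_terms :: "'a \<Rightarrow> bool" where
  "leading_terms t \<longleftrightarrow> t \<noteq> 0 \<and> (\<forall>s. s \<noteq> 0 \<longrightarrow> (\<exists>n \<alpha>. \<alpha> \<noteq> 0 \<and>
     (\<forall>v\<in>P. vord v t > 0 \<longrightarrow> vge v ((n + 1) * vord v t) (phi x s - emb \<alpha> * t powi n))))"

text \<open>The leading term of a quotient is the quotient of the leading terms. The error is
  estimated after multiplication by the denominator, whose order is known from its own leading
  term.\<close>

lemma leading_terms_polyI: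
  assumes t: "t \<noteq> 0"
    and poly: "\<And>p. p \<noteq> 0 \<Longrightarrow> \<exists>n \<alpha>. \<alpha> \<noteq> 0 \<and>
      (\<forall>v\<in>P. vord v t > 0 \<longrightarrow> vge v ((n + 1) * vord v t) (ev x p - emb \<alpha> * t powi n))"
  shows "leading_terms t"
  unfolding leading_terms_def
proof (intro conjI t allI impI)
  fix s :: "'k poly fract" assume s: "s \<noteq> 0"
  obtain p q where pq: "s = Fract p q" "q \<noteq> 0" by (cases s) auto
  have "p \<noteq> 0" using s pq by (auto simp: fract_collapse)
  obtain n \<alpha> where p: "\<alpha> \<noteq> 0" "\<And>v. v \<in> P \<Longrightarrow> vord v t > 0 \<Longrightarrow> vge v ((n + 1) * vord v t) (ev x p - emb \<alpha> * t powi n)"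
    using poly[OF \<open>p \<noteq> 0\<close>] by blast
  obtain m \<beta> where q: "\<beta> \<noteq> 0" "\<And>v. v \<in> P \<Longrightarrow> vord v t > 0 \<Longrightarrow> vge v ((m + 1) * vord v t) (ev x q - emb \<beta> * t powi m)"
    using poly[OF pq(2)] by blast
  have "vge v ((n - m + 1) * vord v t) (phi x s - emb (\<alpha> / \<beta>) * t powi (n - m))"
    if v: "v \<in> P" and e: "vord v t > 0" for v
  proof -
    let ?e = "vord v t"
    have tp: "vord v (emb c * t powi k) = k * ?e" if "c \<noteq> 0" for c k
      using that v t by (simp add: vord_mult vord_powi)
    have b: "ev x q \<noteq> 0" using pq by simp
    have lead: "vge v (vord v (emb \<beta> * t powi m) + 1) (ev x q - emb \<beta> * t powi m)"
      by (rule vge_mono[OF q(2)[OF v e]]) (use tp[OF q(1)] e in \<open>simp add: algebra_simps\<close>)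
    have vb: "vord v (ev x q) = m * ?e"
      using vord_add_eq[OF v _ lead] q(1) t tp[OF q(1)] by simp
    have eq: "(phi x s - emb (\<alpha> / \<beta>) * t powi (n - m)) * ev x q =
      (ev x p - emb \<alpha> * t powi n) - emb (\<alpha> / \<beta>) * t powi (n - m) * (ev x q - emb \<beta> * t powi m)"
      using b q(1) t by (simp add: pq phi_Fract field_simps emb_divide power_int_diff)
    have 1: "vge v ((n + 1) * ?e) (ev x p - emb \<alpha> * t powi n)" using p v e by blast
    have ee: "(n - m) * ?e + (m + 1) * ?e = (n + 1) * ?e" by (simp add: algebra_simps)
    have 2: "vge v ((n - m) * ?e + (m + 1) * ?e) (emb (\<alpha> / \<beta>) * t powi (n - m) * (ev x q - emb \<beta> * t powi m))"
      by (intro vge_mult v q e) (use tp[of "\<alpha> / \<beta>" "n - m"] p q in \<open>auto simp: vge_def\<close>)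
    have "vge v ((n + 1) * ?e) ((phi x s - emb (\<alpha> / \<beta>) * t powi (n - m)) * ev x q)"
      unfolding eq by (rule vge_diff[OF v 1 2[unfolded ee]])
    also have "(n + 1) * ?e = (n - m + 1) * ?e + vord v (ev x q)" by (simp add: vb algebra_simps)
    finally show ?thesis using vge_cancel[OF v b] by blast
  qed
  moreover have "\<alpha> / \<beta> \<noteq> 0" using p q by simp
  ultimately show "\<exists>n \<alpha>. \<alpha> \<noteq> 0 \<and> (\<forall>v\<in>P. vord v t > 0 \<longrightarrow>
    vge v ((n + 1) * vord v t) (phi x s - emb \<alpha> * t powi n))" by blast
qed

lemma x_minus_const_nonzero: "x - emb c \<noteq> 0"
  using nonconst by auto

lemma x_nonzero: "x \<noteq> 0"
  using x_minus_const_nonzero[of 0] by (simp add: emb_zero)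

lemma leading_terms_diff: "leading_terms (x - emb c)"
proof (rule leading_terms_polyI)
  fix p :: "'k poly" assume p0: "p \<noteq> 0"
  obtain q where q: "p = [:-c, 1:] ^ order c p * q" "\<not> [:-c, 1:] dvd q"
    using order_decomp[OF p0] by blast
  define \<alpha> where "\<alpha> = poly q c"
  have \<alpha>: "\<alpha> \<noteq> 0" using q(2) by (simp add: \<alpha>_def poly_eq_0_iff_dvd)
  have "poly (q - [:\<alpha>:]) c = 0" by (simp add: \<alpha>_def)
  then obtain r where r: "q - [:\<alpha>:] = [:-c, 1:] * r" unfolding poly_eq_0_iff_dvd by (auto simp: dvd_def)
  have t: "ev x [:-c, 1:] = x - emb c" by (simp add: emb_minus emb_one emb_zero)
  have "ev x q - emb \<alpha> = ev x (q - [:\<alpha>:])" by (simp add: ev_diff)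
  also have "\<dots> = (x - emb c) * ev x r" by (simp only: r ev_mult t)
  finally have qr: "ev x q = emb \<alpha> + (x - emb c) * ev x r" by (simp add: algebra_simps)
  define k where "k = order c p"
  have "ev x p = (x - emb c) ^ k * ev x q"
    by (subst q(1)) (simp only: ev_mult ev_power t k_def)
  then have eq: "ev x p - emb \<alpha> * (x - emb c) powi int k = (x - emb c) ^ k * (x - emb c) * ev x r"
    by (simp add: qr algebra_simps)
  have "vge v ((int k + 1) * vord v (x - emb c)) (ev x p - emb \<alpha> * (x - emb c) powi int k)"
    if v: "v \<in> P" "vord v (x - emb c) > 0" for v
  proof -
    have "vge v 0 (x - emb c + emb c)" using v by (intro vge_add) (auto simp: vge_def)
    then have "vge v 0 (ev x r)" using vge_ev v by simp
    moreover have "vge v ((int k + 1) * vord v (x - emb c)) ((x - emb c) ^ k * (x - emb c))"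
      using vord_power[of v "x - emb c" "Suc k"] x_minus_const_nonzero v
      by (simp add: vge_def mult.commute algebra_simps)
    ultimately have "vge v ((int k + 1) * vord v (x - emb c) + 0) ((x - emb c) ^ k * (x - emb c) * ev x r)"
      by (intro vge_mult v)
    then show ?thesis unfolding eq by simp
  qed
  then show "\<exists>n \<alpha>. \<alpha> \<noteq> 0 \<and> (\<forall>v\<in>P. vord v (x - emb c) > 0 \<longrightarrow>
    vge v ((n + 1) * vord v (x - emb c)) (ev x p - emb \<alpha> * (x - emb c) powi n))"
    using \<alpha> by blast
qed (rule x_minus_const_nonzero)

lemma leading_terms_x: "leading_terms x"
  using leading_terms_diff[of 0] by (simp add: emb_zero)

text \<open>At a pole of \<open>x\<close> the monomial of highest degree dominates, so the exponent
  of \<open>1/x\<close> is minus the degree.\<close>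

lemma leading_terms_inverse: "leading_terms (inverse x)"
proof (rule leading_terms_polyI)
  fix p :: "'k poly" assume p0: "p \<noteq> 0"
  let ?n = "degree p"
  have pw: "inverse x powi (- int ?n) = x ^ ?n" by (simp add: power_int_minus power_inverse)
  have eq: "ev x p - emb (lead_coeff p) * inverse x powi (- int ?n) = (\<Sum>i<?n. emb (coeff p i) * x ^ i)"
    unfolding pw ev_altdef[OF order_refl] by (simp add: lessThan_Suc_atMost[symmetric])
  have "vge v ((- int ?n + 1) * vord v (inverse x)) (ev x p - emb (lead_coeff p) * inverse x powi (- int ?n))"
    if v: "v \<in> P" "vord v (inverse x) > 0" for v
    unfolding eq
  proof (intro vge_sum v vge_emb_mult)
    fix i assume "i \<in> {..<?n}"
    then have "(- int ?n + 1) * vord v (inverse x) \<le> (- int i) * vord v (inverse x)"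
      using v by (intro mult_right_mono) auto
    also have "\<dots> = vord v (x ^ i)" using v x_nonzero by (simp add: vord_inverse vord_power)
    finally show "vge v ((- int ?n + 1) * vord v (inverse x)) (x ^ i)" by (simp add: vge_def)
  qed
  then show "\<exists>n \<alpha>. \<alpha> \<noteq> 0 \<and> (\<forall>v\<in>P. vord v (inverse x) > 0 \<longrightarrow>
    vge v ((n + 1) * vord v (inverse x)) (ev x p - emb \<alpha> * inverse x powi n))"
    using p0 by (intro exI[of _ "- int ?n"] exI[of _ "lead_coeff p"]) auto
qed (use x_nonzero in auto)

text \<open>The exponent \<open>n\<close> is the least one among the non-zero coefficients. Those
  with a larger exponent get \<beta> equal to 0, so one exponent serves the whole family and some
  \<beta> is non-zero.\<close>

lemma leading_coefficients:
  assumes t: "leading_terms t" and I: "finite I" "i0 \<in> I" "s i0 \<noteq> 0"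
  shows "\<exists>n \<beta>. (\<exists>i\<in>I. \<beta> i \<noteq> 0) \<and> (\<forall>i\<in>I. \<forall>v\<in>P. vord v t > 0 \<longrightarrow>
    vge v ((n + 1) * vord v t) (phi x (s i) - emb (\<beta> i) * t powi n))"
proof -
  have t0: "t \<noteq> 0" using t by (simp add: leading_terms_def)
  have "\<forall>i. \<exists>n \<alpha>. s i \<noteq> 0 \<longrightarrow> \<alpha> \<noteq> 0 \<and>
     (\<forall>v\<in>P. vord v t > 0 \<longrightarrow> vge v ((n + 1) * vord v t) (phi x (s i) - emb \<alpha> * t powi n))"
    using t unfolding leading_terms_def by blast
  then obtain N A where NA: "\<And>i. s i \<noteq> 0 \<Longrightarrow> A i \<noteq> 0"
     "\<And>i v. s i \<noteq> 0 \<Longrightarrow> v\<in>P \<Longrightarrow> vord v t > 0 \<Longrightarrow>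
        vge v ((N i + 1) * vord v t) (phi x (s i) - emb (A i) * t powi (N i))" by metis
  define J where "J = {i \<in> I. s i \<noteq> 0}"
  define n where "n = Min (N ` J)"
  define \<beta> where "\<beta> = (\<lambda>i. if s i \<noteq> 0 \<and> N i = n then A i else 0)"
  have J: "finite (N ` J)" "N ` J \<noteq> {}" using I by (auto simp: J_def)
  obtain i where i: "i \<in> J" "N i = n" using Min_in[OF J] by (auto simp: n_def)
  have nz: "\<exists>i\<in>I. \<beta> i \<noteq> 0" using i NA(1) by (intro bexI[of _ i]) (auto simp: \<beta>_def J_def)
  have "vge v ((n + 1) * vord v t) (phi x (s i) - emb (\<beta> i) * t powi n)"
    if i: "i \<in> I" and v: "v \<in> P" "vord v t > 0" for i v
  proof (cases "s i = 0")
    case False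
    show ?thesis
    proof (cases "N i = n")
      case True
      then show ?thesis using NA(2)[OF False v] False by (simp add: \<beta>_def)
    next
      case ne: False
      have "n \<le> N i" unfolding n_def by (rule Min_le) (use J False i in \<open>auto simp: J_def\<close>)
      then have lt: "n + 1 \<le> N i" using ne by simp
      have "vge v ((n + 1) * vord v t) (phi x (s i) - emb (A i) * t powi (N i))"
        by (rule vge_mono[OF NA(2)[OF False v]]) (use lt v in \<open>auto intro: mult_right_mono\<close>)
      moreover have "vge v ((n + 1) * vord v t) (emb (A i) * t powi (N i))"
        by (intro vge_emb_mult v) (use lt v t0 in \<open>auto simp: vge_def vord_powi intro: mult_right_mono\<close>)
      ultimately have "vge v ((n + 1) * vord v t) (phi x (s i) - emb (A i) * t powi (N i) + emb (A i) * t powi (N i))"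
        by (rule vge_add[OF v(1)])
      then show ?thesis using ne by (simp add: \<beta>_def emb_zero)
    qed
  qed (simp add: \<beta>_def emb_zero)
  then show ?thesis using nz by blast
qed

end

section \<open>Families adapted to a fibre\<close>

context function_field
begin

text \<open>One index for each point and each order below its multiplicity, so that the size is the
  sum of the multiplicities.\<close>

definition local_index :: "('a \<Rightarrow> int extended) set \<Rightarrow> 'a \<Rightarrow> (('a \<Rightarrow> int extended) \<times> nat) set" where
  "local_index T t = (SIGMA v:T. {..<nat (vord v t)})"

text \<open>
  If \<open>T\<close> is the set of all zeros of \<open>t\<close>, then \<open>u\<close> is a basis over \<open>k(x)\<close> that is adapted to the
  filtrations of the fibre \<open>t = 0\<close> by order.
\<close>
definition local_family :: "('a \<Rightarrow> int extended) set \<Rightarrow> 'a \<Rightarrow> (('a \<Rightarrow> int extended) \<times> nat \<Rightarrow> 'a) \<Rightarrow> bool" where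
  "local_family T t u \<longleftrightarrow> (\<forall>v\<in>T. \<forall>j<nat (vord v t). u (v, j) \<noteq> 0 \<and> vord v (u (v, j)) = int j \<and>
     (\<forall>w\<in>T - {v}. vord w t \<le> vord w (u (v, j))))"

lemma finite_local_index: "finite T \<Longrightarrow> finite (local_index T t)"
  by (auto simp: local_index_def)

lemma card_local_index:
  assumes "finite T" "\<And>v. v \<in> T \<Longrightarrow> vord v t > 0"
  shows "int (card (local_index T t)) = (\<Sum>v\<in>T. vord v t)"
  using assms by (simp add: local_index_def less_imp_le)

lemma local_family_exists:
  assumes T: "finite T" "T \<subseteq> P"
  shows "\<exists>u. local_family T t u"
proof -
  have "\<exists>y. v \<in> T \<longrightarrow> y \<noteq> 0 \<and> vord v y = int j \<and> (\<forall>w\<in>T - {v}. vord w t \<le> vord w y)" for v j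
  proof (cases "v \<in> T")
    case True
    then have v: "v \<in> P" using T by auto
    obtain y where y: "y \<noteq> 0" "vord v y = int j" using vord_unif[OF v] by blast
    \<comment> \<open>\<open>z\<close> must make up for the orders of \<open>y\<close> at the other
      points; one bound serves all of them.\<close>
    define M where "M = (\<Sum>w\<in>T. \<bar>vord w t - vord w y\<bar>)"
    obtain z where z: "z \<noteq> 0" "vord v z = 0" "\<And>w. w \<in> T - {v} \<Longrightarrow> vord w z \<ge> M"
      using weak_approximation[OF v, of "T - {v}" M] T by auto
    have "vord w t \<le> vord w (y * z)" if w: "w \<in> T - {v}" for w
    proof -
      have "\<bar>vord w t - vord w y\<bar> \<le> M" unfolding M_def
        by (rule member_le_sum[of w T "\<lambda>w. \<bar>vord w t - vord w y\<bar>"]) (use w T in auto)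
      moreover have "vord w (y * z) = vord w y + vord w z"
        using w T y z by (intro vord_mult) auto
      ultimately show ?thesis using z(3)[OF w] by linarith
    qed
    then show ?thesis using y z v by (intro exI[of _ "y * z"]) (auto simp: vord_mult)
  qed auto
  then obtain u where "\<And>v j. v \<in> T \<Longrightarrow> u v j \<noteq> 0 \<and> vord v (u v j) = int j \<and> (\<forall>w\<in>T - {v}. vord w t \<le> vord w (u v j))"
    by metis
  then show ?thesis by (intro exI[of _ "\<lambda>(v, j). u v j"]) (auto simp: local_family_def)
qed

lemma local_family_vge:
  assumes u: "local_family T t u" and i: "i \<in> local_index T t" and w: "w \<in> T" "vord w t > 0"
  shows "vge w 0 (u i)" "w \<noteq> fst i \<Longrightarrow> vge w (vord w t) (u i)"
proof -
  obtain v j where i': "i = (v, j)" "v \<in> T" "j < nat (vord v t)" using i by (auto simp: local_index_def)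
  have *: "vord v (u (v, j)) = int j" "\<forall>w\<in>T - {v}. vord w t \<le> vord w (u (v, j))"
    using u i' unfolding local_family_def by blast+
  show ne: "w \<noteq> fst i \<Longrightarrow> vge w (vord w t) (u i)"
    using * w i' by (auto simp: vge_def)
  show "vge w 0 (u i)"
  proof (cases "w = v")
    case False
    then show ?thesis using ne w i' by (auto intro: vge_mono)
  qed (use * i' in \<open>auto simp: vge_def\<close>)
qed

text \<open>At \<open>v\<close> the members with first index \<open>v\<close> have the distinct
  orders 0, 1, ..., and all others vanish to the full order of \<open>t\<close>. Hence the order of
  the combination is the least index with a non-zero coefficient.\<close>

lemma local_family_coefficient:
  assumes T: "finite T" "T \<subseteq> P" and u: "local_family T t u"
    and v: "v \<in> T" "j < nat (vord v t)" "int j < m"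
    and sum: "vge v m (\<Sum>i\<in>local_index T t. emb (a i) * u i)"
  shows "a (v, j) = 0"
proof (rule ccontr)
  assume ne: "a (v, j) \<noteq> 0"
  define l where "l = (LEAST j. a (v, j) \<noteq> 0)"
  have al: "a (v, l) \<noteq> 0" unfolding l_def by (rule LeastI, rule ne)
  have lj: "l \<le> j" unfolding l_def by (rule Least_le, rule ne)
  have less: "a (v, j') = 0" if "j' < l" for j' using not_less_Least that unfolding l_def by blast
  have vP: "v \<in> P" using v T by auto
  have le: "l < nat (vord v t)" using lj v by simp
  have lI: "(v, l) \<in> local_index T t" using le v by (simp add: local_index_def)
  have ul: "u (v, l) \<noteq> 0" "vord v (u (v, l)) = int l" using u v le by (auto simp: local_family_def)
  have rest: "vge v (int l + 1) (\<Sum>i\<in>local_index T t - {(v, l)}. emb (a i) * u i)"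
  proof (rule vge_sum[OF vP])
    fix i assume i: "i \<in> local_index T t - {(v, l)}"
    show "vge v (int l + 1) (emb (a i) * u i)"
    proof (cases "fst i = v")
      case True
      then obtain j' where j': "i = (v, j')" by (metis prod.collapse)
      show ?thesis
      proof (cases "j' < l")
        case True
        then show ?thesis using less j' by (simp add: emb_zero)
      next
        case False
        then have "j' > l" "j' < nat (vord v t)" using i j' by (auto simp: local_index_def)
        then have "vord v (u i) \<ge> int l + 1" using u v j' by (auto simp: local_family_def)
        then show ?thesis by (intro vge_emb_mult vP) (simp add: vge_def)
      qed
    next
      case False
      have "vge v (vord v t) (u i)" by (rule local_family_vge(2)[OF u]) (use i v False le in auto)
      then have "vge v (int l + 1) (u i)" using le by (elim vge_mono) auto
      then show ?thesis by (rule vge_emb_mult[OF vP])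
    qed
  qed
  have "vord v (emb (a (v, l)) * u (v, l)) = int l" using ul al vP by (simp add: vord_mult)
  then have "emb (a (v, l)) * u (v, l) + (\<Sum>i\<in>local_index T t - {(v, l)}. emb (a i) * u i) \<noteq> 0 \<and>
    vord v (emb (a (v, l)) * u (v, l) + (\<Sum>i\<in>local_index T t - {(v, l)}. emb (a i) * u i)) = int l"
    using vord_add_eq[OF vP, of "emb (a (v, l)) * u (v, l)"] rest ul al by simp
  moreover have "(\<Sum>i\<in>local_index T t. emb (a i) * u i) =
    emb (a (v, l)) * u (v, l) + (\<Sum>i\<in>local_index T t - {(v, l)}. emb (a i) * u i)"
    using lI finite_local_index[OF T(1)] by (simp add: sum.remove)
  ultimately have "\<not> vge v m (\<Sum>i\<in>local_index T t. emb (a i) * u i)"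
    using v lj by (auto simp: vge_def)
  then show False using sum by simp
qed

end

context function_field_element
begin

context
  fixes T t u
  assumes T: "finite T" "T \<subseteq> P" "\<And>v. v \<in> T \<Longrightarrow> vord v t > 0"
    and t: "leading_terms t"
    and u: "local_family T t u"
begin

text \<open>Up to higher order the sum is \<open>t powi n\<close> times the combination with the
  constants \<beta>. If the claim failed, this combination would vanish on \<open>T\<close> to the
  full order of \<open>t\<close>, which forces every \<beta> to be 0.\<close>

lemma local_family_leading:
  assumes "\<forall>i\<in>local_index T t. \<forall>v\<in>P. vord v t > 0 \<longrightarrow>
    vge v ((n + 1) * vord v t) (phi x (s i) - emb (\<beta> i) * t powi n)"
    and \<beta>: "\<exists>i\<in>local_index T t. \<beta> i \<noteq> 0"
  shows "\<exists>v\<in>T. \<not> vge v ((n + 1) * vord v t) (\<Sum>i\<in>local_index T t. phi x (s i) * u i)"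
proof (rule ccontr)
  let ?I = "local_index T t"
  assume "\<not> ?thesis"
  then have *: "\<And>v. v \<in> T \<Longrightarrow> vge v ((n + 1) * vord v t) (\<Sum>i\<in>?I. phi x (s i) * u i)" by blast
  have t0: "t \<noteq> 0" using t by (simp add: leading_terms_def)
  have "\<beta> i = 0" if i: "i \<in> ?I" for i
  proof -
    obtain v j where vj: "i = (v, j)" "v \<in> T" "j < nat (vord v t)" using i by (auto simp: local_index_def)
    have vP: "v \<in> P" and e: "vord v t > 0" using T vj by auto
    have "vge v ((n + 1) * vord v t) (\<Sum>i\<in>?I. (phi x (s i) - emb (\<beta> i) * t powi n) * u i)"
    proof (rule vge_sum[OF vP])
      fix i assume i: "i \<in> ?I"
      have "vge v ((n + 1) * vord v t + 0) ((phi x (s i) - emb (\<beta> i) * t powi n) * u i)"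
        by (intro vge_mult vP local_family_vge(1)[OF u]) (use assms i vj vP e in auto)
      then show "vge v ((n + 1) * vord v t) ((phi x (s i) - emb (\<beta> i) * t powi n) * u i)" by simp
    qed
    from vge_diff[OF vP *[OF vj(2)] this]
    have "vge v ((n + 1) * vord v t) (\<Sum>i\<in>?I. emb (\<beta> i) * t powi n * u i)"
      by (simp add: sum_subtractf[symmetric] algebra_simps)
    also have "(\<Sum>i\<in>?I. emb (\<beta> i) * t powi n * u i) = (\<Sum>i\<in>?I. emb (\<beta> i) * u i) * t powi n"
      by (subst sum_distrib_right) (simp add: mult_ac)
    also have "(n + 1) * vord v t = vord v t + vord v (t powi n)"
      using t0 vP by (simp add: vord_powi algebra_simps)
    finally have "vge v (vord v t) (\<Sum>i\<in>?I. emb (\<beta> i) * u i)"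
      using vge_cancel[OF vP, of "t powi n"] t0 by simp
    moreover have "int j < vord v t" using vj(3) by simp
    ultimately show "\<beta> i = 0" using local_family_coefficient[OF T(1,2) u vj(2,3)] vj(1) by blast
  qed
  then show False using \<beta> by blast
qed

lemma local_family_indep: "X.fam_indep (local_index T t) u"
proof (rule X.fam_indepI, rule ccontr)
  fix s i assume *: "(\<Sum>i\<in>local_index T t. phi x (s i) * u i) = 0" "i \<in> local_index T t" "s i \<noteq> 0"
  obtain n \<beta> where "\<exists>i\<in>local_index T t. \<beta> i \<noteq> 0"
    "\<forall>i\<in>local_index T t. \<forall>v\<in>P. vord v t > 0 \<longrightarrow>
      vge v ((n + 1) * vord v t) (phi x (s i) - emb (\<beta> i) * t powi n)"
    using leading_coefficients[OF t finite_local_index[OF T(1)] *(2), of s] *(3) by blast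
  then show False using local_family_leading[of n s \<beta>] *(1) by simp
qed

text \<open>The common leading exponent of the coordinates is not negative, because by
  \<open>local_family_leading\<close> the sum would otherwise have a pole on
  \<open>T\<close>.\<close>

lemma local_family_residues:
  assumes y: "\<And>v. v \<in> T \<Longrightarrow> vge v 0 (\<Sum>i\<in>local_index T t. phi x (s i) * u i)"
  shows "\<exists>a. \<forall>i\<in>local_index T t. \<forall>v\<in>P. vord v t > 0 \<longrightarrow> vge v (vord v t) (phi x (s i) - emb (a i))"
proof (cases "\<exists>i\<in>local_index T t. s i \<noteq> 0")
  case False
  then show ?thesis by (intro exI[of _ "\<lambda>_. 0"]) (auto simp: emb_zero)
next
  case True
  have t0: "t \<noteq> 0" using t by (simp add: leading_terms_def)
  obtain n \<beta> where \<beta>: "\<exists>i\<in>local_index T t. \<beta> i \<noteq> 0"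
    "\<forall>i\<in>local_index T t. \<forall>v\<in>P. vord v t > 0 \<longrightarrow>
      vge v ((n + 1) * vord v t) (phi x (s i) - emb (\<beta> i) * t powi n)"
    using leading_coefficients[OF t finite_local_index[OF T(1)], where s = s] True by blast
  obtain v where v: "v \<in> T" "\<not> vge v ((n + 1) * vord v t) (\<Sum>i\<in>local_index T t. phi x (s i) * u i)"
    using local_family_leading[OF \<beta>(2,1)] by blast
  have n0: "n \<ge> 0"
  proof (rule ccontr)
    assume "\<not> n \<ge> 0"
    then have "(n + 1) * vord v t \<le> 0" using T(3)[OF v(1)] by (simp add: mult_nonpos_nonneg)
    then show False using vge_mono[OF y[OF v(1)]] v(2) by blast
  qed
  \<comment> \<open>At exponent 0 the residues are the leading coefficients; at a positive exponent
    all coordinates vanish on the fibre.\<close>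
  define a where "a = (\<lambda>i. if n = 0 then \<beta> i else 0)"
  have "vge v (vord v t) (phi x (s i) - emb (a i))"
    if i: "i \<in> local_index T t" and v: "v \<in> P" "vord v t > 0" for i v
  proof -
    have 1: "vge v ((n + 1) * vord v t) (phi x (s i) - emb (\<beta> i) * t powi n)" using \<beta> i v by blast
    show ?thesis
    proof (cases "n = 0")
      case False
      then have n1: "n \<ge> 1" using n0 by simp
      have le: "1 * vord v t \<le> n * vord v t" using n1 v by (intro mult_right_mono) auto
      have "vge v (vord v t) (emb (\<beta> i) * t powi n)"
        by (intro vge_emb_mult v) (use le v t0 in \<open>simp add: vge_def vord_powi\<close>)
      moreover have "vge v (vord v t) (phi x (s i) - emb (\<beta> i) * t powi n)"
        by (rule vge_mono[OF 1]) (use le v in \<open>simp add: algebra_simps\<close>)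
      ultimately show ?thesis using vge_add[OF v(1)] False by (fastforce simp: a_def emb_zero)
    qed (use 1 in \<open>simp add: a_def\<close>)
  qed
  then show ?thesis by blast
qed

end

lemma zeros_sum_le:
  assumes T: "finite T" "T \<subseteq> P" "\<And>v. v \<in> T \<Longrightarrow> vord v x > 0"
  shows "(\<Sum>v\<in>T. vord v x) \<le> int xbound"
proof -
  obtain u where u: "local_family T x u" using local_family_exists[OF T(1,2)] by blast
  have "card (local_index T x) \<le> xbound"
    by (rule fam_card_le_xbound[OF finite_local_index[OF T(1)]
      local_family_indep[OF T leading_terms_x u]])
  then show ?thesis using card_local_index[OF T(1,3)] by simp
qed

end

section \<open>Zeros, poles and their degrees\<close>

context function_field
begin

definition zeros :: "'a \<Rightarrow> ('a \<Rightarrow> int extended) set" where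
  "zeros y = {v \<in> P. vord v y > 0}"

definition poles :: "'a \<Rightarrow> ('a \<Rightarrow> int extended) set" where
  "poles y = {v \<in> P. vord v y < 0}"

definition zero_degree :: "'a \<Rightarrow> int" where
  "zero_degree y = (\<Sum>v\<in>zeros y. vord v y)"

definition pole_degree :: "'a \<Rightarrow> int" where
  "pole_degree y = (\<Sum>v\<in>poles y. - vord v y)"

lemma finite_zeros: "finite (zeros y)"
proof (cases "y \<in> range emb")
  case True
  then have "zeros y = {}" by (auto simp: zeros_def)
  then show ?thesis by simp
next
  case False
  interpret function_field_element emb y by (rule function_field_elementI[OF False])
  show ?thesis
  proof (rule ccontr)
    assume "infinite (zeros y)"
    then obtain T where T: "T \<subseteq> zeros y" "finite T" "card T = Suc xbound"
      using infinite_arbitrarily_large by blast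
    have "int (card T) = (\<Sum>v\<in>T. 1)" by simp
    also have "\<dots> \<le> (\<Sum>v\<in>T. vord v y)" using T(1) by (intro sum_mono) (auto simp: zeros_def)
    also have "\<dots> \<le> int xbound" using T by (intro zeros_sum_le) (auto simp: zeros_def)
    finally show False using T by simp
  qed
qed

lemma poles_eq_zeros_inverse: "poles y = zeros (inverse y)"
  by (auto simp: poles_def zeros_def vord_inverse)

lemma finite_poles: "finite (poles y)"
  by (simp add: poles_eq_zeros_inverse finite_zeros)

lemma pole_degree_inverse: "pole_degree y = zero_degree (inverse y)"
  unfolding pole_degree_def zero_degree_def poles_eq_zeros_inverse
  by (intro sum.cong) (auto simp: zeros_def vord_inverse)

lemma height_eq: "height emb y = pole_degree y"
proof -
  have eq: "v y < 0 \<longleftrightarrow> vord v y < 0" if "v \<in> P" for v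
    using that by (cases "y = 0") (auto simp: pt_Fin zero_extended_def)
  have "{v. v \<in> P \<and> v y < 0} = poles y" by (auto simp: poles_def eq)
  moreover have "pole_order (v y) = - vord v y" if "v \<in> poles y" for v
    using that by (cases "y = 0") (auto simp: poles_def pole_order_def pt_Fin)
  ultimately show ?thesis unfolding height_def pole_degree_def by simp
qed

lemma pole_degree_nonneg: "pole_degree y \<ge> 0"
  unfolding pole_degree_def by (intro sum_nonneg) (auto simp: poles_def)

section \<open>Dimensions of Riemann-Roch spaces\<close>

abbreviation "RR \<equiv> riemann_roch_space emb"

lemma RR_iff: "g \<in> RR D \<longleftrightarrow> (\<forall>v\<in>P. vge v (- D v) g)"
  by (auto simp: riemann_roch_space_def vge_iff)

lemma RR_mono: "(\<And>v. v \<in> P \<Longrightarrow> D v \<le> D' v) \<Longrightarrow> RR D \<subseteq> RR D'"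
  by (force simp: RR_iff intro: vge_mono)

text \<open>As the residue field is k, an element with the additional pole order at \<open>v\<close>
  is determined modulo \<open>RR D\<close> up to a constant factor.\<close>

lemma RR_step:
  assumes v: "v \<in> P"
  shows "\<exists>u. RR (D(v := D v + 1)) \<subseteq> V.span (insert u (RR D))"
proof (cases "RR (D(v := D v + 1)) \<subseteq> RR D")
  case True
  then show ?thesis using V.span_superset by (intro exI[of _ 0]) blast
next
  case False
  then obtain u where u: "u \<in> RR (D(v := D v + 1))" "u \<notin> RR D" by blast
  then obtain w where w: "w \<in> P" "\<not> vge w (- D w) u" by (auto simp: RR_iff)
  have "w = v" using w u(1) by (auto simp: RR_iff split: if_splits)
  then have u0: "u \<noteq> 0" "vord v u = - D v - 1"
    using w u(1) v by (auto simp: RR_iff vge_def)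
  have "y \<in> V.span (insert u (RR D))" if y: "y \<in> RR (D(v := D v + 1))" for y
  proof -
    have "vge v (0 + vord v u) (y / u * u)" using y v u0 by (force simp: RR_iff)
    then have "vge v 0 (y / u)" using vge_cancel[OF v u0(1)] by blast
    then obtain c where c: "vge v 1 (y / u - emb c)" using residue[OF v] by blast
    then have "vge v (1 + vord v u) ((y / u - emb c) * u)" using vge_cancel[OF v u0(1)] by blast
    then have vv: "vge v (- D v) (y - emb c * u)" using u0 by (simp add: algebra_simps)
    have "y - emb c * u \<in> RR D" unfolding RR_iff
    proof
      fix w assume w: "w \<in> P"
      show "vge w (- D w) (y - emb c * u)"
      proof (cases "w = v")
        case False
        then show ?thesis using y u(1) w by (auto simp: RR_iff intro!: vge_diff vge_emb_mult)
      qed (use vv in simp)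
    qed
    then show ?thesis unfolding V.span_breakdown_eq using V.span_base by blast
  qed
  then show ?thesis by blast
qed

lemma RR_step_n:
  assumes v: "v \<in> P" and fd: "V.fin_dim (RR D)"
  shows "V.fin_dim (RR (D(v := D v + int n))) \<and> V.dim (RR (D(v := D v + int n))) \<le> V.dim (RR D) + n"
proof (induction n)
  case (Suc n)
  define E where "E = D(v := D v + int n)"
  define E' where "E' = D(v := D v + int (Suc n))"
  have EE: "E(v := E v + 1) = E'" by (auto simp: E_def E'_def)
  obtain u where u: "RR E' \<subseteq> V.span (insert u (RR E))" using RR_step[OF v, of E] unfolding EE by blast
  have IH: "V.fin_dim (RR E)" "V.dim (RR E) \<le> V.dim (RR D) + n" using Suc.IH unfolding E_def by blast+
  show ?case using V.dim_insert_le[OF u IH(1)] IH(2) unfolding E'_def[symmetric] by simp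
qed (use fd in simp)

lemma RR_dim_increase_finite:
  assumes "finite T" "T \<subseteq> P" "\<And>v. D v \<le> D' v" "\<And>v. v \<notin> T \<Longrightarrow> D v = D' v" "V.fin_dim (RR D)"
  shows "V.fin_dim (RR D') \<and> int (V.dim (RR D')) \<le> int (V.dim (RR D)) + (\<Sum>v\<in>T. D' v - D v)"
  using assms
proof (induction T arbitrary: D')
  case empty
  then have "D = D'" by auto
  then show ?case using empty by simp
next
  case (insert v T)
  define E where "E = D'(v := D v)"
  have E: "E v = D v" "\<And>w. w \<noteq> v \<Longrightarrow> E w = D' w" by (auto simp: E_def)
  have IH: "V.fin_dim (RR E)" "int (V.dim (RR E)) \<le> int (V.dim (RR D)) + (\<Sum>v\<in>T. E v - D v)"
  proof -
    have le: "D w \<le> E w" for w using E insert.prems(2)[of w] by (cases "w = v") auto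
    have off: "D w = E w" if "w \<notin> T" for w using E insert.prems(3)[of w] that by (cases "w = v") auto
    show "V.fin_dim (RR E)" "int (V.dim (RR E)) \<le> int (V.dim (RR D)) + (\<Sum>v\<in>T. E v - D v)"
      using insert.IH[of E] insert.prems le off by auto
  qed
  have sum: "(\<Sum>v\<in>T. E v - D v) = (\<Sum>v\<in>T. D' v - D v)"
  proof (intro sum.cong refl)
    fix w assume "w \<in> T"
    then have "w \<noteq> v" using insert.hyps by blast
    then show "E w - D w = D' w - D w" using E by simp
  qed
  have upd: "E(v := E v + int (nat (D' v - D v))) = D'"
  proof
    fix w show "(E(v := E v + int (nat (D' v - D v)))) w = D' w"
      using insert.prems(2)[of v] E by (cases "w = v") auto
  qed
  have v: "v \<in> P" using insert by auto
  have "(\<Sum>v\<in>insert v T. D' v - D v) = D' v - D v + (\<Sum>v\<in>T. D' v - D v)" using insert by simp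
  moreover have "V.fin_dim (RR D')" "V.dim (RR D') \<le> V.dim (RR E) + nat (D' v - D v)"
    using RR_step_n[OF v IH(1), of "nat (D' v - D v)"] unfolding upd by blast+
  ultimately show ?case using IH(2) sum insert.prems(2)[of v] by linarith
qed

lemma inverse_nonconst:
  assumes "y \<notin> range emb" shows "inverse y \<notin> range emb"
proof
  assume "inverse y \<in> range emb"
  then obtain c where "inverse y = emb c" by auto
  then have "y = emb (inverse c)" by (simp add: emb_inverse flip: \<open>inverse y = emb c\<close>)
  then show False using assms by auto
qed

text \<open>The inverse of a non-constant element has a zero, so the element itself has a
  pole.\<close>

lemma RR_zero: "RR (\<lambda>_. 0) = range emb"
proof
  show "RR (\<lambda>_. 0) \<subseteq> range emb"
  proof
    fix y assume y: "y \<in> RR (\<lambda>_. 0)"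
    show "y \<in> range emb"
    proof (rule ccontr)
      assume nc: "y \<notin> range emb"
      then have y0: "y \<noteq> 0" by (metis emb_zero rangeI)
      obtain v where "v \<in> P" "vord v (inverse y) > 0"
        using exists_zero[OF inverse_nonconst[OF nc]] by blast
      then show False using y y0 by (force simp: RR_iff vge_def vord_inverse)
    qed
  qed
qed (auto simp: RR_iff)

lemma RR_zero_dim: "V.fin_dim (RR (\<lambda>_. 0))" "V.dim (RR (\<lambda>_. 0)) = 1"
proof -
  have sub: "RR (\<lambda>_. 0) \<subseteq> V.span {1}"
  proof
    fix y assume "y \<in> RR (\<lambda>_. 0)"
    then obtain c where "y = emb c * 1" by (auto simp: RR_zero)
    then show "y \<in> V.span {1}" using V.span_scale[OF V.span_base, of 1 "{1}" c] by simp
  qed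
  then show "V.fin_dim (RR (\<lambda>_. 0))" by (auto simp: V.fin_dim_def)
  show "V.dim (RR (\<lambda>_. 0)) = 1"
  proof (rule V.dim_unique[OF _ sub])
    show "{1} \<subseteq> RR (\<lambda>_. 0)" by (auto simp: RR_iff)
  show "\<not> V.dependent {1}" by (rule V.independent_if_scalars_zero) auto
  qed simp
qed

lemma div_degree_eq:
  assumes "finite T" "\<And>v. v \<notin> T \<Longrightarrow> D v = 0"
  shows "div_degree D = (\<Sum>v\<in>T. D v)"
  unfolding div_degree_def by (rule sum.mono_neutral_left) (use assms in auto)

lemma divisorsI: "finite T \<Longrightarrow> T \<subseteq> P \<Longrightarrow> (\<And>v. v \<notin> T \<Longrightarrow> D v = 0) \<Longrightarrow> D \<in> divisors emb"
  by (auto simp: divisors_def intro: finite_subset[of _ T])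

lemma divisorsE:
  assumes "D \<in> divisors emb"
  obtains T where "finite T" "T \<subseteq> P" "\<And>v. v \<notin> T \<Longrightarrow> D v = 0"
proof (rule that[of "{v. D v \<noteq> 0}"])
  show "finite {v. D v \<noteq> 0}" "{v. D v \<noteq> 0} \<subseteq> P" using assms by (simp_all add: divisors_def)
qed simp

lemma divisors_common:
  assumes "D \<in> divisors emb" "D' \<in> divisors emb"
  obtains T where "finite T" "T \<subseteq> P" "\<And>v. v \<notin> T \<Longrightarrow> D v = 0 \<and> D' v = 0"
proof -
  obtain T where "finite T" "T \<subseteq> P" "\<And>v. v \<notin> T \<Longrightarrow> D v = 0" using divisorsE[OF assms(1)] by blast
  moreover obtain T' where "finite T'" "T' \<subseteq> P" "\<And>v. v \<notin> T' \<Longrightarrow> D' v = 0" using divisorsE[OF assms(2)] by blast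
  ultimately show ?thesis using that[of "T \<union> T'"] by auto
qed

lemma divisor_combination:
  assumes "D \<in> divisors emb" "D' \<in> divisors emb"
  shows "(\<lambda>v. a * D v + b * D' v) \<in> divisors emb"
    "div_degree (\<lambda>v. a * D v + b * D' v) = a * div_degree D + b * div_degree D'"
proof -
  obtain T where T: "finite T" "T \<subseteq> P" "\<And>v. v \<notin> T \<Longrightarrow> D v = 0 \<and> D' v = 0"
    using divisors_common[OF assms] by blast
  show "(\<lambda>v. a * D v + b * D' v) \<in> divisors emb" by (rule divisorsI[OF T(1,2)]) (use T in auto)
  show "div_degree (\<lambda>v. a * D v + b * D' v) = a * div_degree D + b * div_degree D'"
    using T by (simp add: div_degree_eq[OF T(1)] sum.distrib sum_distrib_left)
qed

lemma divisor_zero: "(\<lambda>_. 0) \<in> divisors emb" "div_degree (\<lambda>_ :: 'a \<Rightarrow> int extended. 0) = 0"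
  by (auto simp: divisors_def div_degree_def)

lemma divisor_scale:
  assumes "D \<in> divisors emb"
  shows "(\<lambda>v. a * D v) \<in> divisors emb" "div_degree (\<lambda>v. a * D v) = a * div_degree D"
  using divisor_combination[OF assms assms, of a 0] by auto

lemma divisor_sum:
  assumes "\<And>i. i \<in> I \<Longrightarrow> D i \<in> divisors emb"
  shows "(\<lambda>v. \<Sum>i\<in>I. D i v) \<in> divisors emb"
  using assms
proof (induction I rule: infinite_finite_induct)
  case (insert i I)
  have "(\<lambda>v. 1 * D i v + 1 * (\<Sum>i\<in>I. D i v)) \<in> divisors emb"
    by (rule divisor_combination) (use insert in auto)
  then show ?case using insert by simp
qed (auto simp: divisor_zero)

lemma RR_fin_dim:
  assumes "D \<in> divisors emb"
  shows "V.fin_dim (RR D)"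
proof -
  obtain T where T: "finite T" "T \<subseteq> P" "\<And>v. v \<notin> T \<Longrightarrow> D v = 0" using divisorsE[OF assms] by blast
  have "V.fin_dim (RR (\<lambda>v. max 0 (D v)))"
    using RR_dim_increase_finite[OF T(1,2), of "\<lambda>_. 0" "\<lambda>v. max 0 (D v)"] T RR_zero_dim by auto
  then show ?thesis by (rule V.fin_dim_subset) (rule RR_mono, auto)
qed

lemma RR_dim_increase:
  assumes D: "D \<in> divisors emb" "D' \<in> divisors emb" and le: "\<And>v. D v \<le> D' v"
  shows "int (V.dim (RR D')) \<le> int (V.dim (RR D)) + div_degree D' - div_degree D"
proof -
  obtain T where T: "finite T" "T \<subseteq> P" "\<And>v. v \<notin> T \<Longrightarrow> D v = 0 \<and> D' v = 0"
    using divisors_common[OF D] by blast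
  have "int (V.dim (RR D')) \<le> int (V.dim (RR D)) + (\<Sum>v\<in>T. D' v - D v)"
    using RR_dim_increase_finite[OF T(1,2) le _ RR_fin_dim[OF D(1)]] T(3) by auto
  then show ?thesis using T by (simp add: div_degree_eq[OF T(1)] sum_subtractf)
qed

lemma RR_dim_le:
  assumes D: "D \<in> divisors emb" "\<And>v. 0 \<le> D v"
  shows "int (V.dim (RR D)) \<le> div_degree D + 1"
  using RR_dim_increase[OF divisor_zero(1) D] RR_zero_dim divisor_zero(2) by simp

definition pole_divisor :: "'a \<Rightarrow> ('a \<Rightarrow> int extended) \<Rightarrow> int" where
  "pole_divisor y v = (if v \<in> P then max 0 (- vord v y) else 0)"

lemma pole_divisor: "pole_divisor y \<in> divisors emb" "div_degree (pole_divisor y) = pole_degree y"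
  "pole_divisor y v \<ge> 0"
proof -
  have 0: "pole_divisor y v = 0" if "v \<notin> poles y" for v using that by (auto simp: pole_divisor_def poles_def)
  have sub: "poles y \<subseteq> P" by (auto simp: poles_def)
  show "pole_divisor y \<in> divisors emb" by (rule divisorsI[OF finite_poles sub 0])
  have "div_degree (pole_divisor y) = (\<Sum>v\<in>poles y. pole_divisor y v)"
    by (rule div_degree_eq[OF finite_poles]) (rule 0)
  also have "\<dots> = pole_degree y" unfolding pole_degree_def
    by (intro sum.cong) (auto simp: pole_divisor_def poles_def)
  finally show "div_degree (pole_divisor y) = pole_degree y" .
  show "pole_divisor y v \<ge> 0" by (auto simp: pole_divisor_def)
qed

lemma vge_pole_divisor: "v \<in> P \<Longrightarrow> vge v (- pole_divisor y v) y"
  by (auto simp: pole_divisor_def vge_def)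

end

section \<open>The degree over k(x) and the number of poles\<close>

context function_field_element
begin

lemma RR_powers:
  assumes j: "j \<le> n" and y: "\<And>v. v \<in> P \<Longrightarrow> vge v (- C v) y"
  shows "x ^ j * y \<in> RR (\<lambda>v. int n * pole_divisor x v + 1 * C v)"
  unfolding RR_iff
proof
  fix v assume v: "v \<in> P"
  have "int j * pole_divisor x v \<le> int n * pole_divisor x v"
    using j pole_divisor(3) by (intro mult_right_mono) auto
  moreover have "- (int j * pole_divisor x v) \<le> vord v (x ^ j)"
  proof -
    have "int j * (- pole_divisor x v) \<le> int j * vord v x"
      using v by (intro mult_left_mono) (auto simp: pole_divisor_def)
    then show ?thesis using v x_nonzero by (simp add: vord_power)
  qed
  ultimately have "vge v (- (int n * pole_divisor x v) + - C v) (x ^ j * y)"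
    using v by (intro vge_mult y) (auto simp: vge_def)
  then show "vge v (- (int n * pole_divisor x v + 1 * C v)) (x ^ j * y)" by simp
qed

lemma RR_powers_dim:
  assumes I: "finite I" and u: "X.fam_indep I u" and C: "C \<in> divisors emb"
    and uC: "\<And>v i. v \<in> P \<Longrightarrow> i \<in> I \<Longrightarrow> vge v (- C v) (u i)"
  shows "(n + 1) * card I \<le> V.dim (RR (\<lambda>v. int n * pole_divisor x v + 1 * C v))"
proof -
  let ?D = "\<lambda>v. int n * pole_divisor x v + 1 * C v"
  have "(\<lambda>(j, i). x ^ j * u i) ` ({..n} \<times> I) \<subseteq> RR ?D"
  proof (rule image_subsetI)
    fix ji assume "ji \<in> {..n} \<times> I"
    then obtain j i where "ji = (j, i)" "j \<le> n" "i \<in> I" by auto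
    then show "(case ji of (j, i) \<Rightarrow> x ^ j * u i) \<in> RR ?D" using RR_powers[of j n C "u i"] uC by auto
  qed
  from V.fam_indep_dim[OF _ indep_powers_V[OF u I] this
      RR_fin_dim[OF divisor_combination(1)[OF pole_divisor(1) C]]]
  have "card ({..n} \<times> I) \<le> V.dim (RR ?D)" using I by auto
  moreover have "card ({..n} \<times> I) = (n + 1) * card I" by (simp add: card_cartesian_product)
  ultimately show ?thesis by linarith
qed

lemma pole_bound_family:
  assumes I: "finite I"
  obtains C where "C \<in> divisors emb" "\<And>v. C v \<ge> 0" "\<And>v i. v \<in> P \<Longrightarrow> i \<in> I \<Longrightarrow> vge v (- C v) (u i)"
proof (rule that[of "\<lambda>v. \<Sum>i\<in>I. pole_divisor (u i) v"])
  show "(\<lambda>v. \<Sum>i\<in>I. pole_divisor (u i) v) \<in> divisors emb" by (rule divisor_sum) (rule pole_divisor)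
  show "(\<Sum>i\<in>I. pole_divisor (u i) v) \<ge> 0" for v by (intro sum_nonneg pole_divisor)
  show "vge v (- (\<Sum>i\<in>I. pole_divisor (u i) v)) (u i)" if "v \<in> P" "i \<in> I" for v i
    by (rule vge_mono[OF vge_pole_divisor[OF that(1)]])
      (use that I pole_divisor(3) in \<open>auto intro: member_le_sum\<close>)
qed

text \<open>The products \<open>x ^ j * u i\<close> with \<open>j <= n\<close> are independent over
  k and have poles bounded by n times the pole divisor of \<open>x\<close> plus a fixed divisor.
  Comparing the growth of both counts in n bounds the size of the family.\<close>

lemma X_indep_card_le_pole_degree:
  assumes I: "finite I" and u: "X.fam_indep I u"
  shows "int (card I) \<le> pole_degree x"
proof (rule ccontr)
  assume "\<not> ?thesis"
  then have c: "pole_degree x + 1 \<le> int (card I)" by simp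
  obtain C where C: "C \<in> divisors emb" and C0: "\<And>v. C v \<ge> 0"
    and uC: "\<And>v i. v \<in> P \<Longrightarrow> i \<in> I \<Longrightarrow> vge v (- C v) (u i)"
    using pole_bound_family[OF I, of u] by blast
  have main: "(int n + 1) * int (card I) \<le> int n * pole_degree x + div_degree C + 1" for n
  proof -
    let ?D = "\<lambda>v. int n * pole_divisor x v + 1 * C v"
    have D: "?D \<in> divisors emb" "div_degree ?D = int n * pole_degree x + div_degree C"
      using divisor_combination[OF pole_divisor(1) C, of "int n" x 1] by (auto simp: pole_divisor)
    have "int ((n + 1) * card I) \<le> int (V.dim (RR ?D))"
      using RR_powers_dim[OF I u C uC, of n] by linarith
    also have "\<dots> \<le> div_degree ?D + 1" by (rule RR_dim_le[OF D(1)]) (use C0 pole_divisor(3) in auto)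
    finally show ?thesis using D(2) by (simp add: algebra_simps)
  qed
  \<comment> \<open>A family with \<open>pole_degree x + 1\<close> members would give
    \<open>n + pole_degree x <= div_degree C\<close>.\<close>
  define n where "n = nat (div_degree C) + 1"
  have "(int n + 1) * (pole_degree x + 1) \<le> (int n + 1) * int (card I)"
    using c by (intro mult_left_mono) auto
  also note main[of n]
  finally have "int n + pole_degree x + 1 \<le> div_degree C + 1" by (simp add: algebra_simps)
  then show False using pole_degree_nonneg[of x] by (simp add: n_def split: if_splits)
qed

lemma zero_degree_le_pole_degree: "zero_degree x \<le> pole_degree x"
proof -
  have T: "finite (zeros x)" "zeros x \<subseteq> P" "\<And>v. v \<in> zeros x \<Longrightarrow> vord v x > 0"
    using finite_zeros by (auto simp: zeros_def)
  obtain u where u: "local_family (zeros x) x u" using local_family_exists[OF T(1,2)] by blast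
  show ?thesis
    using X_indep_card_le_pole_degree[OF finite_local_index[OF T(1)] local_family_indep[OF T leading_terms_x u]]
    using card_local_index[OF T(1,3)] by (simp add: zero_degree_def)
qed

end

context function_field
begin


text \<open>A family adapted to the zeros is independent and has as many members as the zero degree,
  which gives one inequality. The other one is the same inequality for the inverse.\<close>

lemma zero_degree_eq_pole_degree: "zero_degree y = pole_degree y"
proof (cases "y \<in> range emb")
  case True
  then have "zeros y = {}" "poles y = {}" by (auto simp: zeros_def poles_def)
  then show ?thesis by (simp add: zero_degree_def pole_degree_def)
next
  case False
  have "zero_degree y \<le> pole_degree y"
    by (rule function_field_element.zero_degree_le_pole_degree[OF function_field_elementI[OF False]])
  moreover have "zero_degree (inverse y) \<le> pole_degree (inverse y)"
    by (rule function_field_element.zero_degree_le_pole_degree[OF function_field_elementI[OF inverse_nonconst[OF False]]])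
  ultimately show ?thesis using pole_degree_inverse[of y] pole_degree_inverse[of "inverse y"] by simp
qed

lemma pole_degree_pos:
  assumes "y \<notin> range emb" shows "pole_degree y \<ge> 1"
proof -
  obtain v where v: "v \<in> P" "vord v y > 0" using exists_zero[OF assms] by blast
  have "vord v y \<le> zero_degree y" unfolding zero_degree_def
    by (rule member_le_sum) (use v finite_zeros in \<open>auto simp: zeros_def\<close>)
  then show ?thesis using v zero_degree_eq_pole_degree[of y] by simp
qed

end

section \<open>Riemann's theorem and the trace\<close>

context function_field_element
begin

text \<open>The bound by the pole degree is attained, so it is the degree of K over k(x). The
  witness is a family adapted to the zeros of \<open>x\<close>, which explains the index
  type.\<close>

lemma maximal_family:
  obtains I and u :: "('a \<Rightarrow> int extended) \<times> nat \<Rightarrow> 'a"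
  where "finite I" "X.fam_indep I u" "int (card I) = pole_degree x"
proof -
  have T: "finite (zeros x)" "zeros x \<subseteq> P" "\<And>v. v \<in> zeros x \<Longrightarrow> vord v x > 0"
    using finite_zeros by (auto simp: zeros_def)
  obtain u where u: "local_family (zeros x) x u" using local_family_exists[OF T(1,2)] by blast
  have "int (card (local_index (zeros x) x)) = pole_degree x"
    using card_local_index[OF T(1,3)] zero_degree_eq_pole_degree[of x] by (simp add: zero_degree_def)
  then show ?thesis
    using that[OF finite_local_index[OF T(1)] local_family_indep[OF T leading_terms_x u]] by blast
qed

text \<open>A maximal family and powers of \<open>x\<close> fill a space that is larger by a fixed
  divisor \<open>C\<close>; removing \<open>C\<close> costs at most its degree.\<close>

lemma RR_multiples_dim:
  "\<exists>\<gamma>. \<forall>n::nat. int n * pole_degree x - \<gamma> \<le> int (V.dim (RR (\<lambda>v. int n * pole_divisor x v)))"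
proof -
  obtain I and u :: "('a \<Rightarrow> int extended) \<times> nat \<Rightarrow> 'a"
    where I: "finite I" and u: "X.fam_indep I u" and card: "int (card I) = pole_degree x"
    using maximal_family .
  obtain C where C: "C \<in> divisors emb" and C0: "\<And>v. C v \<ge> 0"
    and uC: "\<And>v i. v \<in> P \<Longrightarrow> i \<in> I \<Longrightarrow> vge v (- C v) (u i)"
    using pole_bound_family[OF I, of u] by blast
  have "int n * pole_degree x - div_degree C \<le> int (V.dim (RR (\<lambda>v. int n * pole_divisor x v)))" for n
  proof -
    let ?D = "\<lambda>v. int n * pole_divisor x v" and ?D' = "\<lambda>v. int n * pole_divisor x v + 1 * C v"
    have D: "?D \<in> divisors emb" "div_degree ?D = int n * pole_degree x"
      using divisor_scale[OF pole_divisor(1), of "int n" x] by (auto simp: pole_divisor)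
    have D': "?D' \<in> divisors emb" "div_degree ?D' = int n * pole_degree x + div_degree C"
      using divisor_combination[OF pole_divisor(1) C, of "int n" x 1] by (auto simp: pole_divisor)
    have "int ((n + 1) * card I) \<le> int (V.dim (RR ?D'))"
      using RR_powers_dim[OF I u C uC, of n] by (simp only: of_nat_le_iff)
    then have "(int n + 1) * pole_degree x \<le> int (V.dim (RR ?D'))"
      by (simp only: of_nat_mult of_nat_add of_nat_1 card)
    also have "\<dots> \<le> int (V.dim (RR ?D)) + div_degree ?D' - div_degree ?D"
      by (rule RR_dim_increase[OF D(1) D'(1)]) (use C0 in auto)
    also have "\<dots> = int (V.dim (RR ?D)) + div_degree C" using D D' by simp
    finally have "int n * pole_degree x + pole_degree x \<le> int (V.dim (RR ?D)) + div_degree C"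
      by (simp add: algebra_simps)
    then show ?thesis using pole_degree_nonneg[of x] by linarith
  qed
  then show ?thesis by blast
qed

lemma vord_x_minus_const:
  assumes "v \<in> P" "vord v x < 0" shows "vord v (x - emb c) = vord v x"
  using vord_add_eq[of v x "- emb c"] assms x_nonzero by (auto simp: vge_def)

lemma poles_x_minus_const: "poles (x - emb c) = poles x"
proof -
  have "vord v (x - emb c) < 0 \<longleftrightarrow> vord v x < 0" if v: "v \<in> P" for v
  proof
    assume *: "vord v (x - emb c) < 0"
    show "vord v x < 0"
    proof (rule ccontr)
      assume "\<not> vord v x < 0"
      then have "vge v 0 (x - emb c)" using v by (intro vge_diff) (auto simp: vge_def)
      then show False using * x_minus_const_nonzero[of c] by (auto simp: vge_def)
    qed
  qed (use vord_x_minus_const[OF v] in auto)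
  then show ?thesis by (auto simp: poles_def)
qed

lemma pole_degree_x_minus_const: "pole_degree (x - emb c) = pole_degree x"
  unfolding pole_degree_def poles_x_minus_const
  by (intro sum.cong refl) (auto simp: poles_def vord_x_minus_const)

lemma residue_x:
  assumes "v \<in> P" "vord v x \<ge> 0"
  obtains c where "vord v (x - emb c) > 0"
proof -
  obtain c where "vge v 1 (x - emb c)" using residue[OF assms(1), of x] assms by (auto simp: vge_def)
  then have "vord v (x - emb c) > 0" using x_minus_const_nonzero[of c] by (auto simp: vge_def)
  then show ?thesis by (rule that)
qed

text \<open>Every point where \<open>x\<close> is regular is a zero of some \<open>x - c\<close>. A
  product of powers of these has the required zeros, and its poles lie only over the poles of
  \<open>x\<close>, with orders proportional to those of \<open>x\<close>.\<close>

lemma polynomial_with_zeros: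
  assumes T: "finite T" "T \<subseteq> P" "\<And>v. v \<in> T \<Longrightarrow> vord v x \<ge> 0"
  shows "\<exists>z N. z \<noteq> 0 \<and> (\<forall>v\<in>P. vord v x \<ge> 0 \<longrightarrow> vord v z \<ge> 0) \<and> (\<forall>v\<in>T. vord v z \<ge> int (D v)) \<and>
    (\<forall>v\<in>P. vord v x < 0 \<longrightarrow> vord v z = int N * vord v x)"
  using T
proof (induction T)
  case empty
  show ?case by (intro exI[of _ 1] exI[of _ 0]) auto
next
  case (insert v T)
  obtain z N where z: "z \<noteq> 0" "\<And>v. v \<in> P \<Longrightarrow> vord v x \<ge> 0 \<Longrightarrow> vord v z \<ge> 0" "\<And>v. v \<in> T \<Longrightarrow> vord v z \<ge> int (D v)"
    "\<And>v. v \<in> P \<Longrightarrow> vord v x < 0 \<Longrightarrow> vord v z = int N * vord v x" using insert by auto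
  obtain c where c: "vord v (x - emb c) > 0" using residue_x[of v] insert by auto
  let ?y = "(x - emb c) ^ D v"
  have y0: "?y \<noteq> 0" using x_minus_const_nonzero by simp
  have vy: "vord w ?y = int (D v) * vord w (x - emb c)" if "w \<in> P" for w
    using that x_minus_const_nonzero by (simp add: vord_power)
  have pos: "vord w ?y \<ge> 0" if "w \<in> P" "vord w x \<ge> 0" for w
  proof -
    have "vge w 0 (x - emb c)" using that by (intro vge_diff) (auto simp: vge_def)
    then show ?thesis using vy[OF that(1)] x_minus_const_nonzero[of c] by (auto simp: vge_def)
  qed
  show ?case
  proof (intro exI conjI ballI impI)
    show "z * ?y \<noteq> 0" using z y0 by simp
    show "vord w (z * ?y) \<ge> 0" if "w \<in> P" "vord w x \<ge> 0" for w
      using z(2)[OF that] pos[OF that] z(1) y0 that by (simp add: vord_mult)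
    show "vord w (z * ?y) \<ge> int (D w)" if w: "w \<in> insert v T" for w
    proof -
      have wP: "w \<in> P" "vord w x \<ge> 0" using w insert by auto
      show ?thesis
      proof (cases "w = v")
        case True
        have "int (D v) * 1 \<le> int (D v) * vord v (x - emb c)" using c by (intro mult_left_mono) auto
        then show ?thesis using True z(2)[OF wP] vy[OF wP(1)] z(1) y0 wP by (simp add: vord_mult)
      next
        case False
        then have "vord w z \<ge> int (D w)" using w z(3) by auto
        then show ?thesis using pos[OF wP] z(1) y0 wP by (simp add: vord_mult)
      qed
    qed
    show "vord w (z * ?y) = int (N + D v) * vord w x" if "w \<in> P" "vord w x < 0" for w
      using z(4)[OF that] vy[OF that(1)] vord_x_minus_const[OF that] z(1) y0 that
      by (simp add: vord_mult algebra_simps)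
  qed
qed

end

section \<open>Riemann's theorem\<close>

context function_field
begin

lemma exists_nonconst: "\<exists>x. x \<notin> range emb"
proof -
  obtain x where x: "\<forall>p. p \<noteq> 0 \<longrightarrow> poly (map_poly emb p) x \<noteq> 0"
    using finite_over_ratfun_field by blast
  have "x \<notin> range emb"
  proof
    assume "x \<in> range emb"
    then obtain c where "x = emb c" by auto
    then have "ev x [:-c, 1:] = 0" by (simp add: emb_minus emb_one emb_zero)
    then show False using x by (auto simp: ev_def)
  qed
  then show ?thesis by blast
qed

definition principal_divisor :: "'a \<Rightarrow> ('a \<Rightarrow> int extended) \<Rightarrow> int" where
  "principal_divisor z v = (if v \<in> P then vord v z else 0)"

lemma principal_divisor: "principal_divisor z \<in> divisors emb" "div_degree (principal_divisor z) = 0"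
proof -
  have 0: "principal_divisor z v = 0" if "v \<notin> zeros z \<union> poles z" for v
    using that by (auto simp: principal_divisor_def zeros_def poles_def)
  have sub: "zeros z \<union> poles z \<subseteq> P" by (auto simp: poles_def zeros_def)
  have fin: "finite (zeros z \<union> poles z)" using finite_zeros finite_poles by blast
  show "principal_divisor z \<in> divisors emb" by (rule divisorsI[OF fin sub 0])
  have "div_degree (principal_divisor z) = (\<Sum>v\<in>zeros z \<union> poles z. principal_divisor z v)"
    by (rule div_degree_eq[OF fin]) (rule 0)
  also have "\<dots> = (\<Sum>v\<in>zeros z. principal_divisor z v) + (\<Sum>v\<in>poles z. principal_divisor z v)"
    by (rule sum.union_disjoint[OF finite_zeros finite_poles]) (auto simp: zeros_def poles_def)
  also have "(\<Sum>v\<in>zeros z. principal_divisor z v) = zero_degree z" unfolding zero_degree_def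
    by (intro sum.cong) (auto simp: principal_divisor_def zeros_def)
  also have "(\<Sum>v\<in>poles z. principal_divisor z v) = (\<Sum>v\<in>poles z. vord v z)"
    by (intro sum.cong) (auto simp: principal_divisor_def poles_def)
  also have "\<dots> = - pole_degree z" by (simp add: pole_degree_def sum_negf)
  finally show "div_degree (principal_divisor z) = 0" by (simp add: zero_degree_eq_pole_degree)
qed

lemma RR_dim_shift:
  assumes z: "z \<noteq> 0" and D: "D \<in> divisors emb"
  shows "V.dim (RR (\<lambda>v. 1 * D v + (- 1) * principal_divisor z v)) \<le> V.dim (RR D)"
proof -
  let ?D = "\<lambda>v. 1 * D v + (- 1) * principal_divisor z v"
  have D': "?D \<in> divisors emb" by (rule divisor_combination[OF D principal_divisor(1)])
  obtain B where B: "B \<subseteq> RR ?D" "V.independent B" "finite B" "RR ?D \<subseteq> V.span B" "card B = V.dim (RR ?D)"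
    by (rule V.fin_dim_basis[OF RR_fin_dim[OF D']])
  have "(\<lambda>b. inverse z * b) ` B \<subseteq> RR D"
  proof (rule image_subsetI)
    fix b assume "b \<in> B"
    then have b: "b \<in> RR ?D" using B by auto
    show "inverse z * b \<in> RR D" unfolding RR_iff
    proof
      fix v assume v: "v \<in> P"
      have "vge v (- D v + vord v z) b" using b v by (auto simp: RR_iff principal_divisor_def)
      then have "vge v (- vord v z + (- D v + vord v z)) (inverse z * b)"
        by (intro vge_mult v) (auto simp: vge_def vord_inverse v)
      then show "vge v (- D v) (inverse z * b)" by simp
    qed
  qed
  from V.fam_indep_dim[OF B(3) V_fam_indep_scale[OF V.independent_fam_indep[OF B(2,3)]] this RR_fin_dim[OF D]]
  show ?thesis using B z by simp
qed

text \<open>The defect deg - l does not decrease when a divisor grows, nor when a principal divisor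
  is subtracted. After these two operations every divisor lies below a multiple of the pole divisor
  of \<open>x\<close>, for which the defect is bounded.\<close>

theorem riemann_bounded:
  "\<exists>\<gamma>. \<forall>D\<in>divisors emb. div_degree D + 1 - int (div_dim emb D) \<le> \<gamma>"
proof -
  obtain x where "x \<notin> range emb" using exists_nonconst by blast
  then interpret function_field_element emb x by (rule function_field_elementI)
  obtain \<gamma> where \<gamma>: "\<And>n::nat. int n * pole_degree x - \<gamma> \<le> int (V.dim (RR (\<lambda>v. int n * pole_divisor x v)))"
    using RR_multiples_dim by blast
  have "div_degree D + 1 - int (div_dim emb D) \<le> \<gamma> + 1" if D: "D \<in> divisors emb" for D
  proof -
    obtain T where T: "finite T" "T \<subseteq> P" "\<And>v. v \<notin> T \<Longrightarrow> D v = 0" using divisorsE[OF D] by blast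
    define E where "E = (\<lambda>v. max 0 (D v))"
    have E: "E \<in> divisors emb" by (rule divisorsI[OF T(1,2)]) (use T in \<open>auto simp: E_def\<close>)
    have DE: "int (V.dim (RR E)) \<le> int (V.dim (RR D)) + div_degree E - div_degree D"
      by (rule RR_dim_increase[OF D E]) (auto simp: E_def)
    define T' where "T' = {v \<in> T. vord v x \<ge> 0}"
    obtain z N where z: "z \<noteq> 0" "\<And>v. v \<in> P \<Longrightarrow> vord v x \<ge> 0 \<Longrightarrow> vord v z \<ge> 0"
      "\<And>v. v \<in> T' \<Longrightarrow> vord v z \<ge> int (nat (E v))"
      "\<And>v. v \<in> P \<Longrightarrow> vord v x < 0 \<Longrightarrow> vord v z = int N * vord v x"
    proof -
      have T': "finite T'" "T' \<subseteq> P" "\<And>v. v \<in> T' \<Longrightarrow> vord v x \<ge> 0" using T by (auto simp: T'_def)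
      show ?thesis using polynomial_with_zeros[OF T', of "\<lambda>v. nat (E v)"] that by blast
    qed
    \<comment> \<open>The zeros of \<open>z\<close> take care of \<open>E\<close> where
      \<open>x\<close> is regular. At the poles of \<open>x\<close> the multiple \<open>M\<close> of
      the pole divisor covers \<open>E\<close>, and the multiple \<open>N\<close> covers the poles
      of \<open>z\<close>.\<close>
    define M where "M = nat (\<Sum>v\<in>T. E v)"
    have M: "E v \<le> int M" for v
    proof (cases "v \<in> T")
      case True
      then have "E v \<le> (\<Sum>v\<in>T. E v)" by (intro member_le_sum) (auto simp: T E_def)
      then show ?thesis by (simp add: M_def)
    qed (use T in \<open>auto simp: E_def\<close>)
    let ?F = "\<lambda>v. 1 * E v + (- 1) * principal_divisor z v"
    let ?G = "\<lambda>v. int (N + M) * pole_divisor x v"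
    have F: "?F \<in> divisors emb" "div_degree ?F = div_degree E"
      using divisor_combination[OF E principal_divisor(1), of 1 "-1" z] by (auto simp: principal_divisor)
    have G: "?G \<in> divisors emb" "div_degree ?G = int (N + M) * pole_degree x"
      using divisor_scale[OF pole_divisor(1), of "int (N + M)" x] by (auto simp: pole_divisor)
    have le: "?F v \<le> ?G v" for v
    proof (cases "v \<in> P")
      case True
      show ?thesis
      proof (cases "vord v x \<ge> 0")
        case fin: True
        have "E v \<le> vord v z"
        proof (cases "v \<in> T'")
          case False
          then have "v \<notin> T" using fin by (auto simp: T'_def)
          then have "E v = 0" using T by (simp add: E_def)
          then show ?thesis using z(2)[OF True fin] by simp
        qed (use z(3)[of v] in \<open>auto split: if_splits\<close>)
        moreover have "0 \<le> int (N + M) * pole_divisor x v" by (intro mult_nonneg_nonneg pole_divisor) simp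
        ultimately show ?thesis using True by (simp add: principal_divisor_def)
      next
        case False
        have "int M * 1 \<le> int M * (- vord v x)" using False by (intro mult_left_mono) auto
        then show ?thesis using M[of v] True False z(4)[of v]
          by (simp add: principal_divisor_def pole_divisor_def algebra_simps)
      qed
    next
      case False
      then have "v \<notin> T" using T(2) by blast
      then have "E v = 0" using T(3) by (simp add: E_def)
      then show ?thesis using False by (simp add: principal_divisor_def pole_divisor_def)
    qed
    have "int (V.dim (RR ?G)) \<le> int (V.dim (RR ?F)) + div_degree ?G - div_degree ?F"
      by (rule RR_dim_increase[OF F(1) G(1) le])
    moreover have "V.dim (RR ?F) \<le> V.dim (RR E)" by (rule RR_dim_shift[OF z(1) E])
    ultimately have "div_degree D + 1 - int (V.dim (RR D)) \<le> \<gamma> + 1"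
      using DE \<gamma>[of "N + M"] F G by linarith
    then show ?thesis by (simp add: div_dim_def)
  qed
  then show ?thesis by blast
qed

text \<open>The genus is a supremum of integers; boundedness is what makes it dominate each
  member.\<close>

lemma riemann:
  assumes "D \<in> divisors emb"
  shows "div_degree D + 1 - int (V.dim (RR D)) \<le> genus emb"
proof -
  have "bdd_above ((\<lambda>D. div_degree D + 1 - int (div_dim emb D)) ` divisors emb)"
    using riemann_bounded by (auto simp: bdd_above_def)
  from cSUP_upper[OF assms this] show ?thesis by (simp add: genus_def div_dim_def)
qed

lemma genus_nonneg: "genus emb \<ge> 0"
  using riemann[OF divisor_zero(1)] RR_zero_dim divisor_zero(2) by simp

end

section \<open>The trace over k(x) and its reduction on a fibre\<close>

context function_field_element
begin

lemma maximal_indep_spans: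
  assumes B: "finite B" "X.independent B" "int (card B) = pole_degree x"
  shows "X.span B = UNIV"
proof (rule ccontr)
  assume "X.span B \<noteq> UNIV"
  then obtain y where y: "y \<notin> X.span B" by blast
  then have "X.independent (insert y B)" using B by (simp add: X.independent_insert)
  moreover have "y \<notin> B" using y X.span_base by blast
  ultimately show False
    using X_indep_card_le_pole_degree[OF _ X.independent_fam_indep, of "insert y B"] B by simp
qed

definition X_basis :: "'a set \<Rightarrow> bool" where
  "X_basis B \<longleftrightarrow> finite B \<and> X.independent B \<and> X.span B = UNIV"

lemma X_basis_exists: "\<exists>B. X_basis B"
proof -
  obtain I and u :: "('a \<Rightarrow> int extended) \<times> nat \<Rightarrow> 'a"
    where I: "finite I" and u: "X.fam_indep I u" and card: "int (card I) = pole_degree x"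
    using maximal_family .
  have "X_basis (u ` I)" unfolding X_basis_def
    using I X.fam_indep_independent[OF I u] maximal_indep_spans[of "u ` I"]
      card card_image[OF X.fam_indep_inj[OF I u]] by simp
  then show ?thesis by blast
qed

lemma X_representation:
  assumes "X_basis B" shows "y = (\<Sum>b\<in>B. phi x (X.representation B y b) * b)"
  using X.sum_representation_eq[of B y B] assms by (simp add: X_basis_def)

text \<open>The diagonal sum of the matrix of multiplication by \<open>w\<close>. Its values lie in
  the abstract rational function field; \<open>phi x\<close> carries them into K.\<close>

definition basis_trace :: "'a set \<Rightarrow> 'a \<Rightarrow> 'k poly fract" where
  "basis_trace B w = (\<Sum>b\<in>B. X.representation B (w * b) b)"

lemma basis_trace_eq:
  assumes B: "X_basis B" and C: "X_basis C"
  shows "basis_trace B w = basis_trace C w"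
proof -
  let ?R = X.representation
  \<comment> \<open>Expanding through the other basis turns both traces into the same double sum of
    products of change-of-basis coefficients and matrix entries.\<close>
  have rep: "?R B y b = (\<Sum>c\<in>C. ?R C y c * ?R B c b)" for y b
  proof -
    have "?R B (\<Sum>c\<in>C. phi x (?R C y c) * c) b = (\<Sum>c\<in>C. ?R C y c * ?R B c b)"
      using B by (simp add: X.representation_sum X.representation_scale X_basis_def)
    then show ?thesis using X_representation[OF C, of y] by simp
  qed
  have spanC: "X.independent C" "\<And>y. y \<in> X.span C" using C by (simp_all add: X_basis_def)
  have rep2: "?R C (w * c) c = (\<Sum>b\<in>B. ?R B c b * ?R C (w * b) c)" for c
  proof -
    have "w * c = (\<Sum>b\<in>B. phi x (?R B c b) * (w * b))"
      by (subst X_representation[OF B, of c]) (simp add: sum_distrib_left mult_ac)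
    then have "?R C (w * c) c = ?R C (\<Sum>b\<in>B. phi x (?R B c b) * (w * b)) c" by (rule arg_cong)
    also have "\<dots> = (\<Sum>b\<in>B. ?R C (phi x (?R B c b) * (w * b)) c)"
      by (subst X.representation_sum[OF spanC(1)]) (rule spanC refl)+
    also have "\<dots> = (\<Sum>b\<in>B. ?R B c b * ?R C (w * b) c)"
      by (intro sum.cong refl) (subst X.representation_scale[OF spanC], rule refl)
    finally show ?thesis .
  qed
  have "basis_trace B w = (\<Sum>b\<in>B. \<Sum>c\<in>C. ?R C (w * b) c * ?R B c b)"
    unfolding basis_trace_def by (intro sum.cong refl rep)
  also have "\<dots> = (\<Sum>c\<in>C. \<Sum>b\<in>B. ?R B c b * ?R C (w * b) c)"
    by (subst sum.swap) (simp add: mult.commute)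
  also have "\<dots> = basis_trace C w" unfolding basis_trace_def by (intro sum.cong refl rep2[symmetric])
  finally show ?thesis .
qed

definition trace :: "'a \<Rightarrow> 'k poly fract" where
  "trace = basis_trace (SOME B. X_basis B)"

lemma trace_eq: "X_basis B \<Longrightarrow> trace w = basis_trace B w"
  unfolding trace_def by (rule basis_trace_eq) (rule someI_ex[OF X_basis_exists])

lemma trace_add: "trace (w + w') = trace w + trace w'"
proof -
  obtain B where B: "X_basis B" using X_basis_exists by blast
  then show ?thesis unfolding trace_eq[OF B] basis_trace_def
    by (simp add: distrib_right X.representation_add X_basis_def sum.distrib)
qed

lemma trace_scale: "trace (phi x s * w) = s * trace w"
proof -
  obtain B where B: "X_basis B" using X_basis_exists by blast
  have "X.representation B (phi x s * w * b) b = s * X.representation B (w * b) b" for b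
    using B X.representation_scale[of B "w * b" s] by (simp add: X_basis_def mult.assoc)
  then show ?thesis unfolding trace_eq[OF B] basis_trace_def by (simp add: sum_distrib_left)
qed

lemma trace_zero: "trace 0 = 0"
  using trace_scale[of 0 0] by simp

lemma trace_zero_span:
  assumes "X.span G = UNIV" "\<And>y. y \<in> G \<Longrightarrow> trace (y * w) = 0"
  shows "trace (y * w) = 0"
proof -
  have "y \<in> X.span G" using assms by simp
  then show ?thesis
  proof (induction rule: X.span_induct_alt)
    case (step s b y)
    then show ?case using assms(2)[of b]
      by (simp add: distrib_right trace_add mult.assoc trace_scale)
  qed (simp add: trace_zero)
qed

context
  fixes t u
  assumes t: "leading_terms t" and deg: "zero_degree t = pole_degree x"
    and u: "local_family (zeros t) t u"
begin

lemma zeros_facts: "finite (zeros t)" "zeros t \<subseteq> P" "\<And>v. v \<in> zeros t \<Longrightarrow> vord v t > 0"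
  using finite_zeros by (auto simp: zeros_def)

lemma local_inj: "inj_on u (local_index (zeros t) t)"
  by (rule X.fam_indep_inj[OF finite_local_index[OF zeros_facts(1)] local_family_indep[OF zeros_facts t u]])

lemma local_basis: "X_basis (u ` local_index (zeros t) t)"
proof -
  let ?I = "local_index (zeros t) t"
  have I: "finite ?I" by (rule finite_local_index[OF zeros_facts(1)])
  have fam: "X.fam_indep ?I u" by (rule local_family_indep[OF zeros_facts t u])
  have "int (card (u ` ?I)) = pole_degree x"
    using card_local_index[OF zeros_facts(1,3)] deg card_image[OF local_inj] by (simp add: zero_degree_def)
  then show ?thesis unfolding X_basis_def
    using I X.fam_indep_independent[OF I fam] maximal_indep_spans[of "u ` ?I"] by simp
qed

definition local_coord :: "'a \<Rightarrow> ('a \<Rightarrow> int extended) \<times> nat \<Rightarrow> 'k poly fract" where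
  "local_coord y i = X.representation (u ` local_index (zeros t) t) y (u i)"

lemma local_coord: "y = (\<Sum>i\<in>local_index (zeros t) t. phi x (local_coord y i) * u i)"
  using X_representation[OF local_basis, of y] by (simp add: local_coord_def sum.reindex[OF local_inj])

lemma trace_local: "trace w = (\<Sum>i\<in>local_index (zeros t) t. local_coord (w * u i) i)"
  unfolding trace_eq[OF local_basis] basis_trace_def
  by (simp add: local_coord_def sum.reindex[OF local_inj])

text \<open>The coordinates of an element regular on the fibre reduce to constants there, so the
  element agrees modulo \<open>t\<close> with a constant combination of the family.\<close>

lemma local_coord_residues:
  assumes y: "\<And>v. v \<in> zeros t \<Longrightarrow> vge v 0 y"
  shows "\<exists>a. (\<forall>i\<in>local_index (zeros t) t. \<forall>v\<in>zeros t. vge v (vord v t) (phi x (local_coord y i) - emb (a i))) \<and>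
    (\<forall>v\<in>zeros t. vge v (vord v t) (y - (\<Sum>i\<in>local_index (zeros t) t. emb (a i) * u i)))"
proof -
  let ?I = "local_index (zeros t) t"
  obtain a where a: "\<forall>i\<in>?I. \<forall>v\<in>P. vord v t > 0 \<longrightarrow> vge v (vord v t) (phi x (local_coord y i) - emb (a i))"
    using local_family_residues[OF zeros_facts t u, of "local_coord y"] y local_coord[of y] by auto
  have "vge v (vord v t) (y - (\<Sum>i\<in>?I. emb (a i) * u i))" if v: "v \<in> zeros t" for v
  proof -
    have vP: "v \<in> P" "vord v t > 0" using v by (auto simp: zeros_def)
    have eq: "y - (\<Sum>i\<in>?I. emb (a i) * u i) = (\<Sum>i\<in>?I. (phi x (local_coord y i) - emb (a i)) * u i)"
      by (subst local_coord[of y]) (simp add: sum_subtractf left_diff_distrib)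
    have "vge v (vord v t + 0) ((phi x (local_coord y i) - emb (a i)) * u i)" if "i \<in> ?I" for i
      by (intro vge_mult local_family_vge(1)[OF u that v]) (use a that vP in auto)
    then show ?thesis unfolding eq by (intro vge_sum[OF vP(1)]) simp
  qed
  then show ?thesis using a by (auto simp: zeros_def)
qed

text \<open>With respect to \<open>u\<close>, multiplication by an element vanishing on the fibre is strictly triangular
  modulo \<open>t\<close>.\<close>
lemma local_coord_vanishes:
  assumes w: "\<And>v. v \<in> zeros t \<Longrightarrow> vge v 0 w" and i: "(v, j) \<in> local_index (zeros t) t"
    and wi: "vge v (int j + 1) (w * u (v, j))" and v': "v' \<in> zeros t"
  shows "vge v' (vord v' t) (phi x (local_coord (w * u (v, j)) (v, j)))"
proof -
  let ?I = "local_index (zeros t) t" and ?y = "w * u (v, j)"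
  have "vge v 0 ?y" if v: "v \<in> zeros t" for v
  proof -
    have "vge v (0 + 0) ?y" by (intro vge_mult w local_family_vge(1)[OF u i]) (use v in \<open>auto simp: zeros_def\<close>)
    then show ?thesis by simp
  qed
  then obtain a where a: "\<forall>i\<in>?I. \<forall>v\<in>zeros t. vge v (vord v t) (phi x (local_coord ?y i) - emb (a i))"
    "\<forall>v\<in>zeros t. vge v (vord v t) (?y - (\<Sum>i\<in>?I. emb (a i) * u i))"
    using local_coord_residues[of ?y] by blast
  have v: "v \<in> zeros t" "j < nat (vord v t)" "v \<in> P" using i by (auto simp: local_index_def zeros_def)
  have "vge v (int j + 1) (?y - (\<Sum>i\<in>?I. emb (a i) * u i))"
    by (rule vge_mono[of v "vord v t"]) (use a v in auto)
  from vge_diff[OF v(3) wi this] have "vge v (int j + 1) (\<Sum>i\<in>?I. emb (a i) * u i)" by simp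
  then have "a (v, j) = 0"
    using local_family_coefficient[OF zeros_facts(1,2) u v(1,2), of "int j + 1"] by simp
  then show ?thesis using a(1) i v' by (force simp: emb_zero)
qed

text \<open>Multiplication by \<open>w\<close> raises the order of \<open>u (v, j)\<close> at
  \<open>v\<close> above \<open>j\<close>, so each diagonal entry vanishes on the fibre to the order
  of \<open>t\<close>.\<close>

lemma trace_vanishes_aux:
  assumes w: "\<And>v. v \<in> zeros t \<Longrightarrow> vge v 1 w" and v: "v \<in> zeros t"
  shows "vge v (vord v t) (phi x (trace w))"
  unfolding trace_local phi_sum
proof (rule vge_sum)
  show "v \<in> P" using v by (simp add: zeros_def)
  fix i assume i: "i \<in> local_index (zeros t) t"
  obtain v' j where ij: "i = (v', j)" by (cases i)
  have v': "v' \<in> zeros t" "j < nat (vord v' t)" "v' \<in> P" using i ij by (auto simp: local_index_def zeros_def)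
  have "vord v' (u (v', j)) = int j" using u v' by (auto simp: local_family_def)
  then have "vge v' (1 + int j) (w * u (v', j))"
    by (intro vge_mult w v') (auto simp: vge_def)
  then have "vge v' (int j + 1) (w * u (v', j))" by (simp add: add.commute)
  moreover have "vge v 0 w" if "v \<in> zeros t" for v by (rule vge_mono[OF w[OF that]]) simp
  ultimately show "vge v (vord v t) (phi x (local_coord (w * u i) i))"
    unfolding ij using i ij v by (intro local_coord_vanishes) auto
qed

text \<open>The element \<open>u (v, 0)\<close> is a unit at the simple zero \<open>v\<close> and
  vanishes to full order at the other points of the fibre. All diagonal entries except that of
  \<open>(v, 0)\<close> therefore vanish on the fibre, and the remaining one has a non-zero
  residue.\<close>

lemma trace_nonzero_aux:
  assumes v: "v \<in> zeros t" "vord v t = 1"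
  shows "trace (u (v, 0)) \<noteq> 0"
proof -
  let ?I = "local_index (zeros t) t" and ?w = "u (v, 0)"
  have vP: "v \<in> P" using v by (simp add: zeros_def)
  have i0: "(v, 0) \<in> ?I" using v by (simp add: local_index_def)
  have uv: "?w \<noteq> 0" "vord v ?w = 0" using u v by (auto simp: local_family_def)
  have w: "vge v' 0 ?w" if "v' \<in> zeros t" for v'
    by (rule local_family_vge(1)[OF u i0 that]) (use that in \<open>auto simp: zeros_def\<close>)
  have other: "vge v (vord v t) (phi x (local_coord (?w * u i) i))" if i: "i \<in> ?I - {(v, 0)}" for i
  proof -
    obtain v' j where ij: "i = (v', j)" by (cases i)
    have v': "v' \<in> zeros t" "j < nat (vord v' t)" "v' \<in> P" using i ij by (auto simp: local_index_def zeros_def)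
    have ne: "v' \<noteq> v" using i ij v v' by auto
    have "vord v' (u (v', j)) = int j" using u v' by (auto simp: local_family_def)
    then have "vge v' (vord v' t + int j) (?w * u (v', j))"
      by (intro vge_mult local_family_vge(2)[OF u i0] v') (use ne v' in \<open>auto simp: vge_def zeros_def\<close>)
    then have "vge v' (int j + 1) (?w * u (v', j))" by (rule vge_mono) (use v' in auto)
    then show ?thesis unfolding ij using i ij v w by (intro local_coord_vanishes) auto
  qed
  have "vge v' 0 (?w * ?w)" if "v' \<in> zeros t" for v'
    using vge_mult[of v' 0 ?w 0 ?w] w that by (auto simp: zeros_def)
  then obtain a where a: "\<forall>i\<in>?I. \<forall>v\<in>zeros t. vge v (vord v t) (phi x (local_coord (?w * ?w) i) - emb (a i))"
    "\<forall>v\<in>zeros t. vge v (vord v t) (?w * ?w - (\<Sum>i\<in>?I. emb (a i) * u i))"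
    using local_coord_residues[of "?w * ?w"] by blast
  \<comment> \<open>The square of \<open>u (v, 0)\<close> is a unit at \<open>v\<close>, while every
    other member of the family vanishes there, so the coordinate at \<open>(v, 0)\<close> must carry
    its value.\<close>
  have a0: "a (v, 0) \<noteq> 0"
  proof
    assume a0: "a (v, 0) = 0"
    have "vge v 1 (\<Sum>i\<in>?I. emb (a i) * u i)"
    proof (rule vge_sum[OF vP])
      fix i assume i: "i \<in> ?I"
      show "vge v 1 (emb (a i) * u i)"
      proof (cases "i = (v, 0)")
        case False
        then have "v \<noteq> fst i" using i v by (auto simp: local_index_def)
        then have "vge v (vord v t) (u i)" using local_family_vge(2)[OF u i v(1)] v by simp
        then show ?thesis using v by (intro vge_emb_mult vP) simp
      qed (simp add: a0 emb_zero)
    qed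
    moreover have "vge v 1 (?w * ?w - (\<Sum>i\<in>?I. emb (a i) * u i))" using a(2) v by fastforce
    ultimately have "vge v 1 (?w * ?w - (\<Sum>i\<in>?I. emb (a i) * u i) + (\<Sum>i\<in>?I. emb (a i) * u i))"
      by (intro vge_add vP)
    then show False using uv vP by (simp add: vge_def vord_mult)
  qed
  have "trace ?w = local_coord (?w * ?w) (v, 0) + (\<Sum>i\<in>?I - {(v, 0)}. local_coord (?w * u i) i)"
    unfolding trace_local using i0 finite_local_index[OF zeros_facts(1)] by (simp add: sum.remove)
  moreover have "vge v 1 (\<Sum>i\<in>?I - {(v, 0)}. phi x (local_coord (?w * u i) i))"
    using other v by (intro vge_sum vP) auto
  moreover have "vge v 1 (phi x (local_coord (?w * ?w) (v, 0)) - emb (a (v, 0)))"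
    using a(1) i0 v by fastforce
  ultimately have "vge v 1 (phi x (trace ?w) - emb (a (v, 0)))"
    using vge_add[OF vP] by (fastforce simp: phi_add phi_sum algebra_simps)
  show ?thesis
  proof
    assume "trace ?w = 0"
    then have "vge v 1 (emb (- a (v, 0)))" using \<open>vge v 1 (phi x (trace ?w) - emb (a (v, 0)))\<close>
      by (simp add: emb_minus)
    then show False using vge_not_emb[OF vP] a0 by fastforce
  qed
qed

end

lemma trace_vanishes:
  assumes "leading_terms t" "zero_degree t = pole_degree x"
    and "\<And>v. v \<in> zeros t \<Longrightarrow> vge v 1 w" "v \<in> zeros t"
  shows "vge v (vord v t) (phi x (trace w))"
proof -
  have "finite (zeros t)" "zeros t \<subseteq> P" using finite_zeros by (auto simp: zeros_def)
  then obtain u where "local_family (zeros t) t u" using local_family_exists by blast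
  from trace_vanishes_aux[OF assms(1,2) this assms(3,4)] show ?thesis .
qed

lemma trace_nonzero_unramified:
  assumes "v \<in> P" "vord v (x - emb c) = 1"
  shows "\<exists>w. trace w \<noteq> 0"
proof -
  let ?t = "x - emb c"
  have "finite (zeros ?t)" "zeros ?t \<subseteq> P" using finite_zeros by (auto simp: zeros_def)
  then obtain u where "local_family (zeros ?t) ?t u" using local_family_exists by blast
  moreover have "zero_degree ?t = pole_degree x"
    by (simp add: zero_degree_eq_pole_degree pole_degree_x_minus_const)
  ultimately show ?thesis
    using trace_nonzero_aux[OF leading_terms_diff, of c u v] assms by (auto simp: zeros_def)
qed

end

section \<open>Ramification\<close>

lemma infinite_UNIV_alg_closed: "infinite (UNIV :: 'k::alg_closed_field set)"
proof
  assume fin: "finite (UNIV :: 'k set)"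
  define p where "p = (\<Prod>c\<in>(UNIV :: 'k set). [:-c, 1:]) + 1"
  have val: "poly p a = 1" for a
  proof -
    have "poly (\<Prod>c\<in>(UNIV :: 'k set). [:-c, 1:]) a = 0"
      unfolding poly_prod using fin by (intro prod_zero) (auto intro: bexI[of _ a])
    then show ?thesis by (simp add: p_def)
  qed
  have "degree p > 0"
  proof (rule ccontr)
    assume "\<not> degree p > 0"
    then obtain c where c: "p = [:c:]" using degree_eq_zeroE by blast
    then have "p = 1" using val[of 0] by (simp add: one_pCons)
    then have "(\<Prod>c\<in>(UNIV :: 'k set). [:-c, 1:]) = 0" by (simp add: p_def)
    then show False using fin by (simp add: prod_zero_iff)
  qed
  then show False using alg_closed_imp_poly_has_root[of p] val by auto
qed

lemma of_nat_power_CHAR: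
  assumes "prime CHAR('a::field)"
  shows "(of_nat i :: 'a) ^ CHAR('a) = of_nat i"
proof (induction i)
  case 0
  then show ?case using prime_gt_0_nat[OF assms] by simp
next
  case (Suc i)
  then show ?case using freshmans_dream[OF assms refl, of 1 "of_nat i"] by simp
qed

lemma minus_power_CHAR:
  assumes "prime CHAR('a::field)"
  shows "(- y :: 'a) ^ CHAR('a) = - (y ^ CHAR('a))"
proof -
  have "(y + - y) ^ CHAR('a) = y ^ CHAR('a) + (- y) ^ CHAR('a)"
    by (rule freshmans_dream[OF assms refl])
  then have "y ^ CHAR('a) + (- y) ^ CHAR('a) = 0"
    using prime_gt_0_nat[OF assms] by (simp add: power_0_left)
  then show ?thesis by (simp add: add_eq_0_iff)
qed

lemma CHAR_poly_eq: "CHAR('a::field poly) = CHAR('a)"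
  by (rule CHAR_eqI) (auto simp: of_nat_poly of_nat_eq_0_iff_char_dvd)

text \<open>The powers of \<open>x\<close> below p are independent over the subfield of p-th powers
  unless \<open>x\<close> is itself a p-th power. The minimal polynomial of \<open>x\<close> over
  that subfield divides (Y - x)^p; a degree between 1 and p is excluded by differentiation, and
  degree 1 makes \<open>x\<close> a p-th power.\<close>

lemma powers_indep_frobenius:
  fixes x :: "'a::field"
  assumes p: "prime CHAR('a)" and nx: "x \<notin> range (\<lambda>g. g ^ CHAR('a))"
    and rel: "(\<Sum>i<CHAR('a). z i ^ CHAR('a) * x ^ i) = 0" and i: "i < CHAR('a)"
  shows "z i = 0"
proof (rule ccontr)
  assume zi: "z i \<noteq> 0"
  define q where "q = CHAR('a)"
  have q0: "q > 0" using prime_gt_0_nat[OF p] by (simp add: q_def)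
  \<comment> \<open>Polynomials over the subfield of p-th powers are written as \<open>F A\<close>
    with \<open>A\<close> over the whole field, so that the subfield need not be a type.\<close>
  define F where "F = map_poly (\<lambda>c::'a. c ^ q)"
  have F_pCons: "F (pCons a A) = pCons (a ^ q) (F A)" for a A
    unfolding F_def by (rule map_poly_pCons) (use q0 in simp)
  have F_0: "F 0 = 0" by (simp add: F_def)
  have coeff_F: "coeff (F A) n = coeff A n ^ q" for A n
    unfolding F_def by (rule coeff_map_poly) (use q0 in simp)
  have fd: "(a + b) ^ q = a ^ q + b ^ q" for a b :: 'a
    unfolding q_def by (rule freshmans_dream[OF p refl])
  have F_add: "F (A + B) = F A + F B" for A B by (rule poly_eqI) (simp add: coeff_F fd)
  have F_smult: "F (smult a B) = smult (a ^ q) (F B)" for a B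
    by (rule poly_eqI) (simp add: coeff_F power_mult_distrib)
  have F_mult: "F (A * B) = F A * F B" for A B
    by (induction A) (use q0 in \<open>simp_all add: F_0 F_pCons F_add F_smult\<close>)
  have F_minus: "F (- A) = - F A" for A
    by (rule poly_eqI) (simp add: coeff_F q_def minus_power_CHAR[OF p])
  have F_diff: "F (A - B) = F A - F B" for A B using F_add[of A "-B"] by (simp add: F_minus)

  have deg_F: "degree (F A) = degree A" for A
  proof (cases "A = 0")
    case False
    show ?thesis
    proof (rule antisym)
      show "degree (F A) \<le> degree A"
        by (rule degree_le) (use q0 in \<open>auto simp: coeff_F coeff_eq_0\<close>)
      show "degree A \<le> degree (F A)"
        by (rule le_degree) (use False in \<open>simp add: coeff_F\<close>)
    qed
  qed (simp add: F_0)
  have F_pderiv: "pderiv (F A) = F (pderiv A)" for A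
    by (rule poly_eqI) (simp only: coeff_pderiv coeff_F power_mult_distrib q_def of_nat_power_CHAR[OF p])
  define J where "J = {A. poly (F A) x = 0}"
  define H0 where "H0 = (\<Sum>i<q. monom (z i) i)"
  have cH0: "coeff H0 n = (if n < q then z n else 0)" for n by (simp add: H0_def coeff_sum)
  have H0: "H0 \<noteq> 0" using zi i cH0[of i] by (auto simp: q_def)
  have dH0: "degree H0 \<le> q - 1" by (rule degree_le) (auto simp: cH0)
  have "poly (F H0) x = (\<Sum>i\<le>q - 1. z i ^ q * x ^ i)"
  proof -
    have "poly (F H0) x = (\<Sum>i\<le>q - 1. coeff (F H0) i * x ^ i)"
      unfolding poly_altdef by (rule sum.mono_neutral_left) (use dH0 in \<open>auto simp: deg_F coeff_eq_0\<close>)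
    also have "\<dots> = (\<Sum>i\<le>q - 1. z i ^ q * x ^ i)"
      by (intro sum.cong refl) (use q0 in \<open>auto simp: coeff_F cH0\<close>)
    finally show ?thesis .
  qed
  also have "{..q - 1} = {..<q}" using q0 by auto
  finally have "H0 \<in> J" using rel by (simp add: J_def q_def)
  define m where "m = (LEAST m. \<exists>A\<in>J. A \<noteq> 0 \<and> degree A = m)"
  have "\<exists>A\<in>J. A \<noteq> 0 \<and> degree A = m"
    unfolding m_def by (rule LeastI_ex) (use H0 \<open>H0 \<in> J\<close> in blast)
  then obtain H where H: "H \<in> J" "H \<noteq> 0" "degree H = m" by blast
  have least: "m \<le> degree A" if "A \<in> J" "A \<noteq> 0" for A
    unfolding m_def by (rule Least_le) (use that in blast)
  have mq: "m < q" using least[OF \<open>H0 \<in> J\<close> H0] dH0 q0 by linarith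
  have m0: "m > 0"
  proof (rule ccontr)
    assume "\<not> m > 0"
    then obtain c where "H = [:c:]" using H(3) degree_eq_zeroE by blast
    then show False using H by (auto simp: J_def F_pCons F_0)
  qed
  \<comment> \<open>\<open>F P0\<close> is Y^p - x^p, that is, (Y - x)^p. Division with remainder by
    the generator \<open>H\<close> shows that \<open>F H\<close> divides it, hence has
    \<open>x\<close> as its only root.\<close>
  define P0 where "P0 = monom 1 q - [:x:]"
  have FP0: "F P0 = [:-x, 1:] ^ q"
  proof -
    have "F P0 = monom 1 q - [:x ^ q:]"
      by (rule poly_eqI) (use q0 in \<open>auto simp: coeff_F P0_def coeff_pCons q_def minus_power_CHAR[OF p] split: nat.split\<close>)
    moreover have "([:-x:] + monom 1 1) ^ q = [:-x:] ^ q + monom 1 1 ^ q"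
      by (rule freshmans_dream) (use p in \<open>simp_all add: CHAR_poly_eq q_def\<close>)
    moreover have "[:-x:] + monom 1 1 = [:-x, 1:]" by (simp add: monom_Suc)
    moreover have "[:-x:] ^ q = - [:x ^ q:]"
      by (simp add: poly_const_pow q_def minus_power_CHAR[OF p])
    moreover have "monom (1::'a) 1 ^ q = monom 1 q" by (simp add: monom_power)
    ultimately show ?thesis by simp
  qed
  have "P0 \<in> J" using q0 by (simp add: J_def FP0)
  have "P0 mod H \<in> J"
  proof -
    have "P0 mod H = P0 - P0 div H * H" by (simp add: minus_div_mult_eq_mod)
    then show ?thesis using \<open>P0 \<in> J\<close> H(1) by (simp add: J_def F_diff F_mult)
  qed
  then have "P0 mod H = 0"
    using least[of "P0 mod H"] degree_mod_less[OF H(2), of P0] H(3) by force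
  then have "P0 = P0 div H * H" by (metis add.right_neutral div_mult_mod_eq)
  then have prod: "[:-x, 1:] ^ q = F (P0 div H) * F H" using FP0 F_mult by metis
  let ?Q = "F (P0 div H)"
  have nz: "?Q * F H \<noteq> 0" unfolding prod[symmetric] by simp
  have "order x ?Q + order x (F H) = q"
    using order_mult[OF nz, of x] unfolding prod[symmetric] order_power_n_n by simp
  moreover have "degree ?Q + degree (F H) = q"
  proof -
    have "degree (?Q * F H) = degree ?Q + degree (F H)" by (rule degree_mult_eq) (use nz in auto)
    then show ?thesis using degree_linear_power[of "-x" q] unfolding prod[symmetric] by simp
  qed
  moreover have "order x ?Q \<le> degree ?Q" "order x (F H) \<le> degree (F H)"
    using nz by (auto intro!: order_degree)
  ultimately have ord: "order x (F H) = m" by (simp add: deg_F H)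
  \<comment> \<open>A multiple root of \<open>F H\<close> is a root of its derivative
    \<open>F (pderiv H)\<close>. As \<open>m\<close> is less than p, \<open>pderiv H\<close> is
    non-zero and contradicts the minimality of \<open>m\<close>.\<close>
  have m1: "m = 1"
  proof (rule ccontr)
    assume "m \<noteq> 1"
    then have "[:-x, 1:] ^ 2 dvd F H" using order_divides[of x 2 "F H"] ord m0 by auto
    then obtain K where "F H = [:-x, 1:] ^ 2 * K" by (auto simp: dvd_def)
    moreover have "poly (pderiv (A ^ 2 * K)) x = 0" if "poly A x = 0" for A
      using that by (simp add: pderiv_mult power2_eq_square)
    ultimately have "poly (pderiv (F H)) x = 0" by simp
    then have "pderiv H \<in> J" by (simp add: J_def F_pderiv)
    have "coeff (pderiv H) (m - 1) = of_nat m * coeff H m" using m0 by (simp add: coeff_pderiv)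
    moreover have "(of_nat m :: 'a) \<noteq> 0"
      using mq m0 nat_dvd_not_less by (auto simp: of_nat_eq_0_iff_char_dvd q_def)
    ultimately have "pderiv H \<noteq> 0" using H by auto
    from least[OF \<open>pderiv H \<in> J\<close> this] have "m \<le> degree (pderiv H)" .
    moreover have "degree (pderiv H) \<le> m - 1"
      by (rule degree_le) (use H m0 in \<open>auto simp: coeff_pderiv coeff_eq_0\<close>)
    ultimately show False using m0 by simp
  qed
  have "degree H = Suc 0" using H m1 by simp
  obtain a A where aA: "H = pCons a A" by (cases H)
  then have "A \<noteq> 0" "degree A = 0" using \<open>degree H = Suc 0\<close> by (auto split: if_splits)
  obtain b where "A = [:b:]" using degree_eq_zeroE[OF \<open>degree A = 0\<close>] .
  then have Hab: "H = [:a, b:]" "b \<noteq> 0" using aA \<open>A \<noteq> 0\<close> by simp_all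
  then have "a ^ q + x * b ^ q = 0" using H by (simp add: J_def F_pCons F_0)
  then have "x = - (a ^ q) / b ^ q" using Hab by (simp add: field_simps add_eq_0_iff)
  also have "\<dots> = (- a / b) ^ q" by (simp add: power_divide q_def minus_power_CHAR[OF p])
  finally show False using nx by (auto simp: q_def)
qed

section \<open>Traces and the number of points over given values\<close>

context function_field_element
begin

text \<open>New basis elements gained when the multiple of the pole divisor grows by one are
  independent over k(x). If the span were proper, each of g + 1 steps would thus add at most
  \<open>pole_degree x - 1\<close> to the dimension, and the total of at most 1 + (g + 1)(d - 1),
  with d the pole degree, contradicts Riemann's inequality.\<close>

lemma span_RR_multiples:
  "X.span (RR (\<lambda>v. (genus emb + 1) * pole_divisor x v)) = UNIV"
proof (rule ccontr)
  define G where "G = (\<lambda>n::nat. RR (\<lambda>v. int n * pole_divisor x v))"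
  define g where "g = nat (genus emb)"
  have g: "int g = genus emb" using genus_nonneg by (simp add: g_def)
  have D: "(\<lambda>v. int n * pole_divisor x v) \<in> divisors emb"
    "div_degree (\<lambda>v. int n * pole_divisor x v) = int n * pole_degree x" for n
    using divisor_scale[OF pole_divisor(1), of "int n" x] by (auto simp: pole_divisor)
  have fd: "V.fin_dim (G n)" for n unfolding G_def by (rule RR_fin_dim[OF D(1)])
  have mono: "G n \<subseteq> G m" if "n \<le> m" for n m unfolding G_def
    by (rule RR_mono) (use that pole_divisor(3) in \<open>auto intro: mult_right_mono\<close>)
  assume "X.span (RR (\<lambda>v. (genus emb + 1) * pole_divisor x v)) \<noteq> UNIV"
  then have ne: "X.span (G (g + 1)) \<noteq> UNIV" by (simp add: G_def g add.commute)
  have small: "int (card E) \<le> pole_degree x - 1" if E: "finite E" "X.independent E" "E \<subseteq> G (g + 1)" for E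
  proof -
    have "int (card E) \<noteq> pole_degree x"
      using maximal_indep_spans[OF E(1,2)] X.span_mono[OF E(3)] ne by auto
    then show ?thesis using X_indep_card_le_pole_degree[OF E(1) X.independent_fam_indep[OF E(2,1)]] by simp
  qed
  have step: "int (V.dim (G (Suc n))) \<le> int (V.dim (G n)) + (pole_degree x - 1)" if n: "Suc n \<le> g + 1" for n
  proof -
    obtain B0 where B0: "B0 \<subseteq> G n" "V.independent B0" "finite B0" "G n \<subseteq> V.span B0" "card B0 = V.dim (G n)"
      by (rule V.fin_dim_basis[OF fd])
    have "B0 \<subseteq> G (Suc n)" using B0(1) mono[of n "Suc n"] by auto
    then obtain B1 where B1: "B0 \<subseteq> B1" "B1 \<subseteq> G (Suc n)" "V.independent B1" "G (Suc n) \<subseteq> V.span B1"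
      using V.maximal_independent_subset_extend[OF _ B0(2)] by blast
    have cB1: "card B1 = V.dim (G (Suc n))" by (rule V.basis_card_eq_dim[OF B1(2,4,3)])
    have fB1: "finite B1"
    proof -
      obtain T where T: "finite T" "G (Suc n) \<subseteq> V.span T" using fd[of "Suc n"] unfolding V.fin_dim_def by blast
      then have "B1 \<subseteq> V.span T" using B1(2) by blast
      from V.independent_span_bound[OF T(1) B1(3) this] show ?thesis by blast
    qed
    define E where "E = B1 - B0"
    have fE: "finite E" using fB1 by (simp add: E_def)
    have "X.fam_indep E (\<lambda>b. b)"
    proof (rule X.fam_indepI, rule ccontr)
      fix s e assume rel: "(\<Sum>e\<in>E. phi x (s e) * e) = 0" and e: "e \<in> E" "s e \<noteq> 0"
      obtain k \<beta> where \<beta>: "\<exists>i\<in>E. \<beta> i \<noteq> 0" "\<And>i v. i \<in> E \<Longrightarrow> v \<in> P \<Longrightarrow> vord v (inverse x) > 0 \<Longrightarrow>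
        vge v ((k + 1) * vord v (inverse x)) (phi x (s i) - emb (\<beta> i) * inverse x powi k)"
        using leading_coefficients[OF leading_terms_inverse fE e(1), where s = s] e(2) by blast
      \<comment> \<open>The leading coefficients at the poles of \<open>x\<close> turn a relation
        over k(x) into a combination over k whose poles drop by one multiple of the pole divisor. It
        then lies in the span of \<open>B0\<close>, against the independence of
        \<open>B1\<close>.\<close>
      define Z where "Z = (\<Sum>e\<in>E. emb (\<beta> e) * e)"
      have EG: "vge v (- (int (Suc n) * pole_divisor x v)) e" if "v \<in> P" "e \<in> E" for v e
        using that B1(2) by (auto simp: E_def G_def RR_iff)
      have "Z \<in> G n" unfolding G_def RR_iff
      proof
        fix v assume v: "v \<in> P"
        show "vge v (- (int n * pole_divisor x v)) Z"
        proof (cases "vord v x < 0")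
          case False
          then have 0: "pole_divisor x v = 0" by (simp add: pole_divisor_def)
          show ?thesis unfolding Z_def
            by (intro vge_sum v vge_emb_mult) (use EG[OF v] 0 in auto)
        next
          case True
          let ?e = "vord v (inverse x)"
          have ei: "?e > 0" "pole_divisor x v = ?e"
            using True v by (auto simp: vord_inverse pole_divisor_def)
          have 1: "vge v ((k + 1) * ?e + - (int (Suc n) * ?e))
            (\<Sum>e\<in>E. (phi x (s e) - emb (\<beta> e) * inverse x powi k) * e)"
            by (intro vge_sum v vge_mult \<beta>(2) ei) (use EG[OF v] ei in auto)
          have 2: "(\<Sum>e\<in>E. (phi x (s e) - emb (\<beta> e) * inverse x powi k) * e) = - (Z * inverse x powi k)"
          proof -
            have "(\<Sum>e\<in>E. emb (\<beta> e) * inverse x powi k * e) = Z * inverse x powi k"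
              unfolding Z_def by (subst sum_distrib_right) (simp add: mult_ac)
            then show ?thesis using rel by (simp add: left_diff_distrib sum_subtractf)
          qed
          have "vge v ((k + 1) * ?e + - (int (Suc n) * ?e)) (Z * inverse x powi k)"
            using vge_minus[OF v 1[unfolded 2]] by simp
          moreover have "(k + 1) * ?e + - (int (Suc n) * ?e) = - (int n * ?e) + vord v (inverse x powi k)"
            using x_nonzero v by (simp add: vord_powi algebra_simps)
          ultimately have "vge v (- (int n * ?e) + vord v (inverse x powi k)) (Z * inverse x powi k)"
            by metis
          then have "vge v (- (int n * ?e)) Z"
            by (subst (asm) vge_cancel[OF v]) (use x_nonzero in auto)
          then show ?thesis using ei by simp
        qed
      qed
      then have "Z \<in> V.span B0" using B0(4) by blast
      then obtain \<gamma> where \<gamma>: "Z = (\<Sum>b\<in>B0. emb (\<gamma> b) * b)" unfolding V.span_finite[OF B0(3)] by blast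
      define a where "a = (\<lambda>b. if b \<in> E then \<beta> b else - \<gamma> b)"
      have "(\<Sum>b\<in>B1. emb (a b) * b) = (\<Sum>b\<in>E. emb (a b) * b) + (\<Sum>b\<in>B0. emb (a b) * b)"
        using sum.subset_diff[OF B1(1) fB1] by (simp add: E_def)
      also have "(\<Sum>b\<in>E. emb (a b) * b) = Z" by (simp add: Z_def a_def)
      also have "(\<Sum>b\<in>B0. emb (a b) * b) = - Z"
        unfolding \<gamma> by (subst sum_negf[symmetric], intro sum.cong) (auto simp: a_def E_def emb_minus)
      finally have "(\<Sum>b\<in>B1. emb (a b) * b) = 0" by simp
      then have az: "a b = 0" if "b \<in> B1" for b
        using V.fam_indepD[OF V.independent_fam_indep[OF B1(3) fB1]] that by blast
      obtain i where i: "i \<in> E" "\<beta> i \<noteq> 0" using \<beta>(1) by blast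
      then have "i \<in> B1" by (simp add: E_def)
      from az[OF this] show False using i by (simp add: a_def)
    qed
    from X.fam_indep_independent[OF fE this] have "X.independent E" by simp
    then have "int (card E) \<le> pole_degree x - 1"
      using small[OF fE] B1(2) mono[OF n] by (auto simp: E_def)
    moreover have "card B1 = card E + card B0"
      unfolding E_def using card_Diff_subset[OF B0(3) B1(1)] card_mono[OF fB1 B1(1)] by simp
    ultimately show ?thesis using cB1 B0(5) by simp
  qed
  have bound: "int (V.dim (G n)) \<le> 1 + int n * (pole_degree x - 1)" if "n \<le> g + 1" for n
    using that
  proof (induction n)
    case 0
    have "G 0 = RR (\<lambda>_. 0)" by (simp add: G_def)
    then show ?case using RR_zero_dim by simp
  next
    case (Suc n)
    then show ?case using step[of n] by (simp add: algebra_simps)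
  qed
  have "int (g + 1) * pole_degree x + 1 - int (V.dim (G (g + 1))) \<le> int g"
    using riemann[OF D(1), of "g + 1"] unfolding D(2) G_def g .
  then show False using bound[of "g + 1"] by (simp add: algebra_simps)
qed

text \<open>Multiplication by \<open>x - c\<close> makes \<open>w\<close> vanish on the fibre. The
  trace of the product is then divisible by \<open>x - c\<close>, and dividing again leaves a
  regular element. This is why poles of order up to the ramification index minus one are
  allowed.\<close>

lemma vge_trace_finite:
  assumes v: "v \<in> P" "vord v (x - emb c) > 0"
    and w: "\<And>v. v \<in> zeros (x - emb c) \<Longrightarrow> vge v (1 - vord v (x - emb c)) w"
  shows "vge v 0 (phi x (trace w))"
proof -
  let ?t = "x - emb c"
  define s where "s = Fract [:-c, 1:] 1"
  have s: "phi x s = ?t" by (simp add: s_def phi_poly emb_minus emb_one emb_zero)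
  have "vge v' 1 (?t * w)" if "v' \<in> zeros ?t" for v'
    using vge_mult[OF _ vge_self[of v' ?t] w[OF that]] that by (auto simp: zeros_def)
  then have "vge v (vord v ?t) (phi x (trace (?t * w)))"
    using v by (intro trace_vanishes leading_terms_diff)
      (auto simp: zeros_def zero_degree_eq_pole_degree pole_degree_x_minus_const)
  then have "vge v (0 + vord v ?t) (phi x (trace w) * ?t)"
    using trace_scale[of s w] by (simp add: s phi_mult mult.commute)
  then show ?thesis using vge_cancel[OF v(1) x_minus_const_nonzero] by blast
qed

lemma trace_eq_zero:
  assumes fin: "\<And>c v. v \<in> zeros (x - emb c) \<Longrightarrow> vge v (1 - vord v (x - emb c)) w"
    and inf: "\<And>v. v \<in> poles x \<Longrightarrow> vge v 1 w"
  shows "trace w = 0"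
proof -
  let ?r = "phi x (trace w)"
  have at_inf: "vge v 1 ?r" if v: "v \<in> poles x" for v
  proof -
    have "vge v (vord v (inverse x)) ?r"
      using v inf by (intro trace_vanishes leading_terms_inverse)
        (auto simp: poles_eq_zeros_inverse pole_degree_inverse)
    then show ?thesis using v by (elim vge_mono) (auto simp: poles_def vord_inverse)
  qed
  have "?r \<in> RR (\<lambda>_. 0)" unfolding RR_iff
  proof
    fix v assume v: "v \<in> P"
    show "vge v (- 0) ?r"
    proof (cases "vord v x < 0")
      case True
      then show ?thesis using at_inf[of v] v by (auto simp: poles_def intro: vge_mono)
    next
      case False
      then obtain c where c: "vord v (x - emb c) > 0" using residue_x[OF v] by auto
      show ?thesis using vge_trace_finite[OF v c fin] by simp
    qed
  qed
  then obtain c where c: "?r = emb c" by (auto simp: RR_zero)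
  have "poles x \<noteq> {}" using pole_degree_pos[OF nonconst] by (auto simp: pole_degree_def)
  then obtain v where v: "v \<in> poles x" by blast
  then have "c = 0" using at_inf[OF v] vge_not_emb[of v c] by (simp add: c poles_def)
  then show ?thesis using c by (simp add: emb_zero)
qed

lemma zeros_disjoint:
  assumes "v \<in> zeros (x - emb c)" "v \<in> zeros (x - emb c')"
  shows "c = c'"
proof -
  have "vge v 1 (x - emb c)" "vge v 1 (x - emb c')" "v \<in> P"
    using assms by (simp_all add: zeros_def vge_def)
  from vge_diff[OF this(3,2,1)] have "vge v 1 ((x - emb c') - (x - emb c))" .
  then have "vge v 1 (emb (c - c'))" by (simp add: emb_diff)
  then show ?thesis using vge_not_emb[of v "c - c'"] assms by (simp add: zeros_def)
qed

theorem ramification_bound: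
  assumes tr: "\<exists>w. trace w \<noteq> 0" and Z: "finite Z"
  shows "int (card Z) * pole_degree x - (\<Sum>c\<in>Z. int (card (zeros (x - emb c))))
    \<le> genus emb - 1 + (genus emb + 1) * pole_degree x + int (card (poles x))"
proof -
  define R1 where "R1 = (\<lambda>c v. if v \<in> zeros (x - emb c) then vord v (x - emb c) - 1 else 0)"
  have R1: "R1 c \<in> divisors emb" "div_degree (R1 c) = pole_degree x - int (card (zeros (x - emb c)))" for c
  proof -
    have fin: "finite (zeros (x - emb c))" by (rule finite_zeros)
    have sub: "zeros (x - emb c) \<subseteq> P" by (auto simp: zeros_def)
    have 0: "R1 c v = 0" if "v \<notin> zeros (x - emb c)" for v using that by (simp add: R1_def)
    show "R1 c \<in> divisors emb" by (rule divisorsI[OF fin sub 0])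
    have "div_degree (R1 c) = (\<Sum>v\<in>zeros (x - emb c). R1 c v)"
      by (rule div_degree_eq[OF fin]) (rule 0)
    also have "\<dots> = zero_degree (x - emb c) - int (card (zeros (x - emb c)))"
      by (simp add: R1_def zero_degree_def sum_subtractf)
    finally show "div_degree (R1 c) = pole_degree x - int (card (zeros (x - emb c)))"
      by (simp add: zero_degree_eq_pole_degree pole_degree_x_minus_const)
  qed
  define R where "R = (\<lambda>v. \<Sum>c\<in>Z. R1 c v)"
  have R: "R \<in> divisors emb" "div_degree R = int (card Z) * pole_degree x - (\<Sum>c\<in>Z. int (card (zeros (x - emb c))))"
  proof -
    show Rd: "R \<in> divisors emb" unfolding R_def by (rule divisor_sum) (rule R1)
    define T where "T = (\<Union>c\<in>Z. zeros (x - emb c))"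
    have T: "finite T" unfolding T_def using Z finite_zeros by blast
    have 0: "R1 c v = 0" if "v \<notin> T" "c \<in> Z" for c v using that by (auto simp: R1_def T_def)
    have "div_degree R = (\<Sum>v\<in>T. R v)" by (rule div_degree_eq[OF T]) (simp add: R_def 0)
    also have "\<dots> = (\<Sum>c\<in>Z. \<Sum>v\<in>T. R1 c v)" unfolding R_def by (rule sum.swap)
    also have "\<dots> = (\<Sum>c\<in>Z. div_degree (R1 c))"
      by (intro sum.cong refl div_degree_eq[symmetric] T) (rule 0)
    finally show "div_degree R = int (card Z) * pole_degree x - (\<Sum>c\<in>Z. int (card (zeros (x - emb c))))"
      by (simp add: R1 sum_subtractf)
  qed
  define I where "I = (\<lambda>v. if v \<in> poles x then 1 else 0 :: int)"
  have I: "I \<in> divisors emb" "div_degree I = int (card (poles x))"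
  proof -
    have sub: "poles x \<subseteq> P" by (auto simp: poles_def)
    have 0: "I v = 0" if "v \<notin> poles x" for v using that by (simp add: I_def)
    show "I \<in> divisors emb" by (rule divisorsI[OF finite_poles sub 0])
    have "div_degree I = (\<Sum>v\<in>poles x. I v)" by (rule div_degree_eq[OF finite_poles]) (rule 0)
    then show "div_degree I = int (card (poles x))" by (simp add: I_def)
  qed
  define g where "g = genus emb"
  define D where "D = (\<lambda>v. 1 * (1 * R v + (- (g + 1)) * pole_divisor x v) + (- 1) * I v)"
  have D: "D \<in> divisors emb" "div_degree D = div_degree R - (g + 1) * pole_degree x - int (card (poles x))"
    unfolding D_def
    using divisor_combination[OF divisor_combination(1)[OF R(1) pole_divisor(1)] I(1), of 1 1 "- (g + 1)" x "-1"]
      divisor_combination[OF R(1) pole_divisor(1), of 1 "- (g + 1)" x]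
    by (auto simp: I pole_divisor algebra_simps)
  have "w = 0" if w: "w \<in> RR D" for w
  proof -
    have tr0: "trace (y * w) = 0" if y: "y \<in> RR (\<lambda>v. (g + 1) * pole_divisor x v)" for y
    proof (rule trace_eq_zero)
      fix c v assume v: "v \<in> zeros (x - emb c)"
      then have vP: "v \<in> P" "vord v (x - emb c) > 0" by (auto simp: zeros_def)
      have "v \<notin> poles x" using vord_x_minus_const[OF vP(1)] vP by (auto simp: poles_def)
      then have 0: "pole_divisor x v = 0" "I v = 0" using vP by (auto simp: pole_divisor_def poles_def I_def)
      \<comment> \<open>A point lies over at most one constant, so at most one summand of
        \<open>R\<close> contributes at \<open>v\<close>.\<close>
      have "R v \<le> vord v (x - emb c) - 1"
      proof (cases "c \<in> Z")
        case True
        have "R v = R1 c v + (\<Sum>c'\<in>Z - {c}. R1 c' v)" unfolding R_def by (rule sum.remove[OF Z True])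
        also have "(\<Sum>c'\<in>Z - {c}. R1 c' v) = 0"
          by (rule sum.neutral) (use zeros_disjoint[OF v] in \<open>auto simp: R1_def\<close>)
        finally show ?thesis using v by (simp add: R1_def)
      next
        case False
        have "R v = 0" unfolding R_def
          by (rule sum.neutral) (use zeros_disjoint[OF v] False in \<open>auto simp: R1_def\<close>)
        then show ?thesis using vP by simp
      qed
      moreover have "vge v (- R v) w" using w vP 0 by (auto simp: RR_iff D_def)
      ultimately have "vge v (1 - vord v (x - emb c)) w" by (elim vge_mono) simp
      moreover have "vge v 0 y" using y vP 0 by (auto simp: RR_iff)
      ultimately show "vge v (1 - vord v (x - emb c)) (y * w)" using vge_mult[OF vP(1), of 0 y _ w] by simp
    next
      fix v assume v: "v \<in> poles x"
      then have vP: "v \<in> P" by (simp add: poles_def)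
      have "R1 c v = 0" for c using v vord_x_minus_const[of v c] by (auto simp: R1_def zeros_def poles_def)
      then have "R v = 0" by (simp add: R_def)
      then have "vge v ((g + 1) * pole_divisor x v + 1) w"
        using w vP v by (auto simp: RR_iff D_def I_def algebra_simps)
      moreover have "vge v (- ((g + 1) * pole_divisor x v)) y" using y vP by (auto simp: RR_iff)
      ultimately have "vge v (- ((g + 1) * pole_divisor x v) + ((g + 1) * pole_divisor x v + 1)) (y * w)"
        by (intro vge_mult vP)
      then show "vge v 1 (y * w)" by simp
    qed
    show "w = 0"
    proof (rule ccontr)
      assume w0: "w \<noteq> 0"
      obtain w' where "trace w' \<noteq> 0" using tr by blast
      moreover have "trace (w' / w * w) = 0"
        by (rule trace_zero_span[OF span_RR_multiples]) (use tr0 in \<open>simp add: g_def\<close>)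
      ultimately show False using w0 by simp
    qed
  qed
  \<comment> \<open>With dimension 0, Riemann's inequality reads deg D + 1 <= g, and deg D is the
    degree of \<open>R\<close> minus that of the two other divisors.\<close>
  then have "RR D \<subseteq> V.span {}" by auto
  then have "V.dim (RR D) \<le> card ({} :: 'a set)" by (rule V.dim_le_card) simp
  then have "div_degree D + 1 \<le> genus emb" using riemann[OF D(1)] by simp
  then show ?thesis using D R by (simp add: g_def)
qed

text \<open>Removing the points in \<open>S\<close> costs at most the number of its points that are
  not poles of \<open>x\<close>, since no counted point is a pole; this cancels the poles in the
  ramification bound. The final shape, proportional to the degree d, amounts to (g + |S| - 1)(d - 1)
  >= 0.\<close>

theorem value_count:
  assumes tr: "\<exists>w. trace w \<noteq> 0" and Z: "finite Z" and S: "finite S" "S \<subseteq> P" "poles x \<subseteq> S"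
  shows "int (card Z) * pole_degree x \<le> int (card {v \<in> P - S. \<exists>c\<in>Z. vord v (x - emb c) > 0})
    + (2 * genus emb + int (card S)) * pole_degree x"
proof -
  let ?d = "pole_degree x" and ?g = "genus emb"
  define U where "U = (\<Union>c\<in>Z. zeros (x - emb c))"
  have fU: "finite U" unfolding U_def using Z finite_zeros by blast
  have cU: "int (card U) = (\<Sum>c\<in>Z. int (card (zeros (x - emb c))))"
  proof -
    have "card U = (\<Sum>c\<in>Z. card (zeros (x - emb c)))"
      unfolding U_def by (rule card_UN_disjoint[OF Z]) (use finite_zeros zeros_disjoint in blast)+
    then show ?thesis by simp
  qed
  have "U \<inter> poles x = {}" using vord_x_minus_const by (fastforce simp: U_def zeros_def poles_def)
  then have "U \<subseteq> (U - S) \<union> (S - poles x)" by auto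
  then have "card U \<le> card ((U - S) \<union> (S - poles x))" using fU S by (intro card_mono) auto
  also have "\<dots> \<le> card (U - S) + card (S - poles x)" by (rule card_Un_le)
  also have "card (S - poles x) = card S - card (poles x)" by (rule card_Diff_subset[OF finite_poles S(3)])
  finally have 1: "int (card U) \<le> int (card (U - S)) + int (card S) - int (card (poles x))"
    using card_mono[OF S(1,3)] by linarith
  have "U - S = {v \<in> P - S. \<exists>c\<in>Z. vord v (x - emb c) > 0}" by (auto simp: U_def zeros_def)
  then have 2: "int (card Z) * ?d \<le> int (card {v \<in> P - S. \<exists>c\<in>Z. vord v (x - emb c) > 0})
      + (?g - 1 + (?g + 1) * ?d + int (card S))"
    using ramification_bound[OF tr Z] 1 cU by simp
  have d: "?d \<ge> 1" by (rule pole_degree_pos[OF nonconst])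
  have "poles x \<noteq> {}" using d by (auto simp: pole_degree_def)
  then have s: "card S \<ge> 1" using S card_gt_0_iff[of S] by auto
  have "0 \<le> (?g + (int (card S) - 1)) * (?d - 1)"
    using d s genus_nonneg by (intro mult_nonneg_nonneg) auto
  then have "?g - 1 + (?g + 1) * ?d + int (card S) \<le> (2 * ?g + int (card S)) * ?d"
    by (simp add: algebra_simps)
  then show ?thesis using 2 by linarith
qed

section \<open>Non-vanishing of the trace\<close>

lemma phi_of_nat: "phi x (of_nat n) = of_nat n"
  by (induction n) (simp_all add: phi_add)

text \<open>Multiplication by 1 has the identity matrix, so its trace is the degree over
  k(x).\<close>

lemma trace_nonzero_char0:
  assumes "CHAR('a) = 0"
  shows "trace 1 \<noteq> 0"
proof -
  obtain B where B: "X_basis B" using X_basis_exists by blast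
  then have B': "finite B" "X.independent B" "X.span B = UNIV" by (auto simp: X_basis_def)
  have "trace 1 = (\<Sum>b\<in>B. 1)"
    unfolding trace_eq[OF B] basis_trace_def using X.representation_basis[OF B'(2)]
    by (intro sum.cong refl) simp
  then have "phi x (trace 1) = of_nat (card B)" by (simp add: phi_of_nat)
  moreover have "card B \<noteq> 0"
  proof
    assume "card B = 0"
    then have "B = {}" using B' by simp
    then have "(1::'a) \<in> X.span {}" using B' by simp
    then show False by simp
  qed
  moreover have "(of_nat (card B) :: 'a) = 0 \<longleftrightarrow> card B = 0"
    by (simp add: of_nat_eq_0_iff_char_dvd assms)
  ultimately show ?thesis by auto
qed

text \<open>As constants have p-th roots, a polynomial in \<open>x\<close> is a sum of terms
  \<open>x ^ i\<close> times p-th powers, with \<open>i\<close> below p. A relation among the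
  \<open>b i ^ p\<close> regroups into p-th powers times \<open>x ^ i\<close>; these p-th powers
  vanish, and so do their roots, which are relations among the \<open>b i\<close>.\<close>

lemma frobenius_indep:
  assumes p: "prime CHAR('a)" and nx: "x \<notin> range (\<lambda>g. g ^ CHAR('a))"
    and I: "finite I" and b: "X.fam_indep I b"
  shows "X.fam_indep I (\<lambda>i. b i ^ CHAR('a))"
proof (rule X_indepI_poly[OF I])
  define q where "q = CHAR('a)"
  have q0: "q > 0" using prime_gt_0_nat[OF p] by (simp add: q_def)
  fix A j assume rel: "(\<Sum>j\<in>I. ev x (A j) * b j ^ CHAR('a)) = 0" and j: "j \<in> I"
  have "\<forall>c::'k. \<exists>y. y ^ q = c" using nth_root_exists[OF q0] by blast
  then obtain \<gamma> where \<gamma>: "\<And>c::'k. \<gamma> c ^ q = c" by metis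
  define n where "n = (\<Sum>j\<in>I. degree (A j))"
  have deg: "degree (A j) \<le> n" if "j \<in> I" for j
    unfolding n_def by (rule member_le_sum) (use that I in auto)
  \<comment> \<open>Exponents are split as \<open>l * q + i\<close> with \<open>i < q\<close>;
    \<open>s j i\<close> is the p-th root of the part with remainder \<open>i\<close>.\<close>
  define s where "s = (\<lambda>j i. \<Sum>l<Suc n. monom (\<gamma> (coeff (A j) (l * q + i))) l)"
  have spow: "ev x (s j i) ^ q = (\<Sum>l<Suc n. emb (coeff (A j) (l * q + i)) * x ^ (l * q))" for j i
  proof -
    have "ev x (s j i) ^ q = (\<Sum>l<Suc n. emb (\<gamma> (coeff (A j) (l * q + i))) * x ^ l) ^ q"
      by (simp only: s_def ev_sum ev_monom)
    also have "\<dots> = (\<Sum>l<Suc n. (emb (\<gamma> (coeff (A j) (l * q + i))) * x ^ l) ^ q)"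
      by (rule freshmans_dream_sum[OF p q_def])
    also have "\<dots> = (\<Sum>l<Suc n. emb (coeff (A j) (l * q + i)) * x ^ (l * q))"
      by (intro sum.cong refl) (simp only: power_mult_distrib emb_power[symmetric] \<gamma> power_mult)
    finally show ?thesis .
  qed
  have evA: "ev x (A j) = (\<Sum>i<q. x ^ i * ev x (s j i) ^ q)" if "j \<in> I" for j
  proof -
    let ?f = "\<lambda>k. emb (coeff (A j) k) * x ^ k"
    have "n \<le> Suc n * q - 1" using q0 by (cases q) auto
    then have "ev x (A j) = (\<Sum>k\<le>Suc n * q - 1. ?f k)"
      using deg[OF that] by (intro ev_altdef) linarith
    also have "{..Suc n * q - 1} = {..<Suc n * q}"
      using q0 by (auto simp: less_Suc_eq_le[symmetric])
    also have "sum ?f {..<Suc n * q} = (\<Sum>l<Suc n. sum ?f {l * q..<l * q + q})"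
      by (rule sum.nat_group[symmetric])
    also have "\<dots> = (\<Sum>l<Suc n. \<Sum>i<q. ?f (l * q + i))"
    proof (rule sum.cong[OF refl])
      fix l show "sum ?f {l * q..<l * q + q} = (\<Sum>i<q. ?f (l * q + i))"
        using sum.shift_bounds_nat_ivl[of ?f 0 "l * q" q]
        by (simp add: atLeast0LessThan add.commute)
    qed
    also have "\<dots> = (\<Sum>i<q. \<Sum>l<Suc n. ?f (l * q + i))" by (rule sum.swap)
    also have "\<dots> = (\<Sum>i<q. x ^ i * ev x (s j i) ^ q)"
      unfolding spow sum_distrib_left by (intro sum.cong refl) (simp add: power_add mult_ac)
    finally show ?thesis .
  qed
  have "(\<Sum>i<q. (\<Sum>j\<in>I. ev x (s j i) * b j) ^ q * x ^ i) = (\<Sum>i<q. \<Sum>j\<in>I. (ev x (s j i) * b j) ^ q * x ^ i)"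
    by (simp only: freshmans_dream_sum[OF p q_def] sum_distrib_right)
  also have "\<dots> = (\<Sum>j\<in>I. \<Sum>i<q. (ev x (s j i) * b j) ^ q * x ^ i)" by (rule sum.swap)
  also have "\<dots> = (\<Sum>j\<in>I. ev x (A j) * b j ^ q)"
  proof (rule sum.cong[OF refl])
    fix j assume j: "j \<in> I"
    show "(\<Sum>i<q. (ev x (s j i) * b j) ^ q * x ^ i) = ev x (A j) * b j ^ q"
      unfolding evA[OF j] sum_distrib_right
      by (intro sum.cong refl) (simp add: power_mult_distrib mult_ac)
  qed
  finally have "(\<Sum>i<q. (\<Sum>j\<in>I. ev x (s j i) * b j) ^ q * x ^ i) = 0" using rel by (simp add: q_def)
  then have "(\<Sum>j\<in>I. ev x (s j i) * b j) = 0" if "i < q" for i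
    using powers_indep_frobenius[OF p nx, of "\<lambda>i. \<Sum>j\<in>I. ev x (s j i) * b j" i] that by (simp add: q_def)
  then have s0: "s j i = 0" if "i < q" for i using X_indep_poly[OF b, of "\<lambda>j. s j i" j] j that by blast
  show "A j = 0"
  proof (rule poly_eqI)
    fix k
    show "coeff (A j) k = coeff 0 k"
    proof (cases "k \<le> n")
      case True
      let ?i = "k mod q" and ?l = "k div q"
      have "?l < Suc n" using True by (meson div_le_dividend le_trans less_Suc_eq_le)
      then have "coeff (s j ?i) ?l = \<gamma> (coeff (A j) (?l * q + ?i))"
        by (simp add: s_def coeff_sum del: sum.lessThan_Suc)
      then have "\<gamma> (coeff (A j) k) = 0" using s0[of ?i] q0 by simp
      then show ?thesis using \<gamma>[of "coeff (A j) k"] q0 by (simp add: power_0_left)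
    next
      case False
      then show ?thesis using deg[OF j] by (simp add: coeff_eq_0)
    qed
  qed
qed

text \<open>
  A degenerate value \<open>c\<close> yields an element \<open>(\<Sum>i. a i * u i) / (x - c)\<close> of a fixed Riemann-Roch
  space.  By partial fractions these elements are independent for different \<open>c\<close>.
\<close>
lemma finite_degenerate_values:
  assumes I: "finite I" and u: "X.fam_indep I u"
  shows "finite {c. \<exists>a. (\<exists>i\<in>I. a i \<noteq> 0) \<and>
    (\<forall>v\<in>zeros (x - emb c). vge v (vord v (x - emb c)) (\<Sum>i\<in>I. emb (a i) * u i))}" (is "finite ?B")
proof (rule ccontr)
  assume inf: "infinite ?B"
  obtain C where C: "C \<in> divisors emb" and C0: "\<And>v. C v \<ge> 0"
    and uC: "\<And>v i. v \<in> P \<Longrightarrow> i \<in> I \<Longrightarrow> vge v (- C v) (u i)"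
    using pole_bound_family[OF I, of u] by blast
  obtain Y where Y: "finite Y" "card Y = Suc (V.dim (RR C))" "Y \<subseteq> ?B"
    using infinite_arbitrarily_large[OF inf] by blast
  have "\<forall>c\<in>Y. \<exists>a. (\<exists>i\<in>I. a i \<noteq> 0) \<and>
    (\<forall>v\<in>zeros (x - emb c). vge v (vord v (x - emb c)) (\<Sum>i\<in>I. emb (a i) * u i))" using Y(3) by blast
  then obtain a where a: "\<And>c. c \<in> Y \<Longrightarrow> \<exists>i\<in>I. a c i \<noteq> 0"
    "\<And>c v. c \<in> Y \<Longrightarrow> v \<in> zeros (x - emb c) \<Longrightarrow> vge v (vord v (x - emb c)) (\<Sum>i\<in>I. emb (a c i) * u i)"
    by metis
  define w where "w = (\<lambda>c. (\<Sum>i\<in>I. emb (a c i) * u i) / (x - emb c))"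
  have mem: "w ` Y \<subseteq> RR C"
  proof (rule image_subsetI)
    fix c assume c: "c \<in> Y"
    show "w c \<in> RR C" unfolding RR_iff
    proof
      fix v assume v: "v \<in> P"
      let ?s = "\<Sum>i\<in>I. emb (a c i) * u i"
      have eq: "w c * (x - emb c) = ?s" using x_minus_const_nonzero by (simp add: w_def)
      have "vge v (- C v + vord v (x - emb c)) ?s"
      proof (cases "v \<in> zeros (x - emb c)")
        case True
        show ?thesis by (rule vge_mono[OF a(2)[OF c True]]) (use C0 in simp)
      next
        case False
        then have "vord v (x - emb c) \<le> 0" using v by (auto simp: zeros_def)
        moreover have "vge v (- C v) ?s" by (intro vge_sum v vge_emb_mult uC)
        ultimately show ?thesis by (elim vge_mono) simp
      qed
      then show "vge v (- C v) (w c)" unfolding eq[symmetric] using vge_cancel[OF v x_minus_const_nonzero] by blast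
    qed
  qed
  have "V.fam_indep Y w"
  proof (rule V.fam_indepI, rule ccontr)
    fix \<beta> c0 assume rel: "(\<Sum>c\<in>Y. emb (\<beta> c) * w c) = 0" and c0: "c0 \<in> Y" "\<beta> c0 \<noteq> 0"
    \<comment> \<open>The coordinates of the relation with respect to \<open>u\<close>, as partial
      fractions in \<open>x\<close>; independence of \<open>u\<close> makes each of them
      zero.\<close>
    define s where "s = (\<lambda>i. \<Sum>c\<in>Y. Fract [:\<beta> c * a c i:] [:-c, 1:])"
    have lin: "ev x [:-c, 1:] = x - emb c" for c by (simp add: emb_minus emb_one emb_zero)
    have s: "phi x (s i) = (\<Sum>c\<in>Y. emb (\<beta> c * a c i) / (x - emb c))" for i
      unfolding s_def phi_sum
    proof (intro sum.cong refl)
      fix c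
      have "phi x (Fract [:\<beta> c * a c i:] [:-c, 1:]) = ev x [:\<beta> c * a c i:] / ev x [:-c, 1:]"
        by (rule phi_Fract) simp
      then show "phi x (Fract [:\<beta> c * a c i:] [:-c, 1:]) = emb (\<beta> c * a c i) / (x - emb c)"
        unfolding lin by simp
    qed
    have "(\<Sum>i\<in>I. phi x (s i) * u i) = (\<Sum>i\<in>I. \<Sum>c\<in>Y. emb (\<beta> c) * (emb (a c i) * u i / (x - emb c)))"
      unfolding s sum_distrib_right by (intro sum.cong refl) (simp add: emb_mult)
    also have "\<dots> = (\<Sum>c\<in>Y. emb (\<beta> c) * w c)"
      by (subst sum.swap) (simp add: w_def sum_distrib_left sum_divide_distrib)
    finally have s0: "s i = 0" if "i \<in> I" for i using X.fam_indepD[OF u] rel that by simp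
    obtain i where i: "i \<in> I" "a c0 i \<noteq> 0" using a(1)[OF c0(1)] by blast
    obtain v where v: "v \<in> P" "vord v (x - emb c0) > 0"
    proof -
      have "x - emb c0 \<notin> range emb"
      proof
        assume "x - emb c0 \<in> range emb"
        then obtain d where "x - emb c0 = emb d" by blast
        then have "x = emb (d + c0)" by (simp add: emb_add algebra_simps)
        then show False using nonconst by blast
      qed
      then show ?thesis using exists_zero that by blast
    qed
    \<comment> \<open>At a zero of \<open>x - emb c0\<close> only the summand for \<open>c0\<close>
      has a pole, so its numerator must be zero.\<close>
    have "vge v 0 (\<Sum>c\<in>Y - {c0}. emb (\<beta> c * a c i) / (x - emb c))"
    proof (rule vge_sum[OF v(1)])
      fix c assume c: "c \<in> Y - {c0}"
      have ne: "c \<noteq> c0" using c by auto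
      have eq: "x - emb c = emb (c0 - c) + (x - emb c0)" by (simp add: emb_diff)
      have "vord v (emb (c0 - c) + (x - emb c0)) = vord v (emb (c0 - c))"
        using vord_add_eq[OF v(1), of "emb (c0 - c)" "x - emb c0"] v ne by (auto simp: vge_def)
      then have "vord v (x - emb c) = 0" unfolding eq using v(1) by simp
      then have "vge v 0 (inverse (x - emb c))" using v by (simp add: vge_def vord_inverse)
      then show "vge v 0 (emb (\<beta> c * a c i) / (x - emb c))"
        using vge_emb_mult[OF v(1)] by (simp add: field_class.field_divide_inverse)
    qed
    moreover have "0 = emb (\<beta> c0 * a c0 i) / (x - emb c0) + (\<Sum>c\<in>Y - {c0}. emb (\<beta> c * a c i) / (x - emb c))"
      using s0[OF i(1)] s[of i] sum.remove[OF Y(1) c0(1), of "\<lambda>c. emb (\<beta> c * a c i) / (x - emb c)"] by simp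
    ultimately have "vge v 0 (emb (\<beta> c0 * a c0 i) / (x - emb c0))"
      using vge_minus[OF v(1), of 0 "\<Sum>c\<in>Y - {c0}. emb (\<beta> c * a c i) / (x - emb c)"]
        add_eq_0_iff2[of "emb (\<beta> c0 * a c0 i) / (x - emb c0)"] by simp
    then show False using v i c0 x_minus_const_nonzero[of c0] by (auto simp: vge_def vord_divide)
  qed
  from V.fam_indep_dim[OF Y(1) this mem RR_fin_dim[OF C]] show False using Y(2) by simp
qed

text \<open>Over a general value \<open>c\<close> the p-th powers of a basis stay independent modulo
  \<open>x - c\<close>. At a ramified point \<open>v\<close> over \<open>c\<close>, take
  \<open>y\<close> of order 1 that is regular on the fibre. Its expansion makes it a constant
  combination of p-th powers up to order 2 at \<open>v\<close>, hence a constant up to order 2,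
  which contradicts order 1.\<close>

lemma unramified_value:
  assumes p: "prime CHAR('a)" and nx: "x \<notin> range (\<lambda>g. g ^ CHAR('a))"
  shows "\<exists>v\<in>P. \<exists>c. vord v (x - emb c) = 1"
proof -
  define q where "q = CHAR('a)"
  have q2: "q \<ge> 2" using prime_ge_2_nat[OF p] by (simp add: q_def)
  obtain I and b :: "('a \<Rightarrow> int extended) \<times> nat \<Rightarrow> 'a"
    where I: "finite I" and b: "X.fam_indep I b" and card: "int (card I) = pole_degree x"
    using maximal_family .
  let ?u = "\<lambda>i. b i ^ q"
  have u: "X.fam_indep I ?u" unfolding q_def by (rule frobenius_indep[OF p nx I b])
  have span: "X.span (?u ` I) = UNIV"
    using I X.fam_indep_independent[OF I u] maximal_indep_spans[of "?u ` I"] card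
      card_image[OF X.fam_indep_inj[OF I u]] by simp
  define B where "B = {c. \<exists>a. (\<exists>i\<in>I. a i \<noteq> 0) \<and>
    (\<forall>v\<in>zeros (x - emb c). vge v (vord v (x - emb c)) (\<Sum>i\<in>I. emb (a i) * ?u i))}"
  have fB: "finite B" unfolding B_def by (rule finite_degenerate_values[OF I u])
  define S where "S = (\<Union>i\<in>I. poles (b i))"
  have fS: "finite S" unfolding S_def using I finite_poles by blast
  have "finite {c. v \<in> zeros (x - emb c)}" for v
  proof (cases "\<exists>c. v \<in> zeros (x - emb c)")
    case True
    then obtain c where "v \<in> zeros (x - emb c)" by blast
    then have "{c. v \<in> zeros (x - emb c)} \<subseteq> {c}" using zeros_disjoint by blast
    then show ?thesis by (rule finite_subset) simp
  qed simp
  then have fB': "finite (\<Union>v\<in>S. {c. v \<in> zeros (x - emb c)})" using fS by blast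
  \<comment> \<open>Only finitely many values are excluded: the degenerate ones, and those below a
    pole of some \<open>b i\<close>. The field of constants is infinite.\<close>
  obtain c where c: "c \<notin> B" "c \<notin> (\<Union>v\<in>S. {c. v \<in> zeros (x - emb c)})"
    using ex_new_if_finite[OF infinite_UNIV_alg_closed, of "B \<union> (\<Union>v\<in>S. {c. v \<in> zeros (x - emb c)})"]
      fB fB' by blast
  let ?t = "x - emb c"
  have t0: "?t \<noteq> 0" by (rule x_minus_const_nonzero)
  have reg: "vge v 0 (b i)" if "v \<in> zeros ?t" "i \<in> I" for v i
  proof -
    have "v \<notin> poles (b i)" using c(2) that by (auto simp: S_def)
    then show ?thesis using that by (auto simp: poles_def zeros_def vge_def)
  qed
  have regu: "vge v 0 (?u i)" if "v \<in> zeros ?t" "i \<in> I" for v i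
    using vge_power[OF _ reg[OF that]] that by (simp add: zeros_def)
  have "zero_degree ?t \<ge> 1"
    using pole_degree_pos[OF nonconst] by (simp add: zero_degree_eq_pole_degree pole_degree_x_minus_const)
  then have "zeros ?t \<noteq> {}" by (auto simp: zero_degree_def)
  then obtain v where v: "v \<in> zeros ?t" by blast
  have vP: "v \<in> P" "vord v ?t > 0" using v by (auto simp: zeros_def)
  have "vord v ?t = 1"
  proof (rule ccontr)
    assume "vord v ?t \<noteq> 1"
    then have e2: "vord v ?t \<ge> 2" using vP by simp
    have zt: "finite (zeros ?t)" "zeros ?t \<subseteq> P" using finite_zeros by (auto simp: zeros_def)
    obtain l where l: "local_family (zeros ?t) ?t l" using local_family_exists[OF zt] by blast
    define y where "y = l (v, 1)"
    have y: "y \<noteq> 0" "vord v y = 1" using l v e2 by (auto simp: local_family_def y_def)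
    have yreg: "vge v' 0 y" if "v' \<in> zeros ?t" for v' unfolding y_def
      by (rule local_family_vge(1)[OF l _ that]) (use v e2 that in \<open>auto simp: local_index_def zeros_def\<close>)
    have "y \<in> X.span (?u ` I)" using span by simp
    then obtain s' where "y = (\<Sum>z\<in>?u ` I. phi x (s' z) * z)" using X.span_finite[of "?u ` I"] I by auto
    then obtain s where ys: "y = (\<Sum>i\<in>I. phi x (s i) * ?u i)"
      using that[of "\<lambda>i. s' (?u i)"] by (simp add: sum.reindex[OF X.fam_indep_inj[OF I u]])
    obtain i0 where i0: "i0 \<in> I" "s i0 \<noteq> 0" using y(1) ys by (metis (no_types, lifting) mult_zero_left phi_0 sum.neutral)
    obtain n \<beta> where \<beta>: "\<exists>i\<in>I. \<beta> i \<noteq> 0" "\<And>i v. i \<in> I \<Longrightarrow> v \<in> P \<Longrightarrow> vord v ?t > 0 \<Longrightarrow>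
        vge v ((n + 1) * vord v ?t) (phi x (s i) - emb (\<beta> i) * ?t powi n)"
      using leading_coefficients[OF leading_terms_diff I i0(1), where s = s] i0(2) by blast
    define Y where "Y = (\<Sum>i\<in>I. emb (\<beta> i) * ?u i)"
    have lead: "vge v' ((n + 1) * vord v' ?t) (y - Y * ?t powi n)" if v': "v' \<in> zeros ?t" for v'
    proof -
      have v'P: "v' \<in> P" "vord v' ?t > 0" using v' by (auto simp: zeros_def)
      have "vge v' ((n + 1) * vord v' ?t + 0) (\<Sum>i\<in>I. (phi x (s i) - emb (\<beta> i) * ?t powi n) * ?u i)"
        by (intro vge_sum v'P vge_mult \<beta>(2) regu v')
      moreover have "(\<Sum>i\<in>I. emb (\<beta> i) * ?t powi n * ?u i) = Y * ?t powi n"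
        unfolding Y_def by (subst sum_distrib_right) (simp add: mult_ac)
      ultimately show ?thesis by (simp add: ys left_diff_distrib sum_subtractf)
    qed
    \<comment> \<open>With a negative exponent, \<open>Y\<close> would vanish on the fibre to the
      order of \<open>x - c\<close>, so \<open>c\<close> would be degenerate.\<close>
    have n0: "n \<ge> 0"
    proof (rule ccontr)
      assume neg: "\<not> n \<ge> 0"
      have "vge v' (vord v' ?t) Y" if v': "v' \<in> zeros ?t" for v'
      proof -
        have v'P: "v' \<in> P" "vord v' ?t > 0" using v' by (auto simp: zeros_def)
        have "(n + 1) * vord v' ?t \<le> 0" using neg v'P by (simp add: mult_nonpos_nonneg)
        then have "vge v' ((n + 1) * vord v' ?t) y" using vge_mono[OF yreg[OF v']] by blast
        from vge_diff[OF v'P(1) this lead[OF v']]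
        have "vge v' (vord v' ?t + vord v' (?t powi n)) (Y * ?t powi n)"
          using t0 v'P by (simp add: vord_powi algebra_simps)
        then show ?thesis using vge_cancel[OF v'P(1), of "?t powi n"] t0 by simp
      qed
      then have "c \<in> B" using \<beta>(1) unfolding B_def Y_def by blast
      then show False using c by blast
    qed
    have Yreg: "vge v 0 Y" unfolding Y_def by (intro vge_sum vP vge_emb_mult regu v)
    show False
    proof (cases "n = 0")
      case False
      then have n1: "n \<ge> 1" using n0 by simp
      have le: "1 * vord v ?t \<le> n * vord v ?t" using n1 vP by (intro mult_right_mono) auto
      have "vge v (0 + n * vord v ?t) (Y * ?t powi n)"
        by (intro vge_mult vP Yreg) (use t0 vP in \<open>simp add: vge_def vord_powi\<close>)
      then have "vge v 2 (Y * ?t powi n)" by (rule vge_mono) (use le e2 in linarith)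
      moreover have "vge v 2 (y - Y * ?t powi n)"
      proof (rule vge_mono[OF lead[OF v]])
        have "(n + 1) * vord v ?t = n * vord v ?t + vord v ?t" by (simp add: algebra_simps)
        then show "2 \<le> (n + 1) * vord v ?t" using le e2 by linarith
      qed
      ultimately have "vge v 2 (y - Y * ?t powi n + Y * ?t powi n)" by (intro vge_add vP)
      then show False using y by (simp add: vge_def)
    next
      case True
      have "\<exists>\<kappa>. i \<in> I \<longrightarrow> vge v 1 (b i - emb \<kappa>)" for i using residue[OF vP(1) reg[OF v]] by blast
      then obtain \<kappa> where \<kappa>: "\<And>i. i \<in> I \<Longrightarrow> vge v 1 (b i - emb (\<kappa> i))" by metis
      have uk: "vge v 2 (?u i - emb (\<kappa> i ^ q))" if i: "i \<in> I" for i
      proof -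
        have "(b i - emb (\<kappa> i)) ^ q = ?u i - emb (\<kappa> i) ^ q"
          using freshmans_dream[OF p q_def, of "b i - emb (\<kappa> i)" "emb (\<kappa> i)"] by simp
        moreover have "vge v 2 ((b i - emb (\<kappa> i)) ^ q)"
        proof (cases "b i - emb (\<kappa> i) = 0")
          case False
          then have "int q * 1 \<le> int q * vord v (b i - emb (\<kappa> i))"
            using \<kappa>[OF i] by (intro mult_left_mono) (auto simp: vge_def)
          then have "2 \<le> int q * vord v (b i - emb (\<kappa> i))" using q2 by linarith
          then show ?thesis using False vP by (simp add: vge_def vord_power)
        qed (use q2 in \<open>simp add: power_0_left\<close>)
        ultimately show ?thesis by (simp add: emb_power)
      qed
      define k where "k = (\<Sum>i\<in>I. \<beta> i * \<kappa> i ^ q)"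
      have "vge v 2 (\<Sum>i\<in>I. emb (\<beta> i) * (?u i - emb (\<kappa> i ^ q)))" by (intro vge_sum vP vge_emb_mult uk)
      then have Yk: "vge v 2 (Y - emb k)"
        by (simp add: Y_def k_def emb_sum emb_mult right_diff_distrib sum_subtractf)
      have "vge v 2 (y - Y)" by (rule vge_mono[OF lead[OF v, unfolded True, simplified]]) (use e2 in simp)
      from vge_add[OF vP(1) this Yk] have yk: "vge v 2 (y - emb k)" by simp
      have "vge v 1 (y - (y - emb k))" by (intro vge_diff vP vge_mono[OF yk]) (use y in \<open>auto simp: vge_def\<close>)
      then have "k = 0" using vge_not_emb[OF vP(1)] by simp
      then show False using yk y by (simp add: vge_def emb_zero)
    qed
  qed
  then show ?thesis using vP by blast
qed

theorem trace_nonzero: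
  assumes "CHAR('a) > 0 \<Longrightarrow> x \<notin> range (\<lambda>g. g ^ CHAR('a))"
  shows "\<exists>w. trace w \<noteq> 0"
proof (cases "CHAR('a) = 0")
  case True
  then show ?thesis using trace_nonzero_char0 by blast
next
  case False
  then have "prime CHAR('a)" using prime_CHAR_semidom by blast
  then show ?thesis using unramified_value assms False trace_nonzero_unramified by blast
qed

end

section \<open>The exponential local-global principle\<close>

lemma card_roots_simple:
  fixes f :: "'k::alg_closed_field poly"
  assumes "f \<noteq> 0" "\<And>a. poly f a = 0 \<Longrightarrow> poly (pderiv f) a \<noteq> 0"
  shows "card {a. poly f a = 0} = degree f"
  using assms
proof (induction "degree f" arbitrary: f)
  case 0
  then obtain c where "f = [:c:]" using degree_eq_zeroE[of f] by metis
  then show ?case using 0 by simp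
next
  case (Suc n)
  obtain a where a: "poly f a = 0"
    using alg_closed_imp_poly_has_root[of f] Suc(2) by auto
  then obtain g where g: "f = [:-a, 1:] * g" by (auto simp: poly_eq_0_iff_dvd dvd_def)
  have g0: "g \<noteq> 0" using Suc.prems g by auto
  have deg: "degree f = Suc (degree g)" unfolding g using g0 by (subst degree_mult_eq) auto
  have pd: "poly (pderiv f) b = poly g b + (b - a) * poly (pderiv g) b" for b
    unfolding g pderiv_mult by (simp add: pderiv_pCons algebra_simps)
  have ga: "poly g a \<noteq> 0" using Suc.prems(2)[OF a] pd[of a] by simp
  have "card {b. poly g b = 0} = degree g"
  proof (rule Suc.hyps(1))
    fix b assume b: "poly g b = 0"
    then have "poly f b = 0" by (simp add: g)
    from Suc.prems(2)[OF this] show "poly (pderiv g) b \<noteq> 0" using pd[of b] b by auto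
  qed (use deg Suc.hyps g0 in auto)
  moreover have "{b. poly f b = 0} = insert a {b. poly g b = 0}" by (auto simp: g)
  ultimately show ?case using ga deg poly_roots_finite[OF g0] by simp
qed

lemma card_roots_of_unity:
  assumes "n > 0" "\<not> CHAR('k::alg_closed_field) dvd n"
  shows "card {z :: 'k::alg_closed_field. z ^ n = 1} = n"
proof -
  define f :: "'k poly" where "f = monom 1 n - 1"
  have "coeff f n = 1" using assms by (simp add: f_def)
  then have f0: "f \<noteq> 0" by auto
  have d: "degree f = n"
  proof (rule antisym)
    show "degree f \<le> n" by (rule degree_le) (use assms in \<open>auto simp: f_def\<close>)
    show "n \<le> degree f" by (rule le_degree) (simp add: \<open>coeff f n = 1\<close>)
  qed
  have pd: "poly (pderiv f) a = of_nat n * a ^ (n - 1)" for a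
    by (simp add: f_def pderiv_diff pderiv_monom poly_monom)
  have "card {a. poly f a = 0} = degree f"
  proof (rule card_roots_simple[OF f0])
    fix a assume "poly f a = 0"
    then have "a ^ n = 1" by (simp add: f_def poly_monom)
    then have "a \<noteq> 0" using assms by (auto simp: power_0_left)
    then show "poly (pderiv f) a \<noteq> 0" using assms(2) by (simp add: pd of_nat_eq_0_iff_char_dvd)
  qed
  moreover have "poly f a = 0 \<longleftrightarrow> a ^ n = 1" for a by (simp add: f_def poly_monom)
  ultimately show ?thesis using d by simp
qed

text \<open>There are more roots of unity for the exponent q^n than for q^(n-1), which gives an
  element of exact order q^n. The divisibility then follows from Bezout, as every divisor of q^n is
  a power of q.\<close>

lemma prime_power_root_of_unity:
  assumes q: "prime q" "q \<noteq> CHAR('k::alg_closed_field)"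
  obtains w :: "'k::alg_closed_field" where "w ^ (q ^ n) = 1" "\<And>k. w powi k = 1 \<Longrightarrow> int (q ^ n) dvd k"
proof (cases n)
  case 0
  then show ?thesis by (intro that[of 1]) auto
next
  case (Suc m)
  have nd: "\<not> CHAR('k) dvd q ^ j" for j
  proof
    assume *: "CHAR('k) dvd q ^ j"
    then have "CHAR('k) > 0" using q(1) by (intro gr0I) (auto simp: prime_gt_0_nat)
    then have "prime CHAR('k)" using prime_CHAR_semidom by blast
    then have "CHAR('k) dvd q" using * prime_dvd_power by blast
    then show False using \<open>prime CHAR('k)\<close> q primes_dvd_imp_eq by blast
  qed
  have q0: "q ^ j > 0" for j using q(1) by (simp add: prime_gt_0_nat)
  have "card {z :: 'k. z ^ q ^ n = 1} = q ^ n" "card {z :: 'k. z ^ q ^ m = 1} = q ^ m"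
    using card_roots_of_unity[OF q0 nd] by auto
  moreover have "q ^ m < q ^ n" using Suc prime_gt_1_nat[OF q(1)] by simp
  ultimately have "\<not> {z :: 'k. z ^ q ^ n = 1} \<subseteq> {z. z ^ q ^ m = 1}"
    using card_mono[of "{z :: 'k. z ^ q ^ m = 1}" "{z. z ^ q ^ n = 1}"] q0[of m]
    by (metis (no_types, lifting) card.infinite leD less_irrefl_nat)
  then obtain w :: 'k where w: "w ^ q ^ n = 1" "w ^ q ^ m \<noteq> 1" by blast
  have w0: "w \<noteq> 0" using w(1) q0[of n] by (auto simp: power_0_left)
  have "int (q ^ n) dvd k" if k: "w powi k = 1" for k
  proof -
    obtain u v where uv: "u * k + v * int (q ^ n) = gcd k (int (q ^ n))" using bezout_int by blast
    have "w powi (u * k + v * int (q ^ n)) = (w powi k) powi u * (w powi int (q ^ n)) powi v"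
      using w0 by (simp add: power_int_add power_int_mult mult.commute[of u] mult.commute[of v] del: of_nat_power)
    then have "w powi gcd k (int (q ^ n)) = (w powi k) powi u * (w ^ (q ^ n)) powi v"
      unfolding uv power_int_of_nat .
    then have wg: "w powi gcd k (int (q ^ n)) = 1" unfolding k w(1) by simp
    have "nat (gcd k (int (q ^ n))) dvd q ^ n" by (simp add: nat_dvd_iff)
    then obtain s where s: "s \<le> n" "nat (gcd k (int (q ^ n))) = q ^ s"
      using divides_primepow_nat[OF q(1)] by blast
    then have g: "gcd k (int (q ^ n)) = int (q ^ s)" by (metis gcd_ge_0_int nat_0_le)
    have "s = n"
    proof (rule ccontr)
      assume "s \<noteq> n"
      then have "q ^ m = q ^ s * q ^ (m - s)" using s Suc by (simp flip: power_add)
      then have "w ^ q ^ m = (w ^ q ^ s) ^ q ^ (m - s)" by (simp add: power_mult)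
      also have "w ^ q ^ s = 1" using wg unfolding g by (simp del: of_nat_power)
      finally show False using w(2) by simp
    qed
    then show ?thesis using g gcd_dvd1[of k "int (q ^ n)"] by simp
  qed
  then show ?thesis using w that by blast
qed

lemma powi_sum_as_poly:
  fixes y :: "'a::field"
  assumes "y \<noteq> 0" "\<And>i. i \<in> I \<Longrightarrow> b \<le> r i"
  shows "(\<Sum>i\<in>I. c i * y powi r i) = y powi b * poly (\<Sum>i\<in>I. monom (c i) (nat (r i - b))) y"
proof -
  have *: "c i * y powi r i = y powi b * (c i * y ^ nat (r i - b))" if "i \<in> I" for i
  proof -
    have "y powi r i = y powi b * y powi (r i - b)" using assms(1) by (simp flip: power_int_add)
    also have "y powi (r i - b) = y ^ nat (r i - b)" using assms(2)[OF that] by (simp add: power_int_def)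
    finally show ?thesis by simp
  qed
  show ?thesis unfolding poly_sum poly_monom sum_distrib_left by (rule sum.cong[OF refl *])
qed

lemma single_sum_eq_0:
  fixes c :: "'i \<Rightarrow> 'a::comm_monoid_add" and r :: "'i \<Rightarrow> int"
  assumes "\<And>i. i \<in> I \<Longrightarrow> b \<le> r i" "(\<Sum>i\<in>I. monom (c i) (nat (r i - b))) = 0"
  shows "(\<Sum>i\<in>I. Poly_Mapping.single (r i) (c i)) = 0"
proof (rule poly_mapping_eqI)
  fix t
  have "(\<Sum>i\<in>I. if r i = t then c i else 0) = 0"
  proof (cases "t \<ge> b")
    case True
    have "(\<Sum>i\<in>I. if r i = t then c i else 0) = coeff (\<Sum>i\<in>I. monom (c i) (nat (r i - b))) (nat (t - b))"
      unfolding coeff_sum by (intro sum.cong refl) (use assms(1) True in \<open>auto simp: eq_nat_nat_iff\<close>)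
    then show ?thesis using assms(2) by simp
  next
    case False
    show ?thesis by (rule sum.neutral) (use False assms(1) in force)
  qed
  then show "Poly_Mapping.lookup (\<Sum>i\<in>I. Poly_Mapping.single (r i) (c i)) t = Poly_Mapping.lookup 0 t"
    by (simp add: lookup_sum lookup_single when_def)
qed

section \<open>Heights of powers and sums, and reduction at a point\<close>

context function_field
begin

lemma pole_degree_power:
  assumes "n > 0" shows "pole_degree (y ^ n) = int n * pole_degree y"
proof (cases "y = 0")
  case True
  then have "poles y = {}" "poles (y ^ n) = {}" using assms by (auto simp: poles_def power_0_left)
  then show ?thesis by (simp add: pole_degree_def)
next
  case False
  then have "poles (y ^ n) = poles y" using assms by (auto simp: poles_def vord_power mult_less_0_iff)
  then show ?thesis using False by (simp add: pole_degree_def vord_power poles_def sum_distrib_left)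
qed

text \<open>A p^l-th power has pole degree divisible by p^l, and a non-constant one has positive
  pole degree. So the possible \<open>l\<close> are bounded and the description by
  \<open>THE\<close> has a unique solution.\<close>

lemma deg_ins_root:
  assumes f: "f \<notin> range emb"
  obtains f0 where "f = f0 ^ deg_ins f" "CHAR('a) > 0 \<Longrightarrow> f0 \<notin> range (\<lambda>g. g ^ CHAR('a))"
    "\<exists>l. deg_ins f = (if CHAR('a) = 0 then 1 else CHAR('a) ^ l)"
proof (cases "CHAR('a) = 0")
  case True
  then show ?thesis by (intro that[of f]) (auto simp: deg_ins_def)
next
  case False
  define p where "p = CHAR('a)"
  have "prime CHAR('a)" using False prime_CHAR_semidom by blast
  then have p2: "p \<ge> 2" unfolding p_def by (rule prime_ge_2_nat)
  define R where "R = (\<lambda>l. f \<in> range (\<lambda>g. g ^ (p ^ l)))"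
  have R0: "R 0" by (auto simp: R_def)
  have mono: "R l" if R': "R l'" and "l \<le> l'" for l l'
  proof -
    obtain g where "f = g ^ (p ^ l')" using R' by (auto simp: R_def)
    moreover have "p ^ l' = p ^ (l' - l) * p ^ l" using that by (simp flip: power_add)
    ultimately have "f = (g ^ p ^ (l' - l)) ^ p ^ l" by (simp add: power_mult)
    then show ?thesis unfolding R_def by blast
  qed
  have bnd: "l \<le> nat (pole_degree f)" if R': "R l" for l
  proof -
    obtain g where g: "f = g ^ (p ^ l)" using R' by (auto simp: R_def)
    have "g \<notin> range emb" using f g by (auto simp flip: emb_power)
    then have "int (p ^ l) * 1 \<le> int (p ^ l) * pole_degree g"
      by (intro mult_left_mono pole_degree_pos) auto
    also have "\<dots> = pole_degree f" unfolding g by (rule pole_degree_power[symmetric]) (use p2 in simp)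
    finally have "int (p ^ l) \<le> pole_degree f" by simp
    moreover have "l < p ^ l" using p2 by (intro power_gt_expt) simp
    ultimately show ?thesis by linarith
  qed
  obtain l where l: "R l" "\<And>l'. R l' \<Longrightarrow> l' \<le> l"
    using ex_has_greatest_nat[of R 0 "\<lambda>l. l" "Suc (nat (pole_degree f))"] R0 bnd by (auto simp: less_Suc_eq_le)
  have the: "(THE l. R l \<and> \<not> R (l + 1)) = l"
  proof (rule the_equality)
    show "R l \<and> \<not> R (l + 1)" using l by fastforce
    show "l' = l" if "R l' \<and> \<not> R (l' + 1)" for l'
      using that l mono[OF l(1), of "l' + 1"] by (metis Suc_eq_plus1 le_antisym not_less_eq_eq)
  qed
  have d: "deg_ins f = p ^ l" using the False by (simp add: deg_ins_def R_def p_def)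
  obtain f0 where f0: "f = f0 ^ p ^ l" using l(1) by (auto simp: R_def)
  have "f0 \<notin> range (\<lambda>g. g ^ p)"
  proof
    assume "f0 \<in> range (\<lambda>g. g ^ p)"
    then obtain g where "f0 = g ^ p" by blast
    then have "f = g ^ p ^ (l + 1)" using f0 by (simp add: power_mult)
    then have "R (l + 1)" unfolding R_def by blast
    then show False using l(2) by fastforce
  qed
  then show ?thesis using d f0 False by (intro that[of f0]) (auto simp: p_def)
qed

lemma card_zeros_le: "int (card (zeros y)) \<le> pole_degree y"
proof -
  have "int (card (zeros y)) = (\<Sum>v\<in>zeros y. 1)" by simp
  also have "\<dots> \<le> zero_degree y" unfolding zero_degree_def by (intro sum_mono) (auto simp: zeros_def)
  finally show ?thesis by (simp add: zero_degree_eq_pole_degree)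
qed

text \<open>Constant coefficients contribute no poles. This is what makes the height bound for L(y)
  uniform in the constant \<open>y\<close>.\<close>

lemma pole_degree_combination_le:
  assumes I: "finite I"
  shows "pole_degree (\<Sum>i\<in>I. emb (c i) * y i) \<le> (\<Sum>i\<in>I. pole_degree (y i))"
proof -
  let ?s = "\<Sum>i\<in>I. emb (c i) * y i"
  define T where "T = poles ?s \<union> (\<Union>i\<in>I. poles (y i))"
  have T: "finite T" unfolding T_def using I finite_poles by blast
  have TP: "T \<subseteq> P" by (auto simp: T_def poles_def)
  have deg: "pole_degree z = (\<Sum>v\<in>T. pole_divisor z v)" if "poles z \<subseteq> T" for z
    unfolding pole_divisor(2)[symmetric]
    by (rule div_degree_eq[OF T]) (use that in \<open>auto simp: pole_divisor_def poles_def\<close>)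
  have "pole_divisor ?s v \<le> (\<Sum>i\<in>I. pole_divisor (y i) v)" if v: "v \<in> P" for v
  proof -
    have "vge v (- (\<Sum>i\<in>I. pole_divisor (y i) v)) ?s"
    proof (intro vge_sum v vge_emb_mult)
      fix i assume i: "i \<in> I"
      have "pole_divisor (y i) v \<le> (\<Sum>i\<in>I. pole_divisor (y i) v)"
        by (rule member_le_sum[OF i]) (use I pole_divisor(3) in auto)
      then show "vge v (- (\<Sum>i\<in>I. pole_divisor (y i) v)) (y i)"
        by (intro vge_mono[OF vge_pole_divisor[OF v]]) simp
    qed
    moreover have "(\<Sum>i\<in>I. pole_divisor (y i) v) \<ge> 0" by (intro sum_nonneg pole_divisor)
    ultimately show ?thesis using v by (auto simp: pole_divisor_def vge_def)
  qed
  then have "(\<Sum>v\<in>T. pole_divisor ?s v) \<le> (\<Sum>v\<in>T. \<Sum>i\<in>I. pole_divisor (y i) v)"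
    using TP by (intro sum_mono) auto
  also have "\<dots> = (\<Sum>i\<in>I. \<Sum>v\<in>T. pole_divisor (y i) v)" by (rule sum.swap)
  also have "\<dots> = (\<Sum>i\<in>I. pole_degree (y i))"
    by (intro sum.cong refl deg[symmetric]) (auto simp: T_def)
  finally show ?thesis using deg[of ?s] by (simp add: T_def)
qed

lemma vge_residue_power:
  assumes v: "v \<in> P" and y: "vge v 1 (y - emb c)"
  shows "vge v 1 (y ^ n - emb (c ^ n))"
proof (induction n)
  case (Suc n)
  have "vge v 0 (y - emb c + emb c)" using y v by (intro vge_add) (auto intro: vge_mono)
  then have y0: "vge v 0 y" by simp
  have "vge v (0 + 1) (y * (y ^ n - emb (c ^ n)))" by (intro vge_mult v y0 Suc)
  moreover have "vge v 1 (emb (c ^ n) * (y - emb c))" by (intro vge_emb_mult v y)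
  ultimately have "vge v 1 (y * (y ^ n - emb (c ^ n)) + emb (c ^ n) * (y - emb c))"
    using v by (intro vge_add) auto
  then show ?case by (simp add: emb_mult algebra_simps)
qed (simp add: emb_one)

lemma vge_residue_powi:
  assumes v: "v \<in> P" and y: "vge v 1 (y - emb c)" and c: "c \<noteq> 0"
  shows "vge v 1 (y powi n - emb (c powi n))"
proof (cases "n \<ge> 0")
  case True
  then show ?thesis using vge_residue_power[OF v y, of "nat n"] by (simp add: power_int_def)
next
  case False
  have "emb c + (y - emb c) \<noteq> 0 \<and> vord v (emb c + (y - emb c)) = vord v (emb c)"
    by (rule vord_add_eq) (use v y c in auto)
  then have y0: "y \<noteq> 0" "vord v y = 0" using v by auto
  have "inverse y - emb (inverse c) = (emb (inverse c) * inverse y) * (emb c - y)"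
    unfolding emb_inverse using y0 c by (simp add: field_simps)
  moreover have "vge v 1 (- (y - emb c))" by (rule vge_minus[OF v y])
  then have "vge v (0 + 1) ((emb (inverse c) * inverse y) * (emb c - y))"
    using v y0 by (intro vge_mult vge_emb_mult) (auto simp: vge_def vord_inverse)
  ultimately have "vge v 1 (inverse y - emb (inverse c))" by simp
  from vge_residue_power[OF v this, of "nat (- n)"] show ?thesis using False by (simp add: power_int_def)
qed

text \<open>At \<open>v\<close> the value \<open>z\<close> of \<open>f\<close> satisfies z^a = 1, so
  f^a - 1 vanishes there and the minimum in the hypothesis is 1. In the sum, powers of
  \<open>f\<close> may then be replaced by the same powers of \<open>z\<close> modulo the maximal
  ideal of \<open>v\<close>.\<close>

lemma residue_of_power_sum:
  fixes r :: "nat \<Rightarrow> int"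
  assumes v: "v \<in> P" and lam: "\<And>i. i \<in> I \<Longrightarrow> vge v 0 (lam i)"
    and f: "vge v 1 (f - emb z)" and z: "z \<noteq> 0" "z ^ a = 1"
    and B: "min 1 (v (f ^ a - 1)) \<le> v (\<Sum>i\<in>I. lam i * (emb (\<epsilon> i) * f powi r i) powi k)"
  shows "vge v 1 (\<Sum>i\<in>I. emb (\<epsilon> i powi k * (z powi k) powi r i) * lam i)"
proof -
  let ?B = "\<Sum>i\<in>I. lam i * (emb (\<epsilon> i) * f powi r i) powi k"
  have "vge v 1 (f ^ a - 1)" using vge_residue_power[OF v f, of a] z by (simp add: emb_one)
  then have "1 \<le> v (f ^ a - 1)" using vge_iff[OF v, of 1] by (simp add: one_extended_def)
  then have "1 \<le> v ?B" using B by (simp add: min_def split: if_splits)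
  then have vB: "vge v 1 ?B" using vge_iff[OF v, of 1] by (simp add: one_extended_def)
  have "vge v 1 (\<Sum>i\<in>I. lam i * (emb (\<epsilon> i powi k) * (f powi (r i * k) - emb (z powi (r i * k)))))"
  proof (rule vge_sum[OF v])
    fix i assume i: "i \<in> I"
    have "vge v (0 + 1) (lam i * (emb (\<epsilon> i powi k) * (f powi (r i * k) - emb (z powi (r i * k)))))"
      by (intro vge_mult vge_emb_mult lam i v vge_residue_powi f z)
    then show "vge v 1 (lam i * (emb (\<epsilon> i powi k) * (f powi (r i * k) - emb (z powi (r i * k)))))" by simp
  qed
  from vge_diff[OF v vB this]
  have "vge v 1 (\<Sum>i\<in>I. lam i * (emb (\<epsilon> i) * f powi r i) powi k
    - lam i * (emb (\<epsilon> i powi k) * (f powi (r i * k) - emb (z powi (r i * k)))))"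
    by (simp add: sum_subtractf)
  also have "(\<Sum>i\<in>I. lam i * (emb (\<epsilon> i) * f powi r i) powi k
    - lam i * (emb (\<epsilon> i powi k) * (f powi (r i * k) - emb (z powi (r i * k))))) =
    (\<Sum>i\<in>I. emb (\<epsilon> i powi k * (z powi k) powi r i) * lam i)"
  proof (rule sum.cong[OF refl])
    fix i
    have "(emb (\<epsilon> i) * f powi r i) powi k = emb (\<epsilon> i powi k) * f powi (r i * k)"
      by (simp add: power_int_mult_distrib power_int_mult emb_powi)
    moreover have "(z powi k) powi r i = z powi (r i * k)" by (simp add: mult.commute flip: power_int_mult)
    ultimately show "lam i * (emb (\<epsilon> i) * f powi r i) powi k
        - lam i * (emb (\<epsilon> i powi k) * (f powi (r i * k) - emb (z powi (r i * k)))) =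
      emb (\<epsilon> i powi k * (z powi k) powi r i) * lam i"
      by (simp add: emb_mult algebra_simps)
  qed
  finally show ?thesis .
qed

end

theorem theorem8:
  fixes emb :: "'k::alg_closed_field \<Rightarrow> 'a::field"
    and f :: 'a
    and S :: "('a \<Rightarrow> int extended) set"
    and m :: nat
    and lam :: "nat \<Rightarrow> 'a"
    and \<rho> :: real
    and r :: "nat \<Rightarrow> int"
    and \<epsilon> :: "nat \<Rightarrow> 'k"
    and e a :: nat
    and k :: int
  defines "B \<equiv> \<lambda>n::int. \<Sum>i=1..m. lam i * (emb (\<epsilon> i) * f powi r i) powi n"
    and "N \<equiv> Max (r ` {1..m}) - Min (r ` {1..m})"
  assumes "function_field emb"
    and "f \<notin> range emb"
    and "finite S" and "S \<subseteq> points emb"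
    and "f \<in> S_integers emb S"
    and "m \<ge> 1"
    and "\<And>i. i \<in> {1..m} \<Longrightarrow> lam i \<in> S_integers emb S \<and> lam i \<noteq> 0"
    and "\<rho> < 1"
    and "(\<Sum>i=1..m. real_of_int (height emb (lam i)))
           \<le> \<rho> * real_of_int (height emb f) / real (deg_ins f)"
    and "\<And>i. i \<in> {1..m} \<Longrightarrow> \<exists>d>0. \<epsilon> i ^ d = 1"
    and "real e > (2 - \<rho>) / (1 - \<rho>) * (2 * real_of_int (genus emb) + real (card S))"
    and "CHAR('k) > 0 \<Longrightarrow> \<not> CHAR('k) dvd e"
    and "\<And>i. i \<in> {1..m} \<Longrightarrow> \<epsilon> i ^ e = 1"
    and "a > 0"
    and "\<And>q. prime q \<Longrightarrow> q dvd e \<Longrightarrow>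
           real q powi (1 + int (multiplicity q a) - int (multiplicity q e))
             > real_of_int N
               + (2 - \<rho>) / (1 - \<rho>) * (2 * real_of_int (genus emb) + real (card S))"
    and "\<forall>v\<in>points emb - S. min 1 (v (f ^ a - 1)) \<le> v (B k)"
  shows "(int e dvd k \<longrightarrow> (\<Sum>i=1..m. lam i) = 0 \<and> B 0 = 0) \<and>
         (\<not> int e dvd k \<longrightarrow>
           (\<Sum>i=1..m. Poly_Mapping.single (r i) (lam i * emb (\<epsilon> i) powi k)) = 0 \<and> B k = 0)"
proof -
  interpret function_field emb by fact
  note f_nc = \<open>f \<notin> range emb\<close>
  note rho = \<open>\<rho> < 1\<close>
  note S = \<open>finite S\<close> \<open>S \<subseteq> points emb\<close>
  have lam: "vge v 0 (lam i)" if "i \<in> {1..m}" "v \<in> P - S" for i v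
    using assms(9)[OF that(1)] that(2) by (auto simp: S_integers_def zero_extended_def vge_iff)
  obtain f0 where f0: "f = f0 ^ deg_ins f" "CHAR('a) > 0 \<Longrightarrow> f0 \<notin> range (\<lambda>g. g ^ CHAR('a))"
    "\<exists>l. deg_ins f = (if CHAR('a) = 0 then 1 else CHAR('a) ^ l)" using deg_ins_root[OF f_nc] by blast
  define D where "D = deg_ins f"
  have D0: "D > 0" using f0(3) by (auto simp: D_def)
  have "f0 \<notin> range emb"
  proof
    assume "f0 \<in> range emb"
    then obtain c where "f0 = emb c" by blast
    then have "f = emb (c ^ D)" using f0(1) by (simp add: emb_power D_def)
    then show False using f_nc by blast
  qed
  then interpret x: function_field_element emb f0 by (rule function_field_elementI)
  define d where "d = pole_degree f0"
  have d1: "d \<ge> 1" unfolding d_def by (rule pole_degree_pos) fact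
  \<comment> \<open>Taking the D-th power multiplies the height by \<open>D\<close>; dividing by
    \<open>deg_ins f\<close> in the hypothesis restores the height \<open>d\<close> of
    \<open>f0\<close>.\<close>
  have hf: "real_of_int (height emb f) / real D = real_of_int d"
    using pole_degree_power[OF D0, of f0] f0(1) D0 by (simp add: height_eq d_def D_def)
  define h where "h = (\<Sum>i=1..m. pole_degree (lam i))"
  have h_le: "real_of_int h \<le> \<rho> * real_of_int d"
  proof -
    have "(\<Sum>i=1..m. real_of_int (height emb (lam i))) = real_of_int h" by (simp add: h_def height_eq)
    moreover have "\<rho> * real_of_int (height emb f) / real (deg_ins f) = \<rho> * real_of_int d"
      unfolding hf[symmetric] D_def by simp
    ultimately show ?thesis using assms(11) by simp
  qed
  have "h \<ge> 0" unfolding h_def by (intro sum_nonneg pole_degree_nonneg)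
  then have rho0: "\<rho> \<ge> 0" using h_le d1 by (metis le_less_trans linorder_not_le mult_neg_pos of_int_0_le_iff of_int_0_less_iff zero_less_one_class.zero_less_one less_le_trans)
  have polesS: "poles f0 \<subseteq> S"
  proof
    fix v assume v: "v \<in> poles f0"
    show "v \<in> S"
    proof (rule ccontr)
      assume "v \<notin> S"
      then have "0 \<le> v f" using \<open>f \<in> S_integers emb S\<close> v by (auto simp: S_integers_def poles_def)
      then have "vge v 0 f" using v vge_iff[of v 0 f] by (simp add: zero_extended_def poles_def)
      moreover have "vord v f = int D * vord v f0" "f \<noteq> 0"
        using v f0(1) x.x_nonzero vord_power[of v f0 D] by (auto simp: poles_def D_def)
      ultimately show False using v D0 by (auto simp: vge_def poles_def zero_le_mult_iff)
    qed
  qed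
  define X where "X = 2 * genus emb + int (card S)"
  have "poles f0 \<noteq> {}" using d1 by (auto simp: d_def pole_degree_def)
  then have X1: "X \<ge> 1" using S polesS genus_nonneg card_gt_0_iff[of S] by (auto simp: X_def)
  define X' where "X' = (2 - \<rho>) / (1 - \<rho>) * real_of_int X"
  have X'_ge: "X' * (1 - \<rho>) \<ge> real_of_int X" "X' \<ge> 2 * real_of_int X"
  proof -
    have "X' * (1 - \<rho>) = (2 - \<rho>) * real_of_int X" using rho by (simp add: X'_def)
    moreover have "1 * real_of_int X \<le> (2 - \<rho>) * real_of_int X"
      using rho X1 by (intro mult_right_mono) auto
    ultimately show "X' * (1 - \<rho>) \<ge> real_of_int X" by simp
    have "2 \<le> (2 - \<rho>) / (1 - \<rho>)" using rho rho0 by (simp add: field_simps)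
    then show "X' \<ge> 2 * real_of_int X" unfolding X'_def using X1 by (intro mult_right_mono) auto
  qed
  have e_gt: "real e > X'" using assms(13) by (simp add: X'_def X_def)
  have e0: "e > 0" using e_gt X'_ge(2) X1 by (intro gr0I) auto
  have ma: "real q powi (1 + int (multiplicity q a) - int (multiplicity q e)) > real_of_int N + X'"
    if "prime q" "q dvd e" for q using assms(17)[OF that] by (simp add: X'_def X_def)

  have N0: "N \<ge> 0"
  proof -
    have "Min (r ` {1..m}) \<le> r 1" "r 1 \<le> Max (r ` {1..m})" using \<open>m \<ge> 1\<close> by auto
    then show ?thesis unfolding N_def by linarith
  qed
  \<comment> \<open>A non-positive exponent would make the power of \<open>q\<close> at most 1,
    whereas the right-hand side exceeds 1.\<close>
  have mult_le: "multiplicity q e \<le> multiplicity q a" if q: "prime q" "q dvd e" for q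
  proof (rule ccontr)
    assume "\<not> ?thesis"
    then have le: "1 + int (multiplicity q a) - int (multiplicity q e) \<le> 0" by simp
    have "real q powi (1 + int (multiplicity q a) - int (multiplicity q e)) \<le> real q powi 0"
      by (rule power_int_increasing[OF le]) (use prime_ge_1_nat[OF q(1)] in simp)
    then show False using ma[OF q] N0 X'_ge(2) X1 by simp
  qed
  have count: "int (card Z) * d \<le> int (card {v \<in> P - S. \<exists>c\<in>Z. vord v (f0 - emb c) > 0}) + X * d"
    if "finite Z" for Z
    unfolding d_def X_def using x.value_count[OF x.trace_nonzero[OF f0(2)] that S polesS] by simp
  have res: "vge v 1 (\<Sum>i=1..m. emb (\<epsilon> i powi k * ((c ^ D) powi k) powi r i) * lam i)"
    if v: "v \<in> P - S" and c: "vord v (f0 - emb c) > 0" "c ^ a = 1" for v c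
  proof (rule residue_of_power_sum[where f = f and a = a])
    show "v \<in> P" using v by simp
    show "vge v 0 (lam i)" if "i \<in> {1..m}" for i using lam that v by blast
    have "vge v 1 (f0 - emb c)" using c(1) by (simp add: vge_def)
    from vge_residue_power[OF _ this, of D] show "vge v 1 (f - emb (c ^ D))"
      using v f0(1) by (simp add: D_def)
    show "c ^ D \<noteq> 0" using c(2) \<open>a > 0\<close> by (auto simp: power_0_left)
    show "(c ^ D) ^ a = 1" using c(2) by (metis mult.commute power_mult power_one)
    show "min 1 (v (f ^ a - 1)) \<le> v (\<Sum>i=1..m. lam i * (emb (\<epsilon> i) * f powi r i) powi k)"
      using assms(18) v by (auto simp: B_def)
  qed
  have zeros_le: "real (card (zeros (\<Sum>i=1..m. emb (c i) * lam i))) \<le> \<rho> * real_of_int d" for c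
  proof -
    have "int (card (zeros (\<Sum>i=1..m. emb (c i) * lam i))) \<le> h"
      unfolding h_def by (rule order_trans[OF card_zeros_le pole_degree_combination_le]) simp
    then have "real (card (zeros (\<Sum>i=1..m. emb (c i) * lam i))) \<le> real_of_int h" by linarith
    then show ?thesis using h_le by linarith
  qed
  show ?thesis
  proof (intro conjI impI)
    assume ek: "int e dvd k"
    show sum0: "(\<Sum>i=1..m. lam i) = 0"
    proof (rule ccontr)
      assume L0: "(\<Sum>i=1..m. lam i) \<noteq> 0"
      have "e dvd a"
      proof (rule multiplicity_le_imp_dvd)
        fix q :: nat assume "prime q"
        then show "multiplicity q e \<le> multiplicity q a"
          using mult_le[of q] by (cases "q dvd e") (simp_all add: not_dvd_imp_multiplicity_0)
      qed (use e0 in simp)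
      \<comment> \<open>For every such value \<open>c\<close> the factors
        \<open>\<epsilon> i powi k\<close> and \<open>(c ^ D) powi k\<close> are 1, so all points
        found are zeros of the one function \<Sum> \<open>lam i\<close>.\<close>
      define Z where "Z = {c :: 'k. c ^ e = 1}"
      have "\<not> CHAR('k) dvd e" using assms(14) e0 by (cases "CHAR('k) = 0") auto
      then have Z: "card Z = e" unfolding Z_def using card_roots_of_unity e0 by blast
      then have fZ: "finite Z" using e0 card_ge_0_finite by force
      have unit: "c powi k = 1" if "c ^ e = 1" for c :: 'k
      proof -
        obtain j where "k = int e * j" using ek by blast
        then show ?thesis using that by (simp add: power_int_mult)
      qed
      have "{v \<in> P - S. \<exists>c\<in>Z. vord v (f0 - emb c) > 0} \<subseteq> zeros (\<Sum>i=1..m. emb 1 * lam i)"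
      proof clarify
        fix v c assume v: "v \<in> P" "v \<notin> S" and c: "c \<in> Z" "vord v (f0 - emb c) > 0"
        have ce: "c ^ e = 1" using c by (simp add: Z_def)
        have ca: "c ^ a = 1" using \<open>e dvd a\<close> ce by (auto simp: power_mult elim!: dvdE)
        have "(c ^ D) ^ e = 1" using ce by (metis mult.commute power_mult power_one)
        then have 1: "(c ^ D) powi k = 1" by (rule unit)
        have "(\<Sum>i=1..m. emb (\<epsilon> i powi k * ((c ^ D) powi k) powi r i) * lam i) = (\<Sum>i=1..m. emb 1 * lam i)"
          unfolding 1 by (intro sum.cong refl) (use unit assms(15) in simp)
        then have "vge v 1 (\<Sum>i=1..m. emb 1 * lam i)" using res[of v c] v c ca by simp
        then show "v \<in> zeros (\<Sum>i=1..m. emb 1 * lam i)"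
          using L0 v by (simp add: zeros_def vge_def emb_one)
      qed
      from card_mono[OF finite_zeros this]
      have "real (card {v \<in> P - S. \<exists>c\<in>Z. vord v (f0 - emb c) > 0}) \<le> \<rho> * real_of_int d"
        using zeros_le[of "\<lambda>_. 1"] by linarith
      moreover have "real_of_int (int (card Z) * d) \<le>
          real_of_int (int (card {v \<in> P - S. \<exists>c\<in>Z. vord v (f0 - emb c) > 0}) + X * d)"
        using count[OF fZ] by (simp only: of_int_le_iff)
      ultimately have "real e * real_of_int d \<le> (\<rho> + real_of_int X) * real_of_int d"
        by (simp add: Z algebra_simps)
      then have "real e \<le> \<rho> + real_of_int X" using d1 by simp
      then show False using e_gt X'_ge(2) X1 rho by linarith
    qed
    show "B 0 = 0" using sum0 by (simp add: B_def)
  next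
    assume ek: "\<not> int e dvd k"
    have k0: "k \<noteq> 0" using ek by auto
    define K where "K = nat \<bar>k\<bar>"
    have K0: "K > 0" using k0 by (simp add: K_def)
    have "\<not> e dvd K" using ek by (simp add: K_def flip: int_dvd_int_iff)
    then obtain q where q: "prime q" "multiplicity q K < multiplicity q e"
      using multiplicity_le_imp_dvd[of e K] e0 by (metis not_gr_zero not_le)
    have qe: "q dvd e" using q(2) by (metis not_dvd_imp_multiplicity_0 not_less_zero)
    define \<alpha> where "\<alpha> = multiplicity q a"
    define \<kappa> where "\<kappa> = multiplicity q K"
    have le: "\<kappa> < multiplicity q e" "multiplicity q e \<le> \<alpha>"
      using q mult_le[OF q(1) qe] by (auto simp: \<alpha>_def \<kappa>_def)
    \<comment> \<open>The order of \<open>w ^ k\<close>: raising to the power \<open>k\<close>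
      divides the order q^\<alpha> of \<open>w\<close> by q^\<kappa>. As \<kappa> is at least one
      less than its allowed limit \<open>multiplicity q e\<close>, the exponent reaches that of the
      hypothesis.\<close>
    define M where "M = q ^ (\<alpha> - \<kappa>)"
    have M_gt: "real M > real_of_int N + X'"
    proof -
      have "real q powi (1 + int \<alpha> - int (multiplicity q e)) \<le> real q powi int (\<alpha> - \<kappa>)"
        by (rule power_int_increasing) (use le prime_ge_1_nat[OF q(1)] in auto)
      also have "\<dots> = real M" by (simp add: M_def)
      finally show ?thesis using ma[OF q(1) qe] by (simp add: \<alpha>_def)
    qed
    have qp: "q \<noteq> CHAR('k)" using assms(14) qe q(1) by (auto simp: prime_gt_0_nat)
    obtain w :: 'k where w: "w ^ q ^ \<alpha> = 1" "\<And>j. w powi j = 1 \<Longrightarrow> int (q ^ \<alpha>) dvd j"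
      using prime_power_root_of_unity[OF q(1) qp] by blast
    have w0: "w \<noteq> 0" using w(1) q(1) by (auto simp: power_0_left)
    have wa: "(w ^ j) ^ a = 1" for j
    proof -
      have "q ^ \<alpha> dvd a" unfolding \<alpha>_def by (rule multiplicity_dvd)
      then obtain b where "a = q ^ \<alpha> * b" by blast
      then have "(w ^ j) ^ a = (w ^ q ^ \<alpha>) ^ (b * j)" by (simp add: mult_ac flip: power_mult)
      then show ?thesis using w(1) by simp
    qed
    define \<eta> where "\<eta> = (\<lambda>j. ((w ^ j) ^ D) powi k)"
    have \<eta>0: "\<eta> j \<noteq> 0" for j using w0 by (simp add: \<eta>_def)
    \<comment> \<open>\<open>D\<close> is 1 or a power of the characteristic, and \<open>q\<close>
      divides \<open>e\<close>, which the characteristic does not. Hence the D-th power loses no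
      values.\<close>
    have qD: "\<not> q dvd D"
    proof
      assume "q dvd D"
      moreover obtain l where "D = (if CHAR('a) = 0 then 1 else CHAR('a) ^ l)" using f0(3) by (auto simp: D_def)
      ultimately have "CHAR('a) \<noteq> 0" "q dvd CHAR('a)"
        using q(1) by (auto split: if_splits dest: prime_dvd_power)
      moreover then have "prime CHAR('a)" using prime_CHAR_semidom by blast
      ultimately show False using qp q(1) primes_dvd_imp_eq by (metis CHAR_eq)
    qed
    have inj: "inj_on \<eta> {..<M}"
    proof (rule inj_onI)
      fix i j assume ij: "i \<in> {..<M}" "j \<in> {..<M}" "\<eta> i = \<eta> j"
      have \<eta>w: "\<eta> j = w powi (int j * int D * k)" for j
        by (simp add: \<eta>_def power_int_mult power_int_of_nat flip: power_mult)
      have "w powi (int i * int D * k - int j * int D * k) = 1"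
        using ij(3) w0 unfolding \<eta>w by (simp add: power_int_diff)
      then have "int (q ^ \<alpha>) dvd int i * int D * k - int j * int D * k" by (rule w(2))
      also have "int i * int D * k - int j * int D * k = (int i - int j) * int D * k" by (simp add: algebra_simps)
      finally have "nat \<bar>int (q ^ \<alpha>)\<bar> dvd nat \<bar>(int i - int j) * int D * k\<bar>" by (simp add: nat_abs_dvd_iff)
      then have dv: "q ^ \<alpha> dvd nat \<bar>int i - int j\<bar> * D * K"
        by (simp add: K_def nat_abs_mult_distrib nat_power_eq)
      show "i = j"
      proof (rule ccontr)
        assume "i \<noteq> j"
        then have nz: "nat \<bar>int i - int j\<bar> \<noteq> 0" by simp
        have mult: "multiplicity q (nat \<bar>int i - int j\<bar> * D * K) =
            multiplicity q (nat \<bar>int i - int j\<bar>) + multiplicity q D + multiplicity q K"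
          using q(1) nz D0 K0 by (simp add: prime_elem_multiplicity_mult_distrib)
        have "\<alpha> \<le> multiplicity q (nat \<bar>int i - int j\<bar> * D * K)"
          by (rule multiplicity_geI[OF _ _ dv]) (use nz D0 K0 prime_gt_1_nat[OF q(1)] in auto)
        then have "\<alpha> - \<kappa> \<le> multiplicity q (nat \<bar>int i - int j\<bar>)"
          unfolding mult \<kappa>_def using not_dvd_imp_multiplicity_0[OF qD] by simp
        then have "M dvd nat \<bar>int i - int j\<bar>" unfolding M_def by (rule multiplicity_dvd')
        then have "M \<le> nat \<bar>int i - int j\<bar>" using nz by (intro dvd_imp_le) auto
        then show False using ij by auto
      qed
    qed
    define c where "c = (\<lambda>j i. \<epsilon> i powi k * \<eta> j powi r i)"
    define L where "L = (\<lambda>j. \<Sum>i=1..m. emb (c j i) * lam i)"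
    define b where "b = Min (r ` {1..m})"
    have br: "b \<le> r i" "r i - b \<le> N" if "i \<in> {1..m}" for i
    proof -
      have "b \<le> r i" "r i \<le> Max (r ` {1..m})" unfolding b_def using that by auto
      then show "b \<le> r i" "r i - b \<le> N" unfolding N_def b_def by linarith+
    qed
    \<comment> \<open>The Laurent polynomial of the claim, shifted by its least exponent into an
      ordinary polynomial over K of degree at most \<open>N\<close>.\<close>
    define G where "G = (\<Sum>i=1..m. monom (lam i * emb (\<epsilon> i powi k)) (nat (r i - b)))"
    have LG: "L j = emb (\<eta> j) powi b * poly G (emb (\<eta> j))" for j
    proof -
      have "L j = (\<Sum>i=1..m. (lam i * emb (\<epsilon> i powi k)) * emb (\<eta> j) powi r i)"
        unfolding L_def c_def by (intro sum.cong refl) (simp add: emb_mult emb_powi)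
      also have "\<dots> = emb (\<eta> j) powi b * poly G (emb (\<eta> j))"
        unfolding G_def by (rule powi_sum_as_poly) (use \<eta>0 br in auto)
      finally show ?thesis .
    qed
    have "G = 0"
    proof (rule ccontr)
      assume G0: "G \<noteq> 0"
      have degG: "degree G \<le> nat N" unfolding G_def
      proof (rule degree_sum_le)
        fix i assume i: "i \<in> {1..m}"
        show "degree (monom (lam i * emb (\<epsilon> i powi k)) (nat (r i - b))) \<le> nat N"
          by (rule order_trans[OF degree_monom_le]) (use br(2)[OF i] in simp)
      qed simp
      \<comment> \<open>Distinct \<eta> j with \<open>L j = 0\<close> are distinct roots of
        \<open>G\<close>, so at most \<open>N\<close> indices are lost and more than
        \<open>X'\<close> remain.\<close>
      define J where "J = {j \<in> {..<M}. L j \<noteq> 0}"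
      have "card ({..<M} - J) \<le> nat N"
      proof -
        have inj': "inj_on (\<lambda>j. emb (\<eta> j)) ({..<M} - J)"
          using inj emb_inj by (auto simp: inj_on_def)
        have "(\<lambda>j. emb (\<eta> j)) ` ({..<M} - J) \<subseteq> {y. poly G y = 0}"
          using LG \<eta>0 by (auto simp: J_def)
        then have "card ((\<lambda>j. emb (\<eta> j)) ` ({..<M} - J)) \<le> card {y. poly G y = 0}"
          by (intro card_mono poly_roots_finite G0)
        also have "\<dots> \<le> degree G" by (rule card_poly_roots_bound[OF G0])
        finally show ?thesis using degG card_image[OF inj'] by simp
      qed
      moreover have "card ({..<M} - J) = M - card J"
        by (subst card_Diff_subset) (auto simp: J_def)
      ultimately have "real (card J) \<ge> real M - real_of_int N" using N0 by linarith
      then have cJ: "real (card J) > X'" using M_gt by linarith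
      have fJ: "finite J" by (simp add: J_def)
      define Z where "Z = (\<lambda>j. w ^ j) ` J"
      have injw: "inj_on (\<lambda>j. w ^ j) J"
      proof (rule inj_onI)
        fix i j assume "i \<in> J" "j \<in> J" "w ^ i = w ^ j"
        then show "i = j" using inj by (auto simp: inj_on_def J_def \<eta>_def)
      qed
      have Z: "finite Z" "card Z = card J" unfolding Z_def using fJ card_image[OF injw] by auto
      have "{v \<in> P - S. \<exists>c\<in>Z. vord v (f0 - emb c) > 0} \<subseteq> (\<Union>j\<in>J. zeros (L j))"
      proof clarify
        fix v z assume v: "v \<in> P" "v \<notin> S" and z: "z \<in> Z" "vord v (f0 - emb z) > 0"
        then obtain j where j: "j \<in> J" "z = w ^ j" by (auto simp: Z_def)
        have "vge v 1 (L j)" using res[of v z] v z wa unfolding L_def c_def \<eta>_def j(2) by simp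
        then have "v \<in> zeros (L j)" using j v by (simp add: zeros_def vge_def J_def)
        then show "v \<in> (\<Union>j\<in>J. zeros (L j))" using j by blast
      qed
      then have "card {v \<in> P - S. \<exists>c\<in>Z. vord v (f0 - emb c) > 0} \<le> card (\<Union>j\<in>J. zeros (L j))"
        by (intro card_mono) (use fJ finite_zeros in auto)
      also have "\<dots> \<le> (\<Sum>j\<in>J. card (zeros (L j)))" by (rule card_UN_le[OF fJ])
      finally have "real (card {v \<in> P - S. \<exists>c\<in>Z. vord v (f0 - emb c) > 0}) \<le> (\<Sum>j\<in>J. real (card (zeros (L j))))"
        by (simp flip: of_nat_sum)
      also have "\<dots> \<le> (\<Sum>j\<in>J. \<rho> * real_of_int d)" unfolding L_def by (intro sum_mono zeros_le)
      finally have "real (card {v \<in> P - S. \<exists>c\<in>Z. vord v (f0 - emb c) > 0}) \<le> real (card J) * (\<rho> * real_of_int d)"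
        by simp
      moreover have "real_of_int (int (card Z) * d) \<le>
          real_of_int (int (card {v \<in> P - S. \<exists>c\<in>Z. vord v (f0 - emb c) > 0}) + X * d)"
        using count[OF Z(1)] by (simp only: of_int_le_iff)
      \<comment> \<open>Each \<open>L j\<close> with \<open>j\<close> in \<open>J\<close> has at
        most \<rho> d zeros, and together they must contain the points over the values in
        \<open>Z\<close>, at least (|J| - X) d in number.\<close>
      ultimately have "(real (card J) * (1 - \<rho>)) * real_of_int d \<le> real_of_int X * real_of_int d"
        by (simp add: Z algebra_simps)
      then have "real (card J) * (1 - \<rho>) \<le> real_of_int X" using d1 by simp
      moreover have "X' * (1 - \<rho>) < real (card J) * (1 - \<rho>)" using cJ rho by simp
      ultimately show False using X'_ge(1) by linarith
    qed
    have "(\<Sum>i=1..m. Poly_Mapping.single (r i) (lam i * emb (\<epsilon> i powi k))) = 0"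
      by (rule single_sum_eq_0[where b = b]) (use br \<open>G = 0\<close> in \<open>auto simp: G_def\<close>)
    then show "(\<Sum>i=1..m. Poly_Mapping.single (r i) (lam i * emb (\<epsilon> i) powi k)) = 0"
      by (simp add: emb_powi)
    have f_nz: "f \<noteq> 0" using f0(1) x.x_nonzero by (metis power_not_zero)
    \<comment> \<open>\<open>B k\<close> is the same Laurent polynomial evaluated at
      \<open>f powi k\<close>.\<close>
    have "B k = (\<Sum>i=1..m. (lam i * emb (\<epsilon> i powi k)) * (f powi k) powi r i)"
      unfolding B_def
    proof (rule sum.cong[OF refl])
      fix i
      have "(f powi r i) powi k = (f powi k) powi r i" by (simp add: mult.commute flip: power_int_mult)
      then show "lam i * (emb (\<epsilon> i) * f powi r i) powi k = lam i * emb (\<epsilon> i powi k) * (f powi k) powi r i"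
        by (simp add: power_int_mult_distrib emb_powi)
    qed
    also have "\<dots> = (f powi k) powi b * poly G (f powi k)"
      unfolding G_def by (rule powi_sum_as_poly) (use f_nz br in auto)
    finally show "B k = 0" using \<open>G = 0\<close> by simp
  qed
qed

end
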